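(* There exists an absolute constant $c>0$ such that the following holds. Let $C$ be an isotropic convex body in $\mathbb{R}^n$ and let $K$ be a centrally symmetric convex body in $\mathbb{R}^n$. Then, for every $s\ge 1$ and every $\mathbf{t}=(t_1,\ldots,t_s)\in\mathbb{R}^s$, $$\|\mathbf{t}\|_{C^s,K}\ \le\ c\,\Big(L_C\max\Big\{\sqrt[4]{n},\sqrt{\log(1+s)}\Big\}\Big)\,\sqrt{n}\,M(K)\,\|\mathbf{t}\|_2 .$$
   Context: A convex body in $\mathbb{R}^n$ is a compact convex set with non-empty interior; it is centrally symmetric if $-K=K$. $\|x\|_K=\inf\{r>0:x\in rK\}$. A convex body $C$ is isotropic if it has volume $1$, its barycenter is at the origin, and there is a constant $L_C>0$ (the isotropic constant) with $\int_C\langle x,\xi\rangle^2dx=L_C^2$ for all $\xi\in S^{n-1}$. $M(K)=\int_{S^{n-1}}\|\xi\|_K\,d\sigma(\xi)$, where $\sigma$ is the rotationally invariant probability measure on $S^{n-1}$. For $\mathrm{vol}_n(C)=1$, $$\|\mathbf{t}\|_{C^s,K}=\int_C\cdots\int_C\Big\|\sum_{j=1}^st_jx_j\Big\|_K\,dx_1\cdots dx_s .$$ "Absolute constant" means independent of $n,s,C,K,\mathbf{t}$. *)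

theory Defs
  imports "HOL-Analysis.Analysis"
begin

text \<open>
  The constant in the theorem must not depend on the dimension, so the dimension has to be a
  natural number bound inside the formula rather than a type. We therefore take the library's
  \<^const>\<open>Euclidean_space\<close> \<open>n\<close>: the vectors \<open>x :: nat \<Rightarrow> real\<close> with \<open>x i = 0\<close> for \<open>i \<ge> n\<close>.
  Coordinates are indexed by \<open>{..<n}\<close>.
\<close>

abbreviation Rn :: "nat \<Rightarrow> (nat \<Rightarrow> real) set"
  where "Rn n \<equiv> topspace (Euclidean_space n)"

definition inner_n :: "nat \<Rightarrow> (nat \<Rightarrow> real) \<Rightarrow> (nat \<Rightarrow> real) \<Rightarrow> real"
  where "inner_n n x y = (\<Sum>i<n. x i * y i)"

text \<open>The unit sphere \<open>S\<^sup>n\<^sup>-\<^sup>1\<close> of \<open>Rn n\<close>.\<close>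

definition unit_sphere :: "nat \<Rightarrow> (nat \<Rightarrow> real) set"
  where "unit_sphere n = {x \<in> Rn n. L2_set x {..<n} = 1}"

text \<open>
  Lebesgue measure on \<open>Rn n\<close>, viewed as a Borel measure on \<open>nat \<Rightarrow> real\<close> concentrated on \<open>Rn n\<close>.
  Elements of the product space are \<^const>\<open>undefined\<close> outside \<open>{..<n}\<close>; the push-forward replaces
  this value by \<open>0\<close>.
\<close>

definition lborel_n :: "nat \<Rightarrow> (nat \<Rightarrow> real) measure"
  where "lborel_n n =
    distr (Pi\<^sub>M {..<n} (\<lambda>_. lborel)) borel (\<lambda>x i. if i < n then x i else 0)"

definition convex_body :: "nat \<Rightarrow> (nat \<Rightarrow> real) set \<Rightarrow> bool"
  where "convex_body n K \<longleftrightarrow>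
    compactin (Euclidean_space n) K \<and>
    (\<forall>x\<in>K. \<forall>y\<in>K. \<forall>u\<ge>0. \<forall>v\<ge>0. u + v = 1 \<longrightarrow> (\<lambda>i. u * x i + v * y i) \<in> K) \<and>
    (Euclidean_space n) interior_of K \<noteq> {}"

definition centrally_symmetric :: "(nat \<Rightarrow> real) set \<Rightarrow> bool"
  where "centrally_symmetric K \<longleftrightarrow> (\<lambda>x i. - x i) ` K = K"

definition gauge_norm :: "(nat \<Rightarrow> real) set \<Rightarrow> (nat \<Rightarrow> real) \<Rightarrow> real"
  where "gauge_norm K x = Inf {r. r > 0 \<and> x \<in> (\<lambda>y i. r * y i) ` K}"

text \<open>Since the volume is \<open>1\<close>, the barycenter of \<open>C\<close> is \<open>\<integral>\<^sub>C x dx\<close>, taken coordinatewise.\<close>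

definition isotropic :: "nat \<Rightarrow> (nat \<Rightarrow> real) set \<Rightarrow> bool"
  where "isotropic n C \<longleftrightarrow>
    emeasure (lborel_n n) C = 1 \<and>
    (\<forall>i<n. (LINT x:C|lborel_n n. x i) = 0) \<and>
    (\<exists>L>0. \<forall>\<xi>\<in>unit_sphere n. (LINT x:C|lborel_n n. (inner_n n x \<xi>)\<^sup>2) = L\<^sup>2)"

definition isotropic_constant :: "nat \<Rightarrow> (nat \<Rightarrow> real) set \<Rightarrow> real"
  where "isotropic_constant n C =
    (THE L. L > 0 \<and> (\<forall>\<xi>\<in>unit_sphere n. (LINT x:C|lborel_n n. (inner_n n x \<xi>)\<^sup>2) = L\<^sup>2))"

text \<open>Orthogonal matrices (\<open>A\<^sup>T A = I\<close>), with entries outside \<open>n \<times> n\<close> irrelevant.\<close>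

definition orthogonal_n :: "nat \<Rightarrow> (nat \<Rightarrow> nat \<Rightarrow> real) \<Rightarrow> bool"
  where "orthogonal_n n A \<longleftrightarrow>
    (\<forall>i<n. \<forall>j<n. (\<Sum>k<n. A k i * A k j) = (if i = j then 1 else 0))"

definition apply_n :: "nat \<Rightarrow> (nat \<Rightarrow> nat \<Rightarrow> real) \<Rightarrow> (nat \<Rightarrow> real) \<Rightarrow> (nat \<Rightarrow> real)"
  where "apply_n n A x = (\<lambda>i. if i < n then (\<Sum>j<n. A i j * x j) else 0)"

text \<open>
  \<open>\<sigma>\<close> is a rotationally invariant Borel probability measure on the unit sphere of \<open>Rn n\<close>. For
  \<open>n \<ge> 1\<close> exactly one such \<open>\<sigma>\<close> exists. Invariance is required under the full orthogonal group,
  because for \<open>n = 1\<close> the proper rotations alone do not determine \<open>\<sigma>\<close>.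
\<close>

definition rotation_invariant_prob :: "nat \<Rightarrow> (nat \<Rightarrow> real) measure \<Rightarrow> bool"
  where "rotation_invariant_prob n \<sigma> \<longleftrightarrow>
    space \<sigma> = unit_sphere n \<and>
    sets \<sigma> = sets (restrict_space borel (unit_sphere n)) \<and>
    emeasure \<sigma> (space \<sigma>) = 1 \<and>
    (\<forall>A. orthogonal_n n A \<longrightarrow> distr \<sigma> \<sigma> (apply_n n A) = \<sigma>)"

definition mean_norm :: "(nat \<Rightarrow> real) measure \<Rightarrow> (nat \<Rightarrow> real) set \<Rightarrow> real"
  where "mean_norm \<sigma> K = (LINT \<xi>|\<sigma>. gauge_norm K \<xi>)"

text \<open>
  \<open>\<parallel>t\<parallel>\<close> with respect to \<open>C\<^sup>s\<close> and \<open>K\<close>; the \<open>s\<close>-fold integral over \<open>C \<times> \<dots> \<times> C\<close> is an integral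
  with respect to the product measure, and only \<open>t 0, \<dots>, t (s - 1)\<close> are used.
\<close>

definition multi_norm ::
    "nat \<Rightarrow> nat \<Rightarrow> (nat \<Rightarrow> real) set \<Rightarrow> (nat \<Rightarrow> real) set \<Rightarrow> (nat \<Rightarrow> real) \<Rightarrow> real"
  where "multi_norm n s C K t =
    (LINT x : ({..<s} \<rightarrow>\<^sub>E C) | Pi\<^sub>M {..<s} (\<lambda>_. lborel_n n). gauge_norm K (\<lambda>i. \<Sum>j<s. t j * x j i))"

end

theory Submission
  imports Defs "HOL-Probability.Distributions" "HOL-Library.Function_Algebras"
begin

text \<open>
  Let \<open>T\<close> be the polar body of \<open>K\<close>, \<open>S = \<Sum> t\<^sub>j x\<^sub>j\<close> and \<open>W = sqrt n * M(K)\<close>. The norm of \<open>S\<close> is the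
  supremum of \<open>\<langle>S, \<theta>\<rangle>\<close> over \<open>\<theta> \<in> T\<close>, and it is bounded by chaining through finite nets \<open>T\<^sub>k\<close> of \<open>T\<close> with
  radius of order \<open>W / 2 ^ k\<close>. Three facts are used, where \<open>L\<close> is the isotropic constant and \<open>\<tau>\<close> the
  Euclidean norm of \<open>t\<close>.

  \<^item> \<open>\<langle>S, \<theta>\<rangle>\<close> has a bounded exponential moment at the scale \<open>L \<tau> \<bar>\<theta>\<bar>\<close>. Therefore the maximum of \<open>N\<close> such
    functionals has mean of order \<open>L \<tau> max \<bar>\<theta>\<bar> * ln N\<close>.
  \<^item> The Euclidean norm of \<open>S\<close> has mean of order \<open>sqrt n * L \<tau>\<close>.
  \<^item> Sudakov's inequality: the nets can be chosen with \<open>ln (card T\<^sub>k)\<close> of order \<open>4 ^ k\<close>.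

  The links at level \<open>k\<close> then cost \<open>L \<tau> * W / 2 ^ k * 4 ^ k = 2 ^ k * L \<tau> W\<close>. If the chain stops at level
  \<open>m\<close>, the links cost \<open>2 ^ m * L \<tau> W\<close> altogether, and the remaining step, of length \<open>W / 2 ^ m\<close>, is
  paid for with the Euclidean norm: \<open>sqrt n / 2 ^ m * L \<tau> W\<close>. The two are balanced at
  \<open>2 ^ m = root 4 n\<close>, which gives \<open>root 4 n * L \<tau> W\<close>; this is \<open>chaining\<close> and \<open>gauge_mean_le\<close>.

  The exponential moment rests on the Prekopa-Leindler inequality. It makes the volumes of the
  sections of \<open>C\<close> by parallel half-spaces log-concave, so that they decay exponentially once they
  drop at all (\<open>half_space_volume_decay\<close>). Since the barycentre is \<open>0\<close>, the Laplace transform is even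
  sub-Gaussian near the origin; it multiplies over the independent summands, and this produces
  \<open>\<tau>\<close> (\<open>exp_moment_weighted_sum\<close>).

  Sudakov's inequality is first proved in its dual form: a ball is covered by few translates
  of a multiple of \<open>K\<close>, because disjoint translates of a symmetric set of large Gaussian measure
  cannot be too many (\<open>gauss_packing\<close>, \<open>ball_net\<close>). It is transferred to coverings of \<open>T\<close> by balls
  with the duality argument of Tomczak-Jaegermann (\<open>polar_net_refine\<close>). The Gaussian mean of the norm
  is compared with \<open>W\<close> in \<open>gauss_average_le\<close>, using nothing but the invariance of \<open>\<sigma>\<close> and of
  Lebesgue measure under reflections.
\<close>

section \<open>Vectors of \<open>Rn n\<close>\<close>

abbreviation (input) norm_n :: "nat \<Rightarrow> (nat \<Rightarrow> real) \<Rightarrow> real"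
  where "norm_n n x \<equiv> L2_set x {..<n}"

abbreviation (input) scale :: "real \<Rightarrow> (nat \<Rightarrow> real) \<Rightarrow> nat \<Rightarrow> real"
  where "scale r x \<equiv> (\<lambda>i. r * x i)"

lemma Rn_iff: "x \<in> Rn n \<longleftrightarrow> (\<forall>i\<ge>n. x i = 0)"
  by (simp add: topspace_Euclidean_space)

lemma Rn_closed:
  "0 \<in> Rn n"
  "x \<in> Rn n \<Longrightarrow> y \<in> Rn n \<Longrightarrow> x + y \<in> Rn n"
  "x \<in> Rn n \<Longrightarrow> y \<in> Rn n \<Longrightarrow> x - y \<in> Rn n"
  "x \<in> Rn n \<Longrightarrow> - x \<in> Rn n"
  "x \<in> Rn n \<Longrightarrow> scale r x \<in> Rn n"
  by (auto simp: Rn_iff)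

lemma inner_n_simps:
  "inner_n n (x + y) z = inner_n n x z + inner_n n y z"
  "inner_n n (x - y) z = inner_n n x z - inner_n n y z"
  "inner_n n (- x) z = - inner_n n x z"
  "inner_n n (scale r x) z = r * inner_n n x z"
  "inner_n n z (x + y) = inner_n n z x + inner_n n z y"
  "inner_n n z (x - y) = inner_n n z x - inner_n n z y"
  "inner_n n z (- x) = - inner_n n z x"
  "inner_n n z (scale r x) = r * inner_n n z x"
  "inner_n n 0 z = 0" "inner_n n z 0 = 0"
  by (simp_all add: inner_n_def algebra_simps sum.distrib sum_subtractf sum_negf sum_distrib_left)

lemma inner_n_commute: "inner_n n x y = inner_n n y x"
  by (simp add: inner_n_def mult.commute)

lemma norm_n_sq: "(norm_n n x)\<^sup>2 = inner_n n x x"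
  by (simp add: L2_set_def inner_n_def sum_nonneg power2_eq_square)

lemma norm_n_sq_sum: "(norm_n n x)\<^sup>2 = (\<Sum>i<n. (x i)\<^sup>2)"
  by (simp add: L2_set_def sum_nonneg)

lemma inner_n_le: "\<bar>inner_n n x y\<bar> \<le> norm_n n x * norm_n n y"
proof -
  have "\<bar>inner_n n x y\<bar> \<le> (\<Sum>i<n. \<bar>x i\<bar> * \<bar>y i\<bar>)"
    unfolding inner_n_def by (rule order_trans[OF sum_abs]) (simp add: abs_mult)
  also have "\<dots> \<le> norm_n n x * norm_n n y"
    by (rule L2_set_mult_ineq)
  finally show ?thesis .
qed

lemma norm_n_scale: "norm_n n (scale r x) = \<bar>r\<bar> * norm_n n x"
proof -
  have "(norm_n n (scale r x))\<^sup>2 = (\<bar>r\<bar> * norm_n n x)\<^sup>2"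
    by (simp add: norm_n_sq inner_n_simps power_mult_distrib) (simp add: power2_eq_square)
  then show ?thesis
    by (rule power2_eq_imp_eq) auto
qed

lemma norm_n_triangle: "norm_n n (x + y) \<le> norm_n n x + norm_n n y"
  unfolding plus_fun_def by (rule L2_set_triangle_ineq)

lemma norm_n_minus: "norm_n n (- x) = norm_n n x"
  by (simp add: L2_set_def)

lemma norm_n_diff_commute: "norm_n n (x - y) = norm_n n (y - x)"
  by (simp add: L2_set_def power2_commute)

lemma norm_n_triangle_diff: "norm_n n (x - z) \<le> norm_n n (x - y) + norm_n n (y - z)"
  using norm_n_triangle[where x = "x - y" and y = "y - z"] by simp

lemma norm_n_zero: "norm_n n 0 = 0"
  by (simp add: L2_set_def)

lemma norm_n_eq_0: "x \<in> Rn n \<Longrightarrow> norm_n n x = 0 \<longleftrightarrow> x = 0"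
  by (auto simp: L2_set_eq_0_iff Rn_iff fun_eq_iff) (metis lessThan_iff not_le)

lemma norm_n_pos: "x \<in> Rn n \<Longrightarrow> x \<noteq> 0 \<Longrightarrow> 0 < norm_n n x"
  using norm_n_eq_0[of x n] L2_set_nonneg[of x "{..<n}"] by linarith

lemma abs_coord_le_norm_n: "i < n \<Longrightarrow> \<bar>x i\<bar> \<le> norm_n n x"
  using member_le_L2_set[of "{..<n}" i "\<lambda>i. \<bar>x i\<bar>"] by (simp add: L2_set_def)

lemma unit_sphere_normalize:
  assumes "x \<in> Rn n" "x \<noteq> 0"
  shows "scale (1 / norm_n n x) x \<in> unit_sphere n"
  unfolding unit_sphere_def
  using assms norm_n_pos[OF assms] Rn_closed(5)[of x n "1 / norm_n n x"] by (simp add: norm_n_scale[where r = "1 / norm_n n x", simplified])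

lemma continuous_on_coord [continuous_intros]:
  "continuous_on S (\<lambda>x::nat \<Rightarrow> real. x i)"
  by (rule continuous_on_subset[OF continuous_on_product_coordinates]) simp

lemma continuous_on_norm_n [continuous_intros]:
  assumes "\<And>i. continuous_on S (\<lambda>x. f x i)"
  shows "continuous_on S (\<lambda>x. norm_n n (f x))"
  unfolding L2_set_def by (intro continuous_intros assms)

lemma continuous_on_inner_n [continuous_intros]:
  assumes "\<And>i. continuous_on S (\<lambda>x. f x i)" "\<And>i. continuous_on S (\<lambda>x. g x i)"
  shows "continuous_on S (\<lambda>x. inner_n n (f x) (g x))"
  unfolding inner_n_def by (intro continuous_intros assms)

lemma measurable_coord [measurable]: "(\<lambda>x::nat \<Rightarrow> real. x i) \<in> borel_measurable borel"
  by (intro borel_measurable_continuous_onI continuous_intros)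

lemma measurable_coord' [measurable (raw)]:
  fixes f :: "'a \<Rightarrow> nat \<Rightarrow> real"
  assumes "f \<in> borel_measurable M"
  shows "(\<lambda>x. f x i) \<in> borel_measurable M"
  using measurable_compose[OF assms measurable_coord] .

lemma measurable_coordI:
  fixes f :: "'a \<Rightarrow> nat \<Rightarrow> real"
  assumes "\<And>i. (\<lambda>x. f x i) \<in> borel_measurable M"
  shows "f \<in> borel_measurable M"
  using measurable_coordinatewise_then_product[where f = f and M = M] assms by simp

lemma measurable_vec [measurable (raw)]:
  fixes f g :: "'a \<Rightarrow> nat \<Rightarrow> real"
  assumes [measurable]: "f \<in> borel_measurable M" "g \<in> borel_measurable M" "r \<in> borel_measurable M"
  shows "(\<lambda>x. f x + g x) \<in> borel_measurable M"
    "(\<lambda>x. f x - g x) \<in> borel_measurable M"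
    "(\<lambda>x. - f x) \<in> borel_measurable M"
    "(\<lambda>x. scale (r x) (f x)) \<in> borel_measurable M"
  by (rule measurable_coordI, simp, measurable)+

lemma measurable_norm_n [measurable (raw)]:
  assumes [measurable]: "f \<in> borel_measurable M"
  shows "(\<lambda>x. norm_n n (f x)) \<in> borel_measurable M"
  unfolding L2_set_def by measurable

lemma measurable_inner_n [measurable (raw)]:
  assumes [measurable]: "f \<in> borel_measurable M" "g \<in> borel_measurable M"
  shows "(\<lambda>x. inner_n n (f x) (g x)) \<in> borel_measurable M"
  unfolding inner_n_def by measurable

lemma closed_Rn: "closed (Rn n)"
  using closedin_Euclidean_space closed_closedin by (metis euclidean_product_topology)

lemma Rn_borel [measurable]: "Rn n \<in> sets borel"
  using closed_Rn by simp

section \<open>Lebesgue measure on \<open>Rn n\<close>\<close>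

abbreviation (input) embed_n :: "nat \<Rightarrow> (nat \<Rightarrow> real) \<Rightarrow> nat \<Rightarrow> real"
  where "embed_n n x \<equiv> (\<lambda>i. if i < n then x i else 0)"

interpretation lborel_prod: product_sigma_finite "\<lambda>_::nat. lborel :: real measure" ..

lemma sets_lborel_n [simp, measurable_cong]: "sets (lborel_n n) = sets borel"
  by (simp add: lborel_n_def)

lemma space_lborel_n [simp]: "space (lborel_n n) = UNIV"
  by (simp add: lborel_n_def)

lemma measurable_embed [measurable]:
  "embed_n n \<in> measurable (Pi\<^sub>M {..<n} (\<lambda>_. lborel)) borel"
proof (rule measurable_coordI)
  fix i
  show "(\<lambda>x. if i < n then x i else 0) \<in> borel_measurable (Pi\<^sub>M {..<n} (\<lambda>_. lborel))"
    by (cases "i < n") auto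
qed

lemma nn_integral_lborel_n:
  assumes "f \<in> borel_measurable borel"
  shows "(\<integral>\<^sup>+x. f x \<partial>lborel_n n) = (\<integral>\<^sup>+x. f (embed_n n x) \<partial>Pi\<^sub>M {..<n} (\<lambda>_. lborel))"
  unfolding lborel_n_def using assms by (subst nn_integral_distr) auto

lemma AE_lborel_n: "AE x in lborel_n n. x \<in> Rn n"
  unfolding lborel_n_def by (subst AE_distr_iff) (auto simp: Rn_iff)

lemma nn_integral_lborel_n_prod:
  assumes [measurable]: "\<And>i. f i \<in> borel_measurable borel"
  shows "(\<integral>\<^sup>+x. (\<Prod>i<n. f i (x i)) \<partial>lborel_n n) = (\<Prod>i<n. integral\<^sup>N lborel (f i))"
  by (subst nn_integral_lborel_n) (simp_all add: lborel_prod.product_nn_integral_prod)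

lemma emeasure_lborel_n_cube:
  assumes "0 \<le> c"
  shows "emeasure (lborel_n n) {x. \<forall>i<n. \<bar>x i\<bar> \<le> c} = ennreal ((2 * c) ^ n)"
proof -
  have "emeasure (lborel_n n) {x. \<forall>i<n. \<bar>x i\<bar> \<le> c} =
      (\<integral>\<^sup>+x. indicator {x. \<forall>i<n. \<bar>x i\<bar> \<le> c} x \<partial>lborel_n n)"
    by (subst nn_integral_indicator) auto
  also have "\<dots> = (\<integral>\<^sup>+x. (\<Prod>i<n. indicator {- c .. c} (x i)) \<partial>lborel_n n)"
    by (intro nn_integral_cong) (auto simp: indicator_def abs_le_iff minus_le_iff)
  also have "\<dots> = (\<Prod>i<n. emeasure lborel {- c .. c})"
    by (subst nn_integral_lborel_n_prod) auto
  also have "\<dots> = ennreal ((2 * c) ^ n)"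
    using assms by (simp add: ennreal_power)
  finally show ?thesis .
qed

lemma sigma_finite_lborel_n: "sigma_finite_measure (lborel_n n)"
proof
  define B where "B k = {x :: nat \<Rightarrow> real. \<forall>i<n. \<bar>x i\<bar> \<le> real k}" for k :: nat
  have [measurable]: "B k \<in> sets borel" for k
    unfolding B_def by measurable
  have "\<exists>k. x \<in> B k" for x
  proof -
    obtain k :: nat where k: "norm_n n x \<le> real k"
      using real_arch_simple by blast
    have "\<bar>x i\<bar> \<le> real k" if "i < n" for i
      using order_trans[OF abs_coord_le_norm_n[OF that] k] .
    then show ?thesis by (auto simp: B_def)
  qed
  then show "\<exists>A. countable A \<and> A \<subseteq> sets (lborel_n n) \<and> \<Union> A = space (lborel_n n) \<and>
      (\<forall>a\<in>A. emeasure (lborel_n n) a \<noteq> \<infinity>)"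
    by (intro exI[of _ "range B"]) (auto simp: B_def emeasure_lborel_n_cube)
qed

interpretation lborel_n: sigma_finite_measure "lborel_n n" for n
  by (rule sigma_finite_lborel_n)

interpretation lborel_n_pair: pair_sigma_finite "lborel_n n" "lborel_n m" for n m ..

interpretation lborel_n_prod: product_sigma_finite "\<lambda>_::nat. lborel_n n" for n ..

text \<open>Translations and the central reflection both act coordinatewise by measure preserving
  maps of the line.\<close>

lemma nn_integral_lborel_n_coordinatewise:
  assumes g [measurable]: "\<And>i. g i \<in> borel_measurable borel"
    and pres: "\<And>i. distr lborel borel (g i) = lborel"
    and f [measurable]: "f \<in> borel_measurable borel"
  shows "(\<integral>\<^sup>+x. f (\<lambda>i. if i < n then g i (x i) else 0) \<partial>lborel_n n) = (\<integral>\<^sup>+x. f x \<partial>lborel_n n)"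
proof -
  let ?P = "Pi\<^sub>M {..<n} (\<lambda>_. lborel :: real measure)"
  let ?G = "\<lambda>x. \<lambda>i\<in>{..<n}. g i (x i)"
  have G: "?G \<in> measurable ?P ?P"
    by measurable
  have "distr ?P ?P ?G = ?P"
  proof (rule lborel_prod.PiM_eqI)
    fix A :: "nat \<Rightarrow> real set"
    assume A: "\<And>i. i \<in> {..<n} \<Longrightarrow> A i \<in> sets lborel"
    have "emeasure (distr ?P ?P ?G) (Pi\<^sub>E {..<n} A) = emeasure ?P (?G -` Pi\<^sub>E {..<n} A \<inter> space ?P)"
      using A by (intro emeasure_distr G) auto
    also have "?G -` Pi\<^sub>E {..<n} A \<inter> space ?P = Pi\<^sub>E {..<n} (\<lambda>i. g i -` A i)"
      by (auto simp: space_PiM PiE_iff)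
    also have "emeasure ?P \<dots> = (\<Prod>i<n. emeasure lborel (g i -` A i))"
      using A measurable_sets[OF g] by (intro lborel_prod.emeasure_PiM) auto
    also have "\<dots> = (\<Prod>i<n. emeasure lborel (A i))"
    proof (rule prod.cong)
      fix i assume "i \<in> {..<n}"
      then have "emeasure (distr lborel borel (g i)) (A i) = emeasure lborel (g i -` A i)"
        using A by (subst emeasure_distr) auto
      then show "emeasure lborel (g i -` A i) = emeasure lborel (A i)"
        by (simp add: pres)
    qed simp
    finally show "emeasure (distr ?P ?P ?G) (Pi\<^sub>E {..<n} A) = (\<Prod>i<n. emeasure lborel (A i))" .
  qed auto
  then have "(\<integral>\<^sup>+x. f (embed_n n x) \<partial>?P) = (\<integral>\<^sup>+x. f (embed_n n x) \<partial>distr ?P ?P ?G)"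
    by simp
  also have "\<dots> = (\<integral>\<^sup>+x. f (embed_n n (?G x)) \<partial>?P)"
    by (rule nn_integral_distr) (use G in auto)
  also have "\<dots> = (\<integral>\<^sup>+x. f (\<lambda>i. if i < n then g i (embed_n n x i) else 0) \<partial>?P)"
    by (intro nn_integral_cong arg_cong[of _ _ f]) (auto simp: fun_eq_iff)
  also have "\<dots> = (\<integral>\<^sup>+x. f (\<lambda>i. if i < n then g i (x i) else 0) \<partial>lborel_n n)"
  proof -
    have "(\<lambda>x i. if i < n then g i (x i) else 0) \<in> borel_measurable borel"
      by (rule measurable_coordI) measurable
    then show ?thesis
      by (subst nn_integral_lborel_n) auto
  qed
  finally show ?thesis
    by (simp add: nn_integral_lborel_n)
qed

lemma nn_integral_lborel_n_translate:
  assumes f [measurable]: "f \<in> borel_measurable borel" and a: "a \<in> Rn n"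
  shows "(\<integral>\<^sup>+x. f (x + a) \<partial>lborel_n n) = (\<integral>\<^sup>+x. f x \<partial>lborel_n n)"
proof -
  have "(\<integral>\<^sup>+x. f (x + a) \<partial>lborel_n n) =
      (\<integral>\<^sup>+x. f (\<lambda>i. if i < n then a i + x i else 0) \<partial>lborel_n n)"
    using AE_lborel_n
  proof (intro nn_integral_cong_AE, eventually_elim)
    case (elim x)
    with a have "x + a = (\<lambda>i. if i < n then a i + x i else 0)"
      by (auto simp: Rn_iff fun_eq_iff)
    then show ?case by simp
  qed
  also have "\<dots> = (\<integral>\<^sup>+x. f x \<partial>lborel_n n)"
    by (intro nn_integral_lborel_n_coordinatewise[where g = "\<lambda>i x. a i + x"])
      (auto simp: lborel_distr_plus)
  finally show ?thesis .
qed

lemma nn_integral_lborel_n_uminus: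
  assumes f [measurable]: "f \<in> borel_measurable borel"
  shows "(\<integral>\<^sup>+x. f (- x) \<partial>lborel_n n) = (\<integral>\<^sup>+x. f x \<partial>lborel_n n)"
proof -
  have "(\<integral>\<^sup>+x. f (- x) \<partial>lborel_n n) =
      (\<integral>\<^sup>+x. f (\<lambda>i. if i < n then - x i else 0) \<partial>lborel_n n)"
    using AE_lborel_n
  proof (intro nn_integral_cong_AE, eventually_elim)
    case (elim x)
    then have "- x = (\<lambda>i. if i < n then - x i else 0)"
      by (auto simp: Rn_iff fun_eq_iff)
    then show ?case by simp
  qed
  also have "\<dots> = (\<integral>\<^sup>+x. f x \<partial>lborel_n n)"
    by (intro nn_integral_lborel_n_coordinatewise[where g = "\<lambda>i x. - x"])
      (auto simp: lborel_distr_uminus)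
  finally show ?thesis .
qed

section \<open>The Prekopa-Leindler inequality for midpoints\<close>

lemma emeasure_lborel_translate:
  fixes A :: "real set"
  assumes [measurable]: "A \<in> sets borel"
  shows "emeasure lborel {x. x - a \<in> A} = emeasure lborel A"
proof -
  have "emeasure lborel A = emeasure (distr lborel borel ((+) (- a))) A"
    by (simp add: lborel_distr_plus)
  also have "\<dots> = emeasure lborel {x. x - a \<in> A}"
    by (subst emeasure_distr) (auto simp: vimage_def)
  finally show ?thesis ..
qed

text \<open>If \<open>a\<close> is almost the supremum of \<open>A\<close> and \<open>b\<close> almost the infimum of \<open>B\<close>, the translates
  \<open>A + b\<close> and \<open>a + B\<close> both lie in the sumset and overlap only in a short interval.\<close>

lemma sumset_emeasure_bounded:
  fixes A B D :: "real set"
  assumes [measurable]: "A \<in> sets borel" "B \<in> sets borel" "D \<in> sets borel"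
    and ne: "A \<noteq> {}" "B \<noteq> {}" and bdd: "bdd_above A" "bdd_below B"
    and sum: "\<And>a b. a \<in> A \<Longrightarrow> b \<in> B \<Longrightarrow> a + b \<in> D"
  shows "emeasure lborel A + emeasure lborel B \<le> emeasure lborel D"
proof (rule ennreal_le_epsilon)
  fix e :: real assume e: "0 < e"
  obtain a where a: "a \<in> A" "Sup A - e / 2 < a"
    using less_cSup_iff[OF ne(1) bdd(1), of "Sup A - e / 2"] e by auto
  obtain b where b: "b \<in> B" "b < Inf B + e / 2"
    using cInf_less_iff[OF ne(2) bdd(2), of "Inf B + e / 2"] e by auto
  define I where "I = {Inf B + a .. Sup A + b}"
  let ?A = "{x. x - b \<in> A}" and ?B = "{x. x - a \<in> B}"
  have [measurable]: "?A \<in> sets borel" "?B \<in> sets borel" "I \<in> sets borel"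
    unfolding I_def by measurable
  have I: "emeasure lborel I \<le> ennreal e"
  proof (cases "Inf B + a \<le> Sup A + b")
    case True
    then show ?thesis using a b by (auto simp: I_def intro!: ennreal_leI)
  qed (simp add: I_def)
  have "?A \<inter> ?B \<subseteq> I"
  proof
    fix x assume "x \<in> ?A \<inter> ?B"
    then have "x - b \<le> Sup A" "Inf B \<le> x - a"
      using bdd by (auto intro: cSup_upper cInf_lower)
    then show "x \<in> I" by (auto simp: I_def)
  qed
  then have disj: "?A \<inter> (?B - I) = {}" by auto
  have "?A \<union> (?B - I) \<subseteq> D"
  proof -
    have "x \<in> D" if "x - b \<in> A" for x using sum[OF that b(1)] by simp
    moreover have "x \<in> D" if "x - a \<in> B" for x using sum[OF a(1) that] by simp
    ultimately show ?thesis by auto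
  qed
  then have D: "emeasure lborel ?A + emeasure lborel (?B - I) \<le> emeasure lborel D"
    by (subst plus_emeasure) (auto intro!: emeasure_mono simp: disj)
  have "emeasure lborel ?B \<le> emeasure lborel ((?B - I) \<union> I)"
    by (intro emeasure_mono) auto
  also have "\<dots> \<le> emeasure lborel (?B - I) + emeasure lborel I"
    by (intro emeasure_subadditive) auto
  finally have "emeasure lborel ?A + emeasure lborel ?B
      \<le> (emeasure lborel ?A + emeasure lborel (?B - I)) + emeasure lborel I"
    by (simp add: add.assoc add_left_mono)
  also have "\<dots> \<le> emeasure lborel D + ennreal e"
    by (intro add_mono D I)
  finally show "emeasure lborel A + emeasure lborel B \<le> emeasure lborel D + ennreal e"
    by (simp add: emeasure_lborel_translate)
qed

lemma sumset_emeasure: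
  fixes A B D :: "real set"
  assumes [measurable]: "A \<in> sets borel" "B \<in> sets borel" "D \<in> sets borel"
    and ne: "A \<noteq> {}" "B \<noteq> {}"
    and sum: "\<And>a b. a \<in> A \<Longrightarrow> b \<in> B \<Longrightarrow> a + b \<in> D"
  shows "emeasure lborel A + emeasure lborel B \<le> emeasure lborel D"
proof -
  have lim: "(\<lambda>k. emeasure lborel (S \<inter> {- real k .. real k})) \<longlonglongrightarrow> emeasure lborel S"
    if [measurable]: "S \<in> sets borel" for S :: "real set"
  proof -
    have "(\<Union>k::nat. S \<inter> {- real k .. real k}) = S"
    proof -
      have "\<exists>k::nat. - real k \<le> x \<and> x \<le> real k" for x
        using real_arch_simple[of "\<bar>x\<bar>"] by (auto simp: abs_le_iff minus_le_iff)
      then show ?thesis by auto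
    qed
    moreover have "(\<lambda>k. emeasure lborel (S \<inter> {- real k .. real k})) \<longlonglongrightarrow>
        emeasure lborel (\<Union>k::nat. S \<inter> {- real k .. real k})"
      by (intro Lim_emeasure_incseq) (auto simp: incseq_def)
    ultimately show ?thesis by simp
  qed
  obtain a b where ab: "a \<in> A" "b \<in> B" using ne by auto
  obtain k0 :: nat where k0: "\<bar>a\<bar> + \<bar>b\<bar> \<le> real k0"
    using real_arch_simple by blast
  have "emeasure lborel (A \<inter> {- real k .. real k}) + emeasure lborel (B \<inter> {- real k .. real k})
      \<le> emeasure lborel D" if "k0 \<le> k" for k
  proof (rule sumset_emeasure_bounded)
    have "\<bar>a\<bar> \<le> real k" "\<bar>b\<bar> \<le> real k" using k0 that by linarith+
    then show "A \<inter> {- real k .. real k} \<noteq> {}" "B \<inter> {- real k .. real k} \<noteq> {}"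
      using ab by (auto simp: abs_le_iff intro!: exI)
    show "bdd_above (A \<inter> {- real k .. real k})" "bdd_below (B \<inter> {- real k .. real k})"
      by auto
  qed (auto intro: sum)
  then show ?thesis
    by (intro LIMSEQ_le_const2[OF tendsto_add[OF lim lim]]) auto
qed

lemma midpoint_emeasure:
  fixes A B D :: "real set"
  assumes [measurable]: "A \<in> sets borel" "B \<in> sets borel" "D \<in> sets borel"
    and ne: "A \<noteq> {}" "B \<noteq> {}"
    and mid: "\<And>a b. a \<in> A \<Longrightarrow> b \<in> B \<Longrightarrow> (a + b) / 2 \<in> D"
  shows "emeasure lborel A + emeasure lborel B \<le> 2 * emeasure lborel D"
proof -
  have [measurable]: "{x. x / 2 \<in> D} \<in> sets borel" by measurable
  have "emeasure lborel A + emeasure lborel B \<le> emeasure lborel {x. x / 2 \<in> D}"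
    by (intro sumset_emeasure ne) (use mid in auto)
  also have "\<dots> = (\<integral>\<^sup>+x. indicator {x. x / 2 \<in> D} x \<partial>lborel)"
    by simp
  also have "\<dots> = 2 * (\<integral>\<^sup>+x. indicator {x. x / 2 \<in> D} (0 + 2 * x) \<partial>lborel)"
    by (subst nn_integral_real_affine[where c = 2 and t = 0]) auto
  also have "(\<lambda>x. indicator {x. x / 2 \<in> D} (0 + 2 * x) :: ennreal) = indicator D"
    by (auto simp: indicator_def)
  finally show ?thesis by simp
qed

lemma (in sigma_finite_measure) nn_integral_layer_cake:
  assumes [measurable]: "f \<in> borel_measurable M"
  shows "(\<integral>\<^sup>+x. f x \<partial>M) =
    (\<integral>\<^sup>+t. indicator {0<..} t * emeasure M {x \<in> space M. ennreal t < f x} \<partial>lborel)"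
proof -
  interpret P: pair_sigma_finite M "lborel :: real measure" ..
  have cake: "f x = (\<integral>\<^sup>+t. indicator {0<..} t * indicator {t. ennreal t < f x} t \<partial>lborel)" for x
  proof -
    have "(\<integral>\<^sup>+t. indicator {0<..} t * indicator {t. ennreal t < f x} t \<partial>lborel)
        = (\<integral>\<^sup>+t. indicator {t. 0 < t \<and> ennreal t < f x} t \<partial>lborel)"
      by (intro nn_integral_cong) (auto simp: indicator_def)
    also have "\<dots> = emeasure lborel {t. 0 < t \<and> ennreal t < f x}"
      by simp
    also have "\<dots> = f x"
    proof (cases "f x")
      case (real r)
      then have "{t. 0 < t \<and> ennreal t < f x} = {0<..<r}"
        by (auto simp: ennreal_less_iff)
      with real show ?thesis by simp
    next
      case top
      then have "{t. 0 < t \<and> ennreal t < f x} = {0<..}"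
        by auto
      moreover have "emeasure lborel {0::real<..} = top"
      proof -
        have "(of_nat k :: ennreal) \<le> emeasure lborel {0::real<..}" for k :: nat
        proof -
          have "emeasure lborel {0<..<real k} \<le> emeasure lborel {0::real<..}"
            by (intro emeasure_mono) force+
          then show ?thesis by (simp add: ennreal_of_nat_eq_real_of_nat)
        qed
        then have "(SUP k. of_nat k :: ennreal) \<le> emeasure lborel {0::real<..}"
          by (rule SUP_least)
        then show ?thesis by (simp add: ennreal_SUP_of_nat_eq_top top_unique)
      qed
      ultimately show ?thesis
        using top by simp
    qed
    finally show ?thesis ..
  qed
  have "(\<integral>\<^sup>+x. f x \<partial>M) =
      (\<integral>\<^sup>+x. \<integral>\<^sup>+t. indicator {0<..} t * indicator {t. ennreal t < f x} t \<partial>lborel \<partial>M)"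
    by (subst cake) simp
  also have "\<dots> = (\<integral>\<^sup>+t. \<integral>\<^sup>+x. indicator {0<..} t * indicator {t. ennreal t < f x} t \<partial>M \<partial>lborel)"
    by (intro P.Fubini'[symmetric]) (unfold split_beta' indicator_def, measurable)
  also have "\<dots> = (\<integral>\<^sup>+t. indicator {0<..} t * emeasure M {x \<in> space M. ennreal t < f x} \<partial>lborel)"
  proof (intro nn_integral_cong)
    fix t :: real
    have "(\<integral>\<^sup>+x. indicator {0<..} t * indicator {t. ennreal t < f x} t \<partial>M) =
        (\<integral>\<^sup>+x. indicator {0<..} t * indicator {x \<in> space M. ennreal t < f x} x \<partial>M)"
      by (intro nn_integral_cong) (auto simp: indicator_def)
    also have "\<dots> = indicator {0<..} t * emeasure M {x \<in> space M. ennreal t < f x}"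
      by (subst nn_integral_cmult) auto
    finally show "(\<integral>\<^sup>+x. indicator {0<..} t * indicator {t. ennreal t < f x} t \<partial>M) =
        indicator {0<..} t * emeasure M {x \<in> space M. ennreal t < f x}" .
  qed
  finally show ?thesis .
qed

lemma ennreal_amgm:
  fixes a b c :: ennreal
  assumes "a + b \<le> 2 * c"
  shows "a * b \<le> c\<^sup>2"
proof (cases "c = top")
  case True
  then show ?thesis by (simp add: power2_eq_square ennreal_top_mult)
next
  case False
  then have "2 * c < top" by (simp add: ennreal_mult_less_top less_top)
  with assms have "a < top" "b < top" by (auto dest: le_less_trans)
  with False obtain x y z where *: "a = ennreal x" "0 \<le> x" "b = ennreal y" "0 \<le> y"
    "c = ennreal z" "0 \<le> z"
    by (metis ennreal_cases less_irrefl top.not_eq_extremum)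
  have "ennreal (x + y) \<le> ennreal (2 * z)"
    using assms * by (simp add: ennreal_plus ennreal_mult)
  then have "x + y \<le> 2 * z" using * by (subst (asm) ennreal_le_iff) auto
  then have "(x + y)\<^sup>2 \<le> (2 * z)\<^sup>2" using * by (intro power_mono) auto
  moreover have "4 * (x * y) \<le> (x + y)\<^sup>2"
    using zero_le_power2[of "x - y"] by (simp add: power2_eq_square algebra_simps)
  ultimately have "x * y \<le> z\<^sup>2" by (simp add: power_mult_distrib)
  then show ?thesis using *
    by (simp add: ennreal_power flip: ennreal_mult)
qed

text \<open>With both suprema equal to \<open>1\<close>, every level set of \<open>h\<close> contains the midpoints of the two
  corresponding level sets, which are non-empty exactly for levels below \<open>1\<close>.\<close>

lemma prekopa_leindler_real_normalized:
  fixes f g h :: "real \<Rightarrow> ennreal"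
  assumes [measurable]: "f \<in> borel_measurable borel" "g \<in> borel_measurable borel"
      "h \<in> borel_measurable borel"
    and sup: "(SUP x. f x) = 1" "(SUP x. g x) = 1"
    and le: "\<And>x y. f x * g y \<le> (h ((x + y) / 2))\<^sup>2"
  shows "integral\<^sup>N lborel f * integral\<^sup>N lborel g \<le> (integral\<^sup>N lborel h)\<^sup>2"
proof (rule ennreal_amgm)
  have "emeasure lborel {x. ennreal t < f x} + emeasure lborel {x. ennreal t < g x}
      \<le> 2 * emeasure lborel {x. ennreal t < h x}" if t: "0 < t" for t
  proof (cases "t < 1")
    case True
    then have "ennreal t < (SUP x. f x)" "ennreal t < (SUP x. g x)"
      using t by (simp_all add: sup)
    then have ne: "{x. ennreal t < f x} \<noteq> {}" "{x. ennreal t < g x} \<noteq> {}"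
      by (auto simp: less_SUP_iff)
    show ?thesis
    proof (rule midpoint_emeasure[OF _ _ _ ne])
      fix x y assume xy: "x \<in> {x. ennreal t < f x}" "y \<in> {x. ennreal t < g x}"
      have "ennreal t < h ((x + y) / 2)"
      proof (rule ccontr)
        assume "\<not> ?thesis"
        then have *: "f x * g y \<le> ennreal t * ennreal t"
          using order_trans[OF le[of x y], of "ennreal t * ennreal t"]
          by (simp add: power2_eq_square not_less mult_mono)
        obtain q where q: "ennreal t < q" "q < min (f x) (g y)"
          using xy dense[of "ennreal t" "min (f x) (g y)"] by auto
        then obtain s where s: "q = ennreal s" "0 \<le> s"
          by (cases q) auto
        have "ennreal (s * s) = q * q" using s by (simp add: ennreal_mult)
        also have "\<dots> \<le> f x * g y" using q by (intro mult_mono) auto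
        also note * also have "ennreal t * ennreal t = ennreal (t * t)"
          using t by (simp add: ennreal_mult)
        finally have "s * s \<le> t * t" using t by (subst (asm) ennreal_le_iff) auto
        moreover have "t < s" using q s t by (simp add: ennreal_less_iff)
        ultimately show False using t mult_strict_mono[of t s t s] by simp
      qed
      then show "(x + y) / 2 \<in> {x. ennreal t < h x}" by simp
    qed measurable
  next
    case False
    then have "f x \<le> ennreal t" "g x \<le> ennreal t" for x
      using SUP_upper[of x UNIV f] SUP_upper[of x UNIV g] sup ennreal_leI[of 1 t]
      by (auto intro: order_trans)
    then show ?thesis by (simp add: not_less[symmetric])
  qed
  then have *: "indicator {0<..} t * emeasure lborel {x. ennreal t < f x} +
      indicator {0<..} t * emeasure lborel {x. ennreal t < g x}
      \<le> 2 * (indicator {0<..} t * emeasure lborel {x. ennreal t < h x})" for t :: real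
    by (auto simp: indicator_def)
  have [measurable]: "(\<lambda>t. emeasure lborel {x. ennreal t < f x}) \<in> borel_measurable borel"
    if [measurable]: "f \<in> borel_measurable borel" for f :: "real \<Rightarrow> ennreal"
    by measurable
  show "integral\<^sup>N lborel f + integral\<^sup>N lborel g \<le> 2 * integral\<^sup>N lborel h"
    using nn_integral_mono[of lborel "\<lambda>t. indicator {0<..} t * emeasure lborel {x. ennreal t < f x} +
        indicator {0<..} t * emeasure lborel {x. ennreal t < g x}", OF *]
    by (simp add: lborel.nn_integral_layer_cake[of f] lborel.nn_integral_layer_cake[of g]
        lborel.nn_integral_layer_cake[of h] nn_integral_add nn_integral_cmult)
qed

text \<open>Rescaling \<open>f\<close>, \<open>g\<close> by their suprema \<open>a\<close>, \<open>b\<close> and \<open>h\<close> by \<open>sqrt (a b)\<close> preserves both the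
  hypothesis and the conclusion.\<close>

lemma prekopa_leindler_real_bounded:
  fixes f g h :: "real \<Rightarrow> ennreal"
  assumes [measurable]: "f \<in> borel_measurable borel" "g \<in> borel_measurable borel"
      "h \<in> borel_measurable borel"
    and fin: "(SUP x. f x) < top" "(SUP x. g x) < top"
    and le: "\<And>x y. f x * g y \<le> (h ((x + y) / 2))\<^sup>2"
  shows "integral\<^sup>N lborel f * integral\<^sup>N lborel g \<le> (integral\<^sup>N lborel h)\<^sup>2"
proof (cases "(SUP x. f x) = 0 \<or> (SUP x. g x) = 0")
  case True
  have "f x \<le> (SUP x. f x)" "g x \<le> (SUP x. g x)" for x
    by (auto intro: SUP_upper)
  with True have "f = (\<lambda>_. 0) \<or> g = (\<lambda>_. 0)"
    by (metis ext le_zero_eq)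
  then show ?thesis by auto
next
  case False
  with fin obtain a b where ab: "(SUP x. f x) = ennreal a" "(SUP x. g x) = ennreal b" "0 < a" "0 < b"
    by (metis ennreal_cases ennreal_0 less_irrefl order_le_less)
  define c where "c = sqrt (a * b)"
  have c: "0 < c" "c * c = a * b" using ab by (auto simp: c_def)
  have inv: "ennreal r * ennreal (1 / r) = 1" if "0 < r" for r
    using that by (simp flip: ennreal_mult)
  have norm: "(SUP x. ennreal (1 / r) * u x) = 1" if "(SUP x. u x) = ennreal r" "0 < r"
    for u :: "real \<Rightarrow> ennreal" and r
    unfolding SUP_mult_left_ennreal[symmetric] using that inv[of r] by (simp add: mult.commute)
  have "(\<integral>\<^sup>+x. ennreal (1 / a) * f x \<partial>lborel) * (\<integral>\<^sup>+x. ennreal (1 / b) * g x \<partial>lborel)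
      \<le> (\<integral>\<^sup>+x. ennreal (1 / c) * h x \<partial>lborel)\<^sup>2"
  proof (rule prekopa_leindler_real_normalized)
    fix x y
    have cc: "ennreal (1 / a) * ennreal (1 / b) = ennreal (1 / c) * ennreal (1 / c)"
      using c ab by (simp flip: ennreal_mult)
    have "ennreal (1 / a) * f x * (ennreal (1 / b) * g y) =
        (ennreal (1 / a) * ennreal (1 / b)) * (f x * g y)"
      by (simp add: ac_simps)
    also have "\<dots> \<le> (ennreal (1 / c) * ennreal (1 / c)) * (h ((x + y) / 2))\<^sup>2"
      unfolding cc by (intro mult_left_mono le) auto
    also have "\<dots> = (ennreal (1 / c) * h ((x + y) / 2))\<^sup>2"
      by (simp add: power2_eq_square ac_simps)
    finally show "ennreal (1 / a) * f x * (ennreal (1 / b) * g y)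
        \<le> (ennreal (1 / c) * h ((x + y) / 2))\<^sup>2" .
  qed (use ab in \<open>auto intro!: norm\<close>)
  then have scaled: "(ennreal (1 / a) * integral\<^sup>N lborel f) * (ennreal (1 / b) * integral\<^sup>N lborel g)
      \<le> (ennreal (1 / c) * integral\<^sup>N lborel h)\<^sup>2"
    by (simp add: nn_integral_cmult)
  have "integral\<^sup>N lborel f * integral\<^sup>N lborel g =
      (ennreal a * ennreal (1 / a)) * (ennreal b * ennreal (1 / b)) *
        (integral\<^sup>N lborel f * integral\<^sup>N lborel g)"
    using ab by (simp add: inv)
  also have "\<dots> = ennreal a * ennreal b *
      ((ennreal (1 / a) * integral\<^sup>N lborel f) * (ennreal (1 / b) * integral\<^sup>N lborel g))"
    by (simp only: ac_simps)
  also have "\<dots> \<le> ennreal a * ennreal b * (ennreal (1 / c) * integral\<^sup>N lborel h)\<^sup>2"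
    by (intro mult_left_mono scaled) auto
  also have "ennreal a * ennreal b = ennreal c * ennreal c"
    using ab c by (simp flip: ennreal_mult)
  also have "ennreal c * ennreal c * (ennreal (1 / c) * integral\<^sup>N lborel h)\<^sup>2 =
      (ennreal c * ennreal (1 / c)) * (ennreal c * ennreal (1 / c)) * (integral\<^sup>N lborel h)\<^sup>2"
    by (simp only: power2_eq_square ac_simps)
  also have "\<dots> = (integral\<^sup>N lborel h)\<^sup>2"
    using c by (simp add: inv)
  finally show ?thesis .
qed

lemma prekopa_leindler_real:
  fixes f g h :: "real \<Rightarrow> ennreal"
  assumes [measurable]: "f \<in> borel_measurable borel" "g \<in> borel_measurable borel"
      "h \<in> borel_measurable borel"
    and le: "\<And>x y. f x * g y \<le> (h ((x + y) / 2))\<^sup>2"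
  shows "integral\<^sup>N lborel f * integral\<^sup>N lborel g \<le> (integral\<^sup>N lborel h)\<^sup>2"
proof -
  have lim: "integral\<^sup>N lborel u = (SUP k::nat. \<integral>\<^sup>+x. min (u x) (of_nat k) \<partial>lborel)"
    if [measurable]: "u \<in> borel_measurable borel" for u :: "real \<Rightarrow> ennreal"
  proof -
    have "(SUP k::nat. min a (of_nat k)) = a" for a :: ennreal
      by (simp add: inf_SUP[symmetric] ennreal_SUP_of_nat_eq_top flip: inf_min)
    then have "integral\<^sup>N lborel u = (\<integral>\<^sup>+x. (SUP k::nat. min (u x) (of_nat k)) \<partial>lborel)"
      by simp
    also have "\<dots> = (SUP k::nat. \<integral>\<^sup>+x. min (u x) (of_nat k) \<partial>lborel)"
      by (intro nn_integral_monotone_convergence_SUP)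
        (auto simp: incseq_def le_fun_def min_le_iff_disj)
    finally show ?thesis .
  qed
  have bounded: "(\<integral>\<^sup>+x. min (f x) (of_nat j) \<partial>lborel) * (\<integral>\<^sup>+x. min (g x) (of_nat k) \<partial>lborel)
      \<le> (integral\<^sup>N lborel h)\<^sup>2" for j k :: nat
  proof (rule prekopa_leindler_real_bounded)
    have "(SUP x. min (u x) (of_nat k)) < top" for u :: "real \<Rightarrow> ennreal" and k :: nat
      by (rule le_less_trans[of _ "of_nat k"]) (auto intro!: SUP_least simp: of_nat_less_top)
    then show "(SUP x. min (f x) (of_nat j)) < top" "(SUP x. min (g x) (of_nat k)) < top"
      by auto
    show "min (f x) (of_nat j) * min (g y) (of_nat k) \<le> (h ((x + y) / 2))\<^sup>2" for x y
      by (rule order_trans[OF _ le]) (auto intro!: mult_mono)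
  qed auto
  have "integral\<^sup>N lborel f * (\<integral>\<^sup>+x. min (g x) (of_nat k) \<partial>lborel) \<le> (integral\<^sup>N lborel h)\<^sup>2" for k :: nat
    unfolding lim[OF assms(1)] SUP_mult_right_ennreal by (intro SUP_least bounded)
  then show ?thesis
    unfolding lim[OF assms(2)] SUP_mult_left_ennreal by (intro SUP_least)
qed

text \<open>The hypothesis passes to the marginals in one coordinate by the induction hypothesis, so the
  one-dimensional inequality applies to them.\<close>

lemma prekopa_leindler_PiM:
  fixes f g h :: "('i \<Rightarrow> real) \<Rightarrow> ennreal"
  assumes "finite I"
    and "f \<in> borel_measurable (Pi\<^sub>M I (\<lambda>_. lborel))" "g \<in> borel_measurable (Pi\<^sub>M I (\<lambda>_. lborel))"
      "h \<in> borel_measurable (Pi\<^sub>M I (\<lambda>_. lborel))"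
    and "\<And>x y. x \<in> extensional I \<Longrightarrow> y \<in> extensional I \<Longrightarrow>
      f x * g y \<le> (h (\<lambda>i\<in>I. (x i + y i) / 2))\<^sup>2"
  shows "integral\<^sup>N (Pi\<^sub>M I (\<lambda>_. lborel)) f * integral\<^sup>N (Pi\<^sub>M I (\<lambda>_. lborel)) g
    \<le> (integral\<^sup>N (Pi\<^sub>M I (\<lambda>_. lborel)) h)\<^sup>2"
  using assms
proof (induction I arbitrary: f g h)
  case empty
  interpret product_sigma_finite "\<lambda>_::'i. lborel :: real measure" ..
  show ?case
    using empty.prems(4)[of "\<lambda>_. undefined" "\<lambda>_. undefined"]
    by (simp add: nn_integral_empty restrict_def)
next
  case (insert i I)
  interpret product_sigma_finite "\<lambda>_::'i. lborel :: real measure" ..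
  interpret I: finite_product_sigma_finite "\<lambda>_::'i. lborel :: real measure" I
    by standard fact
  note [measurable] = insert.prems(1-3)
  let ?P = "Pi\<^sub>M I (\<lambda>_. lborel :: real measure)"
  have sec [measurable]: "(\<lambda>x. u (x(i := a))) \<in> borel_measurable ?P"
    if [measurable]: "u \<in> borel_measurable (Pi\<^sub>M (insert i I) (\<lambda>_. lborel))"
    for u :: "('i \<Rightarrow> real) \<Rightarrow> ennreal" and a
    by measurable
  have marg: "(\<lambda>a. \<integral>\<^sup>+x. u (x(i := a)) \<partial>?P) \<in> borel_measurable borel"
    if [measurable]: "u \<in> borel_measurable (Pi\<^sub>M (insert i I) (\<lambda>_. lborel))"
    for u :: "('i \<Rightarrow> real) \<Rightarrow> ennreal"
  proof -
    have "(\<lambda>a. \<integral>\<^sup>+x. u (x(i := a)) \<partial>?P) \<in> borel_measurable lborel"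
      by measurable
    then show ?thesis by simp
  qed
  have "(\<integral>\<^sup>+a. \<integral>\<^sup>+x. f (x(i := a)) \<partial>?P \<partial>lborel) * (\<integral>\<^sup>+a. \<integral>\<^sup>+x. g (x(i := a)) \<partial>?P \<partial>lborel)
      \<le> (\<integral>\<^sup>+a. \<integral>\<^sup>+x. h (x(i := a)) \<partial>?P \<partial>lborel)\<^sup>2"
  proof (intro prekopa_leindler_real marg insert.prems(1-3) insert.IH)
    fix a b :: real and x y :: "'i \<Rightarrow> real" assume xy: "x \<in> extensional I" "y \<in> extensional I"
    have mid: "(\<lambda>j\<in>insert i I. ((x(i := a)) j + (y(i := b)) j) / 2) =
        (\<lambda>j\<in>I. (x j + y j) / 2)(i := (a + b) / 2)"
      using insert.hyps by (auto simp: restrict_def fun_eq_iff)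
    have ext: "x(i := a) \<in> extensional (insert i I)" "y(i := b) \<in> extensional (insert i I)"
      using xy by (auto simp: extensional_def)
    show "f (x(i := a)) * g (y(i := b))
        \<le> (h ((\<lambda>j\<in>I. (x j + y j) / 2)(i := (a + b) / 2)))\<^sup>2"
      using insert.prems(4)[OF ext] unfolding mid .
  qed (rule sec, rule insert.prems)+
  then show ?case
    unfolding product_nn_integral_insert_rev[OF insert.hyps insert.prems(1)]
      product_nn_integral_insert_rev[OF insert.hyps insert.prems(2)]
      product_nn_integral_insert_rev[OF insert.hyps insert.prems(3)] .
qed

lemma prekopa_leindler_lborel_n:
  fixes f g h :: "(nat \<Rightarrow> real) \<Rightarrow> ennreal"
  assumes [measurable]: "f \<in> borel_measurable borel" "g \<in> borel_measurable borel"
      "h \<in> borel_measurable borel"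
    and le: "\<And>x y. x \<in> Rn n \<Longrightarrow> y \<in> Rn n \<Longrightarrow> f x * g y \<le> (h (\<lambda>i. (x i + y i) / 2))\<^sup>2"
  shows "integral\<^sup>N (lborel_n n) f * integral\<^sup>N (lborel_n n) g \<le> (integral\<^sup>N (lborel_n n) h)\<^sup>2"
proof -
  have "f (embed_n n x) * g (embed_n n y) \<le> (h (embed_n n (\<lambda>i\<in>{..<n}. (x i + y i) / 2)))\<^sup>2" for x y
  proof -
    have "embed_n n (\<lambda>i\<in>{..<n}. (x i + y i) / 2) = (\<lambda>i. (embed_n n x i + embed_n n y i) / 2)"
      by auto
    then show ?thesis
      using le[of "embed_n n x" "embed_n n y"] by (simp add: Rn_iff)
  qed
  then show ?thesis
    unfolding nn_integral_lborel_n[OF assms(1)] nn_integral_lborel_n[OF assms(2)]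
      nn_integral_lborel_n[OF assms(3)]
    by (intro prekopa_leindler_PiM[where f = "\<lambda>x. f (embed_n n x)" and g = "\<lambda>x. g (embed_n n x)"
          and h = "\<lambda>x. h (embed_n n x)"] measurable_compose[OF measurable_embed] assms) simp_all
qed

section \<open>Convex bodies\<close>

lemma convex_body_props:
  assumes "convex_body n K"
  shows convex_body_subset: "K \<subseteq> Rn n"
    and convex_body_compact: "compact K"
    and convex_body_closed: "closed K"
    and convex_body_borel: "K \<in> sets borel"
proof -
  have "compactin (powertop_real UNIV) K \<and> K \<subseteq> Rn n"
    using assms by (auto simp: convex_body_def Euclidean_space_def compactin_subtopology)
  then show K: "K \<subseteq> Rn n" "compact K"
    by (simp_all add: euclidean_product_topology compactin_euclidean_iff)
  then show "closed K" by (simp add: compact_imp_closed)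
  then show "K \<in> sets borel" by simp
qed

lemma convex_body_convex:
  assumes "convex_body n K" "x \<in> K" "y \<in> K" "0 \<le> u" "0 \<le> v" "u + v = 1"
  shows "(\<lambda>i. u * x i + v * y i) \<in> K"
  using assms unfolding convex_body_def by blast

section \<open>Exponential moments of linear functionals on isotropic convex bodies\<close>

text \<open>The midpoint of two points of \<open>C\<close>, one in each of two parallel half-spaces, lies in \<open>C\<close> and in
  the half-space halfway between them.\<close>

lemma half_space_volume_log_concave:
  assumes C: "convex_body n C"
  shows "emeasure (lborel_n n) (C \<inter> {x. r \<le> inner_n n x \<theta>}) *
      emeasure (lborel_n n) (C \<inter> {x. s \<le> inner_n n x \<theta>})
    \<le> (emeasure (lborel_n n) (C \<inter> {x. (r + s) / 2 \<le> inner_n n x \<theta>}))\<^sup>2"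
proof -
  have [measurable]: "C \<in> sets borel" by (rule convex_body_borel[OF C])
  define H where "H a = C \<inter> {x. a \<le> inner_n n x \<theta>}" for a
  have [measurable]: "H a \<in> sets borel" for a unfolding H_def by measurable
  have "integral\<^sup>N (lborel_n n) (indicator (H r)) * integral\<^sup>N (lborel_n n) (indicator (H s))
      \<le> (integral\<^sup>N (lborel_n n) (indicator (H ((r + s) / 2))))\<^sup>2"
  proof (rule prekopa_leindler_lborel_n)
    fix x y :: "nat \<Rightarrow> real"
    show "indicator (H r) x * indicator (H s) y
        \<le> (indicator (H ((r + s) / 2)) (\<lambda>i. (x i + y i) / 2) :: ennreal)\<^sup>2"
    proof (cases "x \<in> H r \<and> y \<in> H s")
      case True
      then have "(\<lambda>i. (1/2) * x i + (1/2) * y i) \<in> C"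
        by (intro convex_body_convex[OF C]) (auto simp: H_def)
      then have "(\<lambda>i. (x i + y i) / 2) \<in> C" by (simp add: add_divide_distrib)
      moreover have "inner_n n (\<lambda>i. (x i + y i) / 2) \<theta> = (inner_n n x \<theta> + inner_n n y \<theta>) / 2"
        by (simp add: inner_n_def sum_divide_distrib flip: sum.distrib) (simp add: algebra_simps)
      ultimately have "(\<lambda>i. (x i + y i) / 2) \<in> H ((r + s) / 2)"
        using True by (auto simp: H_def)
      then show ?thesis using True by simp
    qed (auto simp: indicator_def)
  qed auto
  then show ?thesis by (simp add: H_def)
qed

text \<open>Log-concavity makes the ratios of successive terms non-increasing, so the first drop
  propagates. Monotonicity covers the case that a term vanishes.\<close>

lemma log_concave_seq_decay:
  fixes g :: "nat \<Rightarrow> real"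
  assumes nonneg: "\<And>k. 0 \<le> g k" and dec: "\<And>k. g (Suc k) \<le> g k"
    and lc: "\<And>k. g k * g (Suc (Suc k)) \<le> (g (Suc k))\<^sup>2"
    and start: "g 0 \<le> 1" "g 1 \<le> g 0 / 8"
  shows "g k \<le> (1 / 8) ^ k"
proof -
  have step: "g (Suc k) \<le> g k / 8" for k
  proof (induction k)
    case (Suc k)
    show ?case
    proof (cases "g k = 0")
      case True
      then have "g (Suc k) = 0" "g (Suc (Suc k)) = 0"
        using nonneg[of "Suc k"] dec[of k] nonneg[of "Suc (Suc k)"] dec[of "Suc k"] by auto
      then show ?thesis by simp
    next
      case False
      then have pos: "0 < g k" using nonneg[of k] by simp
      have "g k * g (Suc (Suc k)) \<le> g (Suc k) * g (Suc k)"
        using lc[of k] by (simp add: power2_eq_square)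
      also have "\<dots> \<le> (g k / 8) * g (Suc k)"
        by (intro mult_right_mono Suc nonneg)
      finally have "g k * g (Suc (Suc k)) \<le> g k * (g (Suc k) / 8)" by simp
      then show ?thesis using pos by (simp only: mult_le_cancel_left_pos)
    qed
  qed (use start in simp)
  show ?thesis
  proof (induction k)
    case (Suc k)
    then show ?case using step[of k] by simp
  qed (use start in simp)
qed

text \<open>By Chebyshev, all but \<open>1/9\<close> of the mass lies in \<open>\<bar>\<langle>x, \<theta>\<rangle>\<bar> < 3L\<close>, and log-concavity of the
  half-space volumes propagates this first drop to a geometric decay.\<close>

lemma half_space_volume_decay:
  assumes C: "convex_body n C" "emeasure (lborel_n n) C = 1" and L: "0 < L"
    and var: "(\<integral>\<^sup>+x. indicator C x * ennreal ((inner_n n x \<theta>)\<^sup>2) \<partial>lborel_n n) \<le> ennreal (L\<^sup>2)"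
  shows "emeasure (lborel_n n) (C \<inter> {x. - (3 * L) + 6 * L * real k \<le> inner_n n x \<theta>})
    \<le> ennreal ((1 / 8) ^ k)"
proof -
  have [measurable]: "C \<in> sets borel" by (rule convex_body_borel[OF C(1)])
  define H where "H a = C \<inter> {x. a \<le> inner_n n x \<theta>}" for a
  have [measurable]: "H a \<in> sets borel" for a unfolding H_def by measurable
  define g where "g k = measure (lborel_n n) (H (- (3 * L) + 6 * L * real k))" for k :: nat
  have le1: "emeasure (lborel_n n) A \<le> 1" if "A \<subseteq> C" for A
    using emeasure_mono[OF that, of "lborel_n n"] C by simp
  have em: "emeasure (lborel_n n) A = ennreal (measure (lborel_n n) A)" if "A \<subseteq> C" for A
    using le1[OF that] by (intro emeasure_eq_ennreal_measure) (auto simp: top_unique)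
  have HC: "H a \<subseteq> C" for a by (auto simp: H_def)
  have HH: "H b \<subseteq> H a" if "a \<le> b" for a b using that by (auto simp: H_def)
  have mono: "measure (lborel_n n) A \<le> measure (lborel_n n) B"
    if "A \<subseteq> B" "B \<subseteq> C" "A \<in> sets borel" "B \<in> sets borel" for A B
    using that emeasure_mono[OF that(1), of "lborel_n n"] em[of A] em[of B]
    by (simp add: subset_trans)
  define E where "E = C \<inter> {x. 9 * L\<^sup>2 \<le> (inner_n n x \<theta>)\<^sup>2}"
  have [measurable]: "E \<in> sets borel" unfolding E_def by measurable
  have "ennreal (9 * L\<^sup>2) * emeasure (lborel_n n) E = (\<integral>\<^sup>+x. ennreal (9 * L\<^sup>2) * indicator E x \<partial>lborel_n n)"
    by (subst nn_integral_cmult_indicator) auto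
  also have "\<dots> \<le> (\<integral>\<^sup>+x. indicator C x * ennreal ((inner_n n x \<theta>)\<^sup>2) \<partial>lborel_n n)"
    by (intro nn_integral_mono) (auto simp: E_def indicator_def intro!: ennreal_leI)
  also note var
  finally have "ennreal (9 * L\<^sup>2 * measure (lborel_n n) E) \<le> ennreal (L\<^sup>2)"
    by (subst (asm) em) (auto simp: E_def ennreal_mult)
  then have "9 * L\<^sup>2 * measure (lborel_n n) E \<le> L\<^sup>2"
    by (subst (asm) ennreal_le_iff) auto
  then have E: "measure (lborel_n n) E \<le> 1 / 9" using L by (simp add: field_simps)
  have sqE: "9 * L\<^sup>2 \<le> a\<^sup>2" if "3 * L \<le> a \<or> a \<le> - (3 * L)" for a :: real
    using that L abs_le_square_iff[of "3 * L" a] by (auto simp: power_mult_distrib)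
  have "g 1 \<le> measure (lborel_n n) E"
    unfolding g_def
    by (intro mono) (use L in \<open>auto simp: H_def E_def intro!: sqE\<close>)
  with E have g1: "g 1 \<le> 1 / 9" by simp
  have "1 = measure (lborel_n n) C" using C(2) by (simp add: measure_def)
  also have "\<dots> \<le> measure (lborel_n n) (H (- (3 * L)) \<union> E)"
    by (intro mono) (auto simp: H_def E_def intro!: sqE)
  also have "\<dots> \<le> measure (lborel_n n) (H (- (3 * L))) + measure (lborel_n n) E"
    by (intro measure_Un_le) auto
  finally have g0: "8 / 9 \<le> g 0" using E by (simp add: g_def)
  have "g k \<le> (1 / 8) ^ k"
  proof (rule log_concave_seq_decay)
    fix k
    show "0 \<le> g k" by (simp add: g_def)
    show "g (Suc k) \<le> g k"
      unfolding g_def using L by (intro mono HH HC) (auto simp: algebra_simps)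
    have mid: "(- (3 * L) + 6 * L * real k + (- (3 * L) + 6 * L * real (Suc (Suc k)))) / 2 =
        - (3 * L) + 6 * L * real (Suc k)"
      by (simp add: field_simps)
    have "ennreal (g k * g (Suc (Suc k))) \<le> ennreal ((g (Suc k))\<^sup>2)"
      using half_space_volume_log_concave[OF C(1), of "- (3 * L) + 6 * L * real k" \<theta>
          "- (3 * L) + 6 * L * real (Suc (Suc k))"]
      unfolding H_def[symmetric] em[OF HC] mid
      by (simp only: g_def ennreal_mult ennreal_power measure_nonneg)
    then show "g k * g (Suc (Suc k)) \<le> (g (Suc k))\<^sup>2"
      by (subst (asm) ennreal_le_iff) auto
  next
    show "g 0 \<le> 1"
      using le1[OF HC] by (simp add: g_def em[OF HC])
    show "g 1 \<le> g 0 / 8" using g0 g1 by simp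
  qed
  then show ?thesis
    unfolding H_def[symmetric] em[OF HC] g_def by (rule ennreal_leI)
qed

text \<open>Slice \<open>C\<close> into slabs of width \<open>6L\<close>. From one slab to the next the exponential grows by \<open>exp 1 \<le> 3\<close>
  and the volume beyond the slab falls by \<open>8\<close>, so the slabs contribute a geometric series.\<close>

lemma exp_abs_moment:
  assumes C: "convex_body n C" "emeasure (lborel_n n) C = 1" and L: "0 < L"
    and var: "(\<integral>\<^sup>+x. indicator C x * ennreal ((inner_n n x \<theta>)\<^sup>2) \<partial>lborel_n n) \<le> ennreal (L\<^sup>2)"
  shows "(\<integral>\<^sup>+x. indicator C x * ennreal (exp (\<bar>inner_n n x \<theta>\<bar> / (6 * L))) \<partial>lborel_n n) \<le> 8"
proof -
  have [measurable]: "C \<in> sets borel" by (rule convex_body_borel[OF C(1)])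
  define A where "A k = C \<inter> {x. - (3 * L) + 6 * L * real k \<le> \<bar>inner_n n x \<theta>\<bar>}" for k :: nat
  have [measurable]: "A k \<in> sets borel" for k unfolding A_def by measurable
  have A: "emeasure (lborel_n n) (A k) \<le> ennreal (2 * (1 / 8) ^ k)" for k
  proof -
    let ?H = "\<lambda>\<theta>. C \<inter> {x. - (3 * L) + 6 * L * real k \<le> inner_n n x \<theta>}"
    have [measurable]: "?H \<theta> \<in> sets borel" for \<theta> by measurable
    have "emeasure (lborel_n n) (A k) \<le> emeasure (lborel_n n) (?H \<theta> \<union> ?H (- \<theta>))"
      by (intro emeasure_mono) (auto simp: A_def inner_n_simps)
    also have "\<dots> \<le> emeasure (lborel_n n) (?H \<theta>) + emeasure (lborel_n n) (?H (- \<theta>))"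
      by (intro emeasure_subadditive) auto
    also have "\<dots> \<le> ennreal ((1 / 8) ^ k) + ennreal ((1 / 8) ^ k)"
      using var by (intro add_mono half_space_volume_decay C L) (auto simp: inner_n_simps)
    also have "\<dots> = ennreal (2 * (1 / 8) ^ k)"
      by (simp flip: ennreal_plus)
    finally show ?thesis .
  qed
  have le_suminf: "u k \<le> suminf u" for u :: "nat \<Rightarrow> ennreal" and k
    using sum_le_suminf[of u "{k}"] by simp
  have ptw: "indicator C x * ennreal (exp (\<bar>inner_n n x \<theta>\<bar> / (6 * L)))
      \<le> (\<Sum>k. ennreal (2 * 3 ^ k) * indicator (A k) x)" for x
  proof (cases "x \<in> C")
    case True
    define a where "a = \<bar>inner_n n x \<theta>\<bar> / (6 * L)"
    \<comment> \<open>the largest \<open>k\<close> with \<open>x \<in> A k\<close>\<close>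
    define k where "k = nat \<lfloor>a + 1 / 2\<rfloor>"
    have a: "0 \<le> a" "\<bar>inner_n n x \<theta>\<bar> = a * (6 * L)" using L by (auto simp: a_def)
    then have k: "real k \<le> a + 1 / 2" "a + 1 / 2 < real k + 1"
      unfolding k_def by linarith+
    have "6 * L * real k \<le> 6 * L * (a + 1 / 2)"
      using L k by (intro mult_left_mono) auto
    then have "x \<in> A k" using True a by (simp add: A_def algebra_simps)
    have "exp a \<le> exp (1 / 2 + real k)" using k by simp
    also have "\<dots> = exp (1 / 2) * exp 1 ^ k" by (simp add: exp_add flip: exp_of_nat_mult)
    also have "\<dots> \<le> 2 * 3 ^ k"
    proof (intro mult_mono power_mono exp_le)
      have "exp (1 / 2) * exp (1 / 2) \<le> 2 * (2::real)"
        using exp_le by (simp flip: exp_add)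
      then show "exp (1 / 2) \<le> (2::real)"
        using power2_le_imp_le[of "exp (1/2)" "2::real"] by (simp add: power2_eq_square)
    qed auto
    finally have "ennreal (exp a) \<le> ennreal (2 * 3 ^ k) * indicator (A k) x"
      using \<open>x \<in> A k\<close> by (simp add: ennreal_leI)
    also have "\<dots> \<le> (\<Sum>i. ennreal (2 * 3 ^ i) * indicator (A i) x)"
      by (rule le_suminf)
    finally show ?thesis using True by (simp add: a_def)
  qed simp
  have "(\<integral>\<^sup>+x. indicator C x * ennreal (exp (\<bar>inner_n n x \<theta>\<bar> / (6 * L))) \<partial>lborel_n n)
      \<le> (\<integral>\<^sup>+x. (\<Sum>k. ennreal (2 * 3 ^ k) * indicator (A k) x) \<partial>lborel_n n)"
    by (intro nn_integral_mono ptw)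
  also have "\<dots> = (\<Sum>k. \<integral>\<^sup>+x. ennreal (2 * 3 ^ k) * indicator (A k) x \<partial>lborel_n n)"
    by (intro nn_integral_suminf) auto
  also have "\<dots> \<le> (\<Sum>k. ennreal (4 * (3 / 8) ^ k))"
  proof (intro suminf_le)
    fix k
    have "(\<integral>\<^sup>+x. ennreal (2 * 3 ^ k) * indicator (A k) x \<partial>lborel_n n) =
        ennreal (2 * 3 ^ k) * emeasure (lborel_n n) (A k)"
      by (intro nn_integral_cmult_indicator) auto
    also have "\<dots> \<le> ennreal (2 * 3 ^ k) * ennreal (2 * (1 / 8) ^ k)"
      by (intro mult_left_mono A) auto
    also have "\<dots> = ennreal (4 * (3 / 8) ^ k)"
      by (simp add: power_divide flip: ennreal_mult)
    finally show "(\<integral>\<^sup>+x. ennreal (2 * 3 ^ k) * indicator (A k) x \<partial>lborel_n n)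
        \<le> ennreal (4 * (3 / 8) ^ k)" .
  qed auto
  also have "\<dots> = ennreal (\<Sum>k. 4 * (3 / 8) ^ k)"
    by (intro suminf_ennreal2 summable_mult summable_geometric) auto
  also have "(\<Sum>k. 4 * (3 / 8 :: real) ^ k) = 4 * (1 / (1 - 3 / 8))"
    by (subst suminf_mult) (auto simp: suminf_geometric)
  also have "ennreal (4 * (1 / (1 - 3 / 8))) \<le> 8"
    using ennreal_leI[of "4 * (1 / (1 - 3 / 8))" 8] by simp
  finally show ?thesis .
qed

text \<open>This form keeps the linear term exact: it integrates to zero for a centred variable.\<close>

lemma exp_le_quadratic: "exp v \<le> 1 + v + v\<^sup>2 / 2 * exp \<bar>v\<bar>" for v :: real
proof -
  obtain t where t: "\<bar>t\<bar> \<le> \<bar>v\<bar>" "exp v = (\<Sum>m<2. v ^ m / fact m) + exp t / fact 2 * v ^ 2"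
    using Maclaurin_exp_le[of v 2] by blast
  have "exp t * v\<^sup>2 \<le> exp \<bar>v\<bar> * v\<^sup>2"
    using t(1) by (intro mult_right_mono) auto
  with t(2) show ?thesis by (simp add: numeral_2_eq_2 mult.commute)
qed

text \<open>The linear term of the exponential has mean \<open>0\<close> because the barycentre is \<open>0\<close>, and the
  quadratic remainder is absorbed by the exponential moment.\<close>

lemma exp_moment_isotropic:
  assumes C: "convex_body n C" "emeasure (lborel_n n) C = 1" and L: "0 < L"
    and mean: "\<And>i. i < n \<Longrightarrow> (LINT x:C|lborel_n n. x i) = 0"
    and var: "(LINT x:C|lborel_n n. (inner_n n x \<theta>)\<^sup>2) = L\<^sup>2"
    and \<mu>: "\<bar>\<mu>\<bar> * L \<le> 1 / 12"
  shows "(\<integral>\<^sup>+x. indicator C x * ennreal (exp (\<mu> * inner_n n x \<theta>)) \<partial>lborel_n n)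
    \<le> ennreal (exp (1152 * \<mu>\<^sup>2 * L\<^sup>2))"
proof -
  have Cm [measurable]: "C \<in> sets borel" by (rule convex_body_borel[OF C(1)])
  have int: "set_integrable (lborel_n n) C f" if "continuous_on UNIV f" for f :: "(nat \<Rightarrow> real) \<Rightarrow> real"
  proof -
    have "compact (f ` C)"
      by (intro compact_continuous_image convex_body_compact[OF C(1)] continuous_on_subset[OF that]) auto
    then obtain B where B: "\<And>x. x \<in> C \<Longrightarrow> \<bar>f x\<bar> \<le> B"
      using compact_imp_bounded[of "f ` C"] by (auto simp: bounded_iff)
    have [measurable]: "f \<in> borel_measurable borel"
      using that by (rule borel_measurable_continuous_onI)
    show ?thesis
      unfolding set_integrable_def
      by (rule integrableI_bounded_set_indicator[where B = B])
        (use C B in auto)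
  qed
  have toI: "(\<integral>\<^sup>+x. indicator C x * ennreal (f x) \<partial>lborel_n n) = ennreal (LINT x:C|lborel_n n. f x)"
    if "continuous_on UNIV f" "\<And>x. 0 \<le> f x" for f :: "(nat \<Rightarrow> real) \<Rightarrow> real"
  proof -
    have "(\<integral>\<^sup>+x. indicator C x * ennreal (f x) \<partial>lborel_n n) =
        (\<integral>\<^sup>+x. ennreal (indicator C x *\<^sub>R f x) \<partial>lborel_n n)"
      by (intro nn_integral_cong) (auto simp: indicator_def)
    also have "\<dots> = ennreal (LINT x:C|lborel_n n. f x)"
      unfolding set_lebesgue_integral_def
      using int[OF that(1)] that(2)
      by (intro nn_integral_eq_integral) (auto simp: set_integrable_def)
    finally show ?thesis .
  qed
  have cont: "continuous_on UNIV (\<lambda>x. inner_n n x \<theta>)"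
    by (intro continuous_intros)
  have var': "(\<integral>\<^sup>+x. indicator C x * ennreal ((inner_n n x \<theta>)\<^sup>2) \<partial>lborel_n n) \<le> ennreal (L\<^sup>2)"
    by (subst toI) (auto intro!: continuous_intros simp: var)
  define E where "E = (LINT x:C|lborel_n n. exp (\<bar>inner_n n x \<theta>\<bar> / (6 * L)))"
  have contE: "continuous_on UNIV (\<lambda>x. exp (\<bar>inner_n n x \<theta>\<bar> / (6 * L)))"
    using L by (intro continuous_intros) auto
  have "ennreal E \<le> 8"
    using exp_abs_moment[OF C L var'] unfolding E_def by (subst (asm) toI[OF contE]) auto
  then have "ennreal E \<le> ennreal 8" by simp
  then have E: "E \<le> 8" by (subst (asm) ennreal_le_iff) auto
  have "(LINT x:C|lborel_n n. inner_n n x \<theta>) = (\<Sum>i<n. (LINT x:C|lborel_n n. x i * \<theta> i))"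
    unfolding inner_n_def set_lebesgue_integral_def scaleR_sum_right
  proof (intro Bochner_Integration.integral_sum)
    fix i
    have "set_integrable (lborel_n n) C (\<lambda>x. x i * \<theta> i)"
      by (intro int continuous_intros)
    then show "integrable (lborel_n n) (\<lambda>x. indicat_real C x *\<^sub>R (x i * \<theta> i))"
      by (simp add: set_integrable_def)
  qed
  also have "\<dots> = 0"
    using mean by (intro sum.neutral) simp
  finally have mean': "(LINT x:C|lborel_n n. inner_n n x \<theta>) = 0" .
  have vol: "(LINT x:C|lborel_n n. (1::real)) = 1"
    using C(2) by (simp add: set_integral_const measure_def)
  have ptw: "exp (\<mu> * inner_n n x \<theta>)
      \<le> 1 + \<mu> * inner_n n x \<theta> + 144 * \<mu>\<^sup>2 * L\<^sup>2 * exp (\<bar>inner_n n x \<theta>\<bar> / (6 * L))" for x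
  proof -
    define u where "u = inner_n n x \<theta>"
    \<comment> \<open>Half of the available exponential moment absorbs \<open>u\<^sup>2\<close>, the other half absorbs \<open>exp \<bar>\<mu> u\<bar>\<close>.\<close>
    define y where "y = \<bar>u\<bar> / (12 * L)"
    have y: "0 \<le> y" "\<bar>u\<bar> = 12 * L * y" using L by (auto simp: y_def)
    have "y\<^sup>2 / 2 \<le> exp y"
      using exp_lower_Taylor_quadratic[OF y(1)] y(1) by simp
    then have y2: "y\<^sup>2 \<le> 2 * exp y" by simp
    have "u\<^sup>2 = 144 * (L\<^sup>2 * y\<^sup>2)"
      using y(2) power2_abs[of u] by (simp add: power_mult_distrib)
    also have "\<dots> \<le> 144 * (L\<^sup>2 * (2 * exp y))"
      by (intro mult_left_mono y2) auto
    finally have u2: "u\<^sup>2 \<le> 288 * L\<^sup>2 * exp y" by (simp add: mult.assoc)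
    have "\<bar>\<mu> * u\<bar> = (\<bar>\<mu>\<bar> * L) * (12 * y)" using y(2) by (simp add: abs_mult)
    also have "\<dots> \<le> (1 / 12) * (12 * y)" using \<mu> y(1) by (intro mult_right_mono) auto
    finally have e: "exp \<bar>\<mu> * u\<bar> \<le> exp y" by simp
    have "(\<mu> * u)\<^sup>2 / 2 * exp \<bar>\<mu> * u\<bar> = \<mu>\<^sup>2 / 2 * (u\<^sup>2 * exp \<bar>\<mu> * u\<bar>)"
      by (simp add: power_mult_distrib)
    also have "\<dots> \<le> \<mu>\<^sup>2 / 2 * ((288 * L\<^sup>2 * exp y) * exp y)"
      by (intro mult_left_mono mult_mono u2 e) auto
    also have "\<dots> = 144 * \<mu>\<^sup>2 * L\<^sup>2 * exp (y + y)"
      unfolding exp_add by (simp only: ac_simps)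
    also have "y + y = \<bar>u\<bar> / (6 * L)" by (simp add: y_def)
    finally show ?thesis using exp_le_quadratic[of "\<mu> * u"] unfolding u_def by linarith
  qed
  have cont3: "continuous_on UNIV (\<lambda>x. 144 * \<mu>\<^sup>2 * L\<^sup>2 * exp (\<bar>inner_n n x \<theta>\<bar> / (6 * L)))"
    "continuous_on UNIV (\<lambda>x. 1 + \<mu> * inner_n n x \<theta>)" "continuous_on UNIV (\<lambda>x. \<mu> * inner_n n x \<theta>)"
    "continuous_on UNIV (\<lambda>x. exp (\<mu> * inner_n n x \<theta>))"
    by (intro continuous_intros contE cont)+
  have "(LINT x:C|lborel_n n. exp (\<mu> * inner_n n x \<theta>)) \<le> (LINT x:C|lborel_n n.
      (1 + \<mu> * inner_n n x \<theta>) + 144 * \<mu>\<^sup>2 * L\<^sup>2 * exp (\<bar>inner_n n x \<theta>\<bar> / (6 * L)))"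
    using cont3 L by (intro set_integral_mono int continuous_intros ptw) auto
  also have "\<dots> = 1 + 144 * \<mu>\<^sup>2 * L\<^sup>2 * E"
    using cont3 cont int[of "\<lambda>_. 1"]
    by (subst set_integral_add; (intro int)?)
       (auto simp: set_integral_add int vol mean' E_def intro!: continuous_intros)
  also have "\<dots> \<le> 1 + 144 * \<mu>\<^sup>2 * L\<^sup>2 * 8"
    using E by (intro add_left_mono mult_left_mono) auto
  also have "\<dots> \<le> exp (1152 * \<mu>\<^sup>2 * L\<^sup>2)"
    using exp_ge_add_one_self[of "1152 * \<mu>\<^sup>2 * L\<^sup>2"] by (simp add: mult.assoc)
  finally show ?thesis
    by (subst toI) (auto simp: cont3 intro!: ennreal_leI)
qed

lemma exp_moment_isotropic_scaled:
  assumes C: "convex_body n C" "emeasure (lborel_n n) C = 1" and L: "0 < L"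
    and mean: "\<And>i. i < n \<Longrightarrow> (LINT x:C|lborel_n n. x i) = 0"
    and var: "\<And>\<xi>. \<xi> \<in> unit_sphere n \<Longrightarrow> (LINT x:C|lborel_n n. (inner_n n x \<xi>)\<^sup>2) = L\<^sup>2"
    and \<theta>: "\<theta> \<in> Rn n" and \<mu>: "\<bar>\<mu>\<bar> * norm_n n \<theta> * L \<le> 1 / 12"
  shows "(\<integral>\<^sup>+x. indicator C x * ennreal (exp (\<mu> * inner_n n x \<theta>)) \<partial>lborel_n n)
    \<le> ennreal (exp (1152 * (\<mu> * norm_n n \<theta>)\<^sup>2 * L\<^sup>2))"
proof (cases "\<theta> = 0")
  case True
  have [measurable]: "C \<in> sets borel" by (rule convex_body_borel[OF C(1)])
  show ?thesis using C(2) by (simp add: True inner_n_simps norm_n_zero)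
next
  case False
  let ?\<xi> = "scale (1 / norm_n n \<theta>) \<theta>"
  have pos: "0 < norm_n n \<theta>" by (rule norm_n_pos[OF \<theta> False])
  have eq: "\<mu> * inner_n n x \<theta> = (\<mu> * norm_n n \<theta>) * inner_n n x ?\<xi>" for x
    using pos by (simp only: inner_n_simps) simp
  have "(\<integral>\<^sup>+x. indicator C x * ennreal (exp ((\<mu> * norm_n n \<theta>) * inner_n n x ?\<xi>)) \<partial>lborel_n n)
    \<le> ennreal (exp (1152 * (\<mu> * norm_n n \<theta>)\<^sup>2 * L\<^sup>2))"
    using \<mu> by (intro exp_moment_isotropic C L mean var unit_sphere_normalize \<theta> False)
      (auto simp: abs_mult)
  then show ?thesis unfolding eq .
qed

text \<open>For the weighted sum of independent copies the Laplace transforms multiply, and the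
  quadratic exponents add up to the square of the Euclidean norm of the weights.\<close>

lemma exp_moment_weighted_sum:
  fixes s :: nat
  assumes C: "convex_body n C" "emeasure (lborel_n n) C = 1" and L: "0 < L"
    and mean: "\<And>i. i < n \<Longrightarrow> (LINT x:C|lborel_n n. x i) = 0"
    and var: "\<And>\<xi>. \<xi> \<in> unit_sphere n \<Longrightarrow> (LINT x:C|lborel_n n. (inner_n n x \<xi>)\<^sup>2) = L\<^sup>2"
    and \<theta>: "\<theta> \<in> Rn n" "norm_n n \<theta> \<le> 1"
    and \<tau>: "L2_set t {..<s} \<le> \<tau>" "0 < \<tau>"
  shows "(\<integral>\<^sup>+x. indicator ({..<s} \<rightarrow>\<^sub>E C) x *
      ennreal (exp (1 / (12 * L * \<tau>) * inner_n n (\<lambda>i. \<Sum>j<s. t j * x j i) \<theta>))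
        \<partial>Pi\<^sub>M {..<s} (\<lambda>_. lborel_n n)) \<le> ennreal (exp 8)"
proof -
  have [measurable]: "C \<in> sets borel" by (rule convex_body_borel[OF C(1)])
  define l where "l = 1 / (12 * L * \<tau>)"
  have l: "0 < l" "l * L * \<tau> = 1 / 12" using L \<tau> by (auto simp: l_def)
  let ?f = "\<lambda>j x. indicator C x * ennreal (exp (l * t j * inner_n n x \<theta>)) :: ennreal"
  have inner: "inner_n n (\<lambda>i. \<Sum>j<s. t j * x j i) \<theta> = (\<Sum>j<s. t j * inner_n n (x j) \<theta>)" for x
    unfolding inner_n_def sum_distrib_left sum_distrib_right
    by (subst sum.swap) (simp add: mult.assoc)
  have "(\<integral>\<^sup>+x. indicator ({..<s} \<rightarrow>\<^sub>E C) x * ennreal (exp (l * inner_n n (\<lambda>i. \<Sum>j<s. t j * x j i) \<theta>))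
        \<partial>Pi\<^sub>M {..<s} (\<lambda>_. lborel_n n)) =
      (\<integral>\<^sup>+x. (\<Prod>j<s. ?f j (x j)) \<partial>Pi\<^sub>M {..<s} (\<lambda>_. lborel_n n))"
  proof (intro nn_integral_cong)
    fix x assume x: "x \<in> space (Pi\<^sub>M {..<s} (\<lambda>_. lborel_n n))"
    have "(\<Prod>j<s. ?f j (x j)) = (\<Prod>j<s. indicator C (x j)) * (\<Prod>j<s. ennreal (exp (l * t j * inner_n n (x j) \<theta>)))"
      by (simp only: prod.distrib)
    also have "(\<Prod>j<s. indicator C (x j)) = (indicator ({..<s} \<rightarrow>\<^sub>E C) x :: ennreal)"
      using x by (auto simp: indicator_def space_PiM PiE_iff)
    also have "(\<Prod>j<s. ennreal (exp (l * t j * inner_n n (x j) \<theta>))) =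
        ennreal (exp (l * inner_n n (\<lambda>i. \<Sum>j<s. t j * x j i) \<theta>))"
      by (simp add: prod_ennreal inner sum_distrib_left mult.assoc flip: exp_sum)
    finally show "indicator ({..<s} \<rightarrow>\<^sub>E C) x * ennreal (exp (l * inner_n n (\<lambda>i. \<Sum>j<s. t j * x j i) \<theta>)) =
        (\<Prod>j<s. ?f j (x j))" ..
  qed
  also have "\<dots> = (\<Prod>j<s. integral\<^sup>N (lborel_n n) (?f j))"
    by (intro lborel_n_prod.product_nn_integral_prod) auto
  also have "\<dots> \<le> (\<Prod>j<s. ennreal (exp (1152 * (l * t j * norm_n n \<theta>)\<^sup>2 * L\<^sup>2)))"
  proof (intro prod_mono_ennreal exp_moment_isotropic_scaled C L mean var \<theta>)
    fix j assume "j \<in> {..<s}"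
    then have "\<bar>t j\<bar> \<le> \<tau>"
      using order_trans[OF abs_coord_le_norm_n \<tau>(1)] by simp
    then have "\<bar>t j\<bar> * norm_n n \<theta> \<le> \<tau> * 1"
      using \<theta> \<tau> by (intro mult_mono) auto
    then have "(l * L) * (\<bar>t j\<bar> * norm_n n \<theta>) \<le> (l * L) * (\<tau> * 1)"
      using l L by (intro mult_left_mono) auto
    then show "\<bar>l * t j\<bar> * norm_n n \<theta> * L \<le> 1 / 12"
      using l by (simp add: abs_mult ac_simps)
  qed
  also have "\<dots> = ennreal (exp (\<Sum>j<s. 1152 * (l * t j * norm_n n \<theta>)\<^sup>2 * L\<^sup>2))"
    by (simp add: prod_ennreal exp_sum)
  also have "(\<Sum>j<s. 1152 * (l * t j * norm_n n \<theta>)\<^sup>2 * L\<^sup>2) =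
      1152 * (l * L * norm_n n \<theta>)\<^sup>2 * (L2_set t {..<s})\<^sup>2"
    unfolding norm_n_sq_sum[where x = t] sum_distrib_left
    by (intro sum.cong refl) (simp add: power_mult_distrib ac_simps)
  also have "\<dots> \<le> 1152 * (l * L * 1)\<^sup>2 * \<tau>\<^sup>2"
    using \<theta> \<tau> l L by (intro mult_mono power_mono mult_left_mono) auto
  also have "\<dots> = 8"
  proof -
    have "1152 * (l * L * 1)\<^sup>2 * \<tau>\<^sup>2 = 1152 * (l * L * \<tau>)\<^sup>2"
      by (simp add: power_mult_distrib)
    then show ?thesis unfolding l(2) by (simp add: power2_eq_square)
  qed
  finally show ?thesis unfolding l_def by (simp add: ennreal_leI)
qed

section \<open>Reflections and the Gaussian weight\<close>

definition reflect :: "nat \<Rightarrow> (nat \<Rightarrow> real) \<Rightarrow> (nat \<Rightarrow> real) \<Rightarrow> nat \<Rightarrow> real"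
  where "reflect n v x = x - scale (2 * inner_n n x v / inner_n n v v) v"

context
  fixes n :: nat and v :: "nat \<Rightarrow> real"
  assumes v: "v \<in> Rn n" "v \<noteq> 0"
begin

lemma inner_v_pos: "0 < inner_n n v v"
  using norm_n_pos[OF v] by (simp add: norm_n_sq[symmetric])

lemma reflect_Rn: "x \<in> Rn n \<Longrightarrow> reflect n v x \<in> Rn n"
  unfolding reflect_def by (intro Rn_closed v)

lemma reflect_diff: "reflect n v (x - y) = reflect n v x - reflect n v y"
  by (simp add: reflect_def inner_n_simps fun_eq_iff algebra_simps diff_divide_distrib)

lemma reflect_scale: "reflect n v (scale r x) = scale r (reflect n v x)"
  by (simp add: reflect_def inner_n_simps fun_eq_iff algebra_simps)

lemma reflect_reflect: "reflect n v (reflect n v x) = x"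
  unfolding reflect_def inner_n_simps
  using inner_v_pos by (simp add: fun_eq_iff field_simps)

lemma norm_reflect: "norm_n n (reflect n v x) = norm_n n x"
proof -
  have "inner_n n (reflect n v x) (reflect n v x) = inner_n n x x"
    unfolding reflect_def inner_n_simps
    using inner_v_pos by (simp add: inner_n_commute[of n v x] field_simps)
  then have "(norm_n n (reflect n v x))\<^sup>2 = (norm_n n x)\<^sup>2"
    by (simp add: norm_n_sq)
  then show ?thesis by (rule power2_eq_imp_eq) auto
qed

lemma reflect_measurable [measurable]: "reflect n v \<in> borel_measurable borel"
  unfolding reflect_def by measurable

text \<open>The image of Lebesgue measure under the reflection is again translation invariant. Two
  translation invariant measures agree up to the ratio of their values on the unit ball; this is
  an exchange of the order of integration. The unit ball is invariant under the reflection.\<close>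

lemma nn_integral_lborel_n_reflect:
  assumes [measurable]: "f \<in> borel_measurable borel"
  shows "(\<integral>\<^sup>+x. f (reflect n v x) \<partial>lborel_n n) = (\<integral>\<^sup>+x. f x \<partial>lborel_n n)"
proof -
  define B where "B = {x. norm_n n x \<le> 1}"
  have [measurable]: "B \<in> sets borel" unfolding B_def by measurable
  define g where "g = (indicator B :: (nat \<Rightarrow> real) \<Rightarrow> ennreal)"
  have [measurable]: "g \<in> borel_measurable borel" unfolding g_def by measurable
  let ?\<beta> = "emeasure (lborel_n n) B"
  let ?R = "reflect n v"
  have gR: "g (?R x) = g x" for x by (simp add: g_def B_def norm_reflect indicator_def)
  have g_diff: "g (x - y) = g (y - x)" for x y
    by (simp add: g_def B_def indicator_def norm_n_diff_commute[where x = x and y = y])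
  have "?\<beta> * (\<integral>\<^sup>+x. f x \<partial>lborel_n n) = (\<integral>\<^sup>+y. g y * (\<integral>\<^sup>+x. f x \<partial>lborel_n n) \<partial>lborel_n n)"
    by (simp add: nn_integral_multc g_def)
  also have "\<dots> = (\<integral>\<^sup>+y. \<integral>\<^sup>+x. g (?R y) * f (x + ?R y) \<partial>lborel_n n \<partial>lborel_n n)"
    using AE_lborel_n
  proof (intro nn_integral_cong_AE, eventually_elim)
    case (elim y)
    then have "(\<integral>\<^sup>+x. f x \<partial>lborel_n n) = (\<integral>\<^sup>+x. f (x + ?R y) \<partial>lborel_n n)"
      by (intro nn_integral_lborel_n_translate[symmetric] reflect_Rn) auto
    then show ?case by (simp add: gR nn_integral_cmult)
  qed
  also have "\<dots> = (\<integral>\<^sup>+x. \<integral>\<^sup>+y. g (?R y) * f (x + ?R y) \<partial>lborel_n n \<partial>lborel_n n)"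
    by (intro lborel_n_pair.Fubini') (unfold split_beta', measurable)
  also have "\<dots> = (\<integral>\<^sup>+x. \<integral>\<^sup>+y. g (?R y - x) * f (?R y) \<partial>lborel_n n \<partial>lborel_n n)"
    using AE_lborel_n
  proof (intro nn_integral_cong_AE, eventually_elim)
    case (elim x)
    have "?R (y + - ?R x) = ?R y - x" for y
      using reflect_diff[of y "?R x"] by (simp add: reflect_reflect)
    then show ?case
      using nn_integral_lborel_n_translate[of "\<lambda>y. g (?R y) * f (x + ?R y)" "- ?R x" n]
        Rn_closed(4)[OF reflect_Rn[OF elim(2)]]
      by simp
  qed
  also have "\<dots> = (\<integral>\<^sup>+y. \<integral>\<^sup>+x. g (?R y - x) * f (?R y) \<partial>lborel_n n \<partial>lborel_n n)"
    by (intro lborel_n_pair.Fubini'[symmetric]) (unfold split_beta', measurable)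
  also have "\<dots> = (\<integral>\<^sup>+y. ?\<beta> * f (?R y) \<partial>lborel_n n)"
    using AE_lborel_n
  proof (intro nn_integral_cong_AE, eventually_elim)
    case (elim y)
    have "(\<integral>\<^sup>+x. g (?R y - x) \<partial>lborel_n n) = (\<integral>\<^sup>+x. g (x + - ?R y) \<partial>lborel_n n)"
      by (subst g_diff) simp
    also have "\<dots> = ?\<beta>"
      using Rn_closed(4)[OF reflect_Rn[OF elim(2)]]
      by (subst nn_integral_lborel_n_translate) (auto simp: g_def)
    finally show ?case by (simp add: nn_integral_multc)
  qed
  also have "\<dots> = ?\<beta> * (\<integral>\<^sup>+x. f (?R x) \<partial>lborel_n n)"
    by (intro nn_integral_cmult) auto
  finally have eq: "?\<beta> * (\<integral>\<^sup>+x. f x \<partial>lborel_n n) = ?\<beta> * (\<integral>\<^sup>+x. f (?R x) \<partial>lborel_n n)" .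
  have "?\<beta> \<le> emeasure (lborel_n n) {x. \<forall>i<n. \<bar>x i\<bar> \<le> 1}"
    unfolding B_def by (intro emeasure_mono) (auto intro: order_trans[OF abs_coord_le_norm_n])
  then have fin: "?\<beta> < top"
    using emeasure_lborel_n_cube[of 1 n] by (simp add: le_less_trans[OF _ ennreal_less_top])
  have "{x. \<forall>i<n. \<bar>x i\<bar> \<le> 1 / (real n + 1)} \<subseteq> B"
  proof
    fix x :: "nat \<Rightarrow> real" assume x: "x \<in> {x. \<forall>i<n. \<bar>x i\<bar> \<le> 1 / (real n + 1)}"
    have "norm_n n x \<le> (\<Sum>i<n. \<bar>x i\<bar>)" by (rule L2_set_le_sum_abs)
    also have "\<dots> \<le> (\<Sum>i<n. 1 / (real n + 1))" using x by (intro sum_mono) auto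
    also have "\<dots> \<le> 1" by simp
    finally show "x \<in> B" by (simp add: B_def)
  qed
  then have "emeasure (lborel_n n) {x. \<forall>i<n. \<bar>x i\<bar> \<le> 1 / (real n + 1)} \<le> ?\<beta>"
    by (intro emeasure_mono) auto
  then have "0 < ?\<beta>"
    by (subst (asm) emeasure_lborel_n_cube) (auto intro: less_le_trans[rotated])
  with eq fin show ?thesis
    by (auto simp: ennreal_mult_cancel_left)
qed

end

definition gauss :: "nat \<Rightarrow> (nat \<Rightarrow> real) \<Rightarrow> real"
  where "gauss n x = (\<Prod>i<n. std_normal_density (x i))"

lemma gauss_nonneg [simp]: "0 \<le> gauss n x"
  by (simp add: gauss_def prod_nonneg)

lemma gauss_measurable [measurable]: "gauss n \<in> borel_measurable borel"
  unfolding gauss_def by measurable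

lemma gauss_eq: "gauss n x = (1 / sqrt (2 * pi)) ^ n * exp (- (norm_n n x)\<^sup>2 / 2)"
  unfolding gauss_def std_normal_density_def norm_n_sq_sum
  by (simp add: prod_dividef power_one_over sum_negf sum_divide_distrib flip: exp_sum)

lemma nn_integral_std_normal:
  "(\<integral>\<^sup>+x. ennreal (std_normal_density x) \<partial>lborel) = 1"
  "(\<integral>\<^sup>+x. ennreal (x\<^sup>2 * std_normal_density x) \<partial>lborel) = 1"
proof -
  have *: "(\<integral>\<^sup>+x. ennreal (std_normal_density x * x ^ (2 * k)) \<partial>lborel) =
      ennreal (fact (2 * k) / (2 ^ k * fact k))" for k
    using std_normal_moment_even[of k]
    by (subst nn_integral_eq_integral) (auto simp: has_bochner_integral_iff)
  show "(\<integral>\<^sup>+x. ennreal (std_normal_density x) \<partial>lborel) = 1"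
    using *[of 0] by simp
  show "(\<integral>\<^sup>+x. ennreal (x\<^sup>2 * std_normal_density x) \<partial>lborel) = 1"
    using *[of 1] by (simp add: numeral_2_eq_2 mult.commute)
qed

lemma nn_integral_gauss: "(\<integral>\<^sup>+x. ennreal (gauss n x) \<partial>lborel_n n) = 1"
  using nn_integral_lborel_n_prod[where f = "\<lambda>_ x. ennreal (std_normal_density x)" and n = n]
  by (simp add: gauss_def nn_integral_std_normal prod_ennreal)

lemma nn_integral_gauss_sq:
  "(\<integral>\<^sup>+x. ennreal ((norm_n n x)\<^sup>2 * gauss n x) \<partial>lborel_n n) = of_nat n"
proof -
  have "(\<integral>\<^sup>+x. ennreal ((norm_n n x)\<^sup>2 * gauss n x) \<partial>lborel_n n) =
      (\<integral>\<^sup>+x. (\<Sum>i<n. ennreal ((x i)\<^sup>2 * gauss n x)) \<partial>lborel_n n)"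
    by (intro nn_integral_cong) (simp add: norm_n_sq_sum sum_distrib_right sum_ennreal)
  also have "\<dots> = (\<Sum>i<n. \<integral>\<^sup>+x. ennreal ((x i)\<^sup>2 * gauss n x) \<partial>lborel_n n)"
    by (intro nn_integral_sum) auto
  also have "\<dots> = (\<Sum>i<n. 1)"
  proof (intro sum.cong refl)
    fix i assume "i \<in> {..<n}"
    then have i: "i < n" by simp
    let ?f = "\<lambda>j y. ennreal ((if j = i then y\<^sup>2 else 1) * std_normal_density y)"
    have "ennreal ((x i)\<^sup>2 * gauss n x) = (\<Prod>j<n. ?f j (x j))" for x
      using i by (simp add: prod_ennreal prod.distrib gauss_def)
    then have "(\<integral>\<^sup>+x. ennreal ((x i)\<^sup>2 * gauss n x) \<partial>lborel_n n) = (\<Prod>j<n. integral\<^sup>N lborel (?f j))"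
      by (simp only:) (rule nn_integral_lborel_n_prod[where f = ?f], measurable)
    also have "\<dots> = 1"
    proof (intro prod.neutral ballI)
      fix j show "integral\<^sup>N lborel (?f j) = 1"
        by (cases "j = i") (simp_all add: nn_integral_std_normal)
    qed
    finally show "(\<integral>\<^sup>+x. ennreal ((x i)\<^sup>2 * gauss n x) \<partial>lborel_n n) = 1" .
  qed
  finally show ?thesis by simp
qed

lemma nn_integral_gauss_norm:
  assumes "1 \<le> n"
  shows "(\<integral>\<^sup>+x. ennreal (norm_n n x * gauss n x) \<partial>lborel_n n) \<le> ennreal (sqrt (real n))"
proof -
  have n: "0 < sqrt (real n)" using assms by simp
  have amgm: "norm_n n x \<le> sqrt (real n) / 2 + 1 / (2 * sqrt (real n)) * (norm_n n x)\<^sup>2" for x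
  proof -
    have "0 \<le> (norm_n n x - sqrt (real n))\<^sup>2 / (2 * sqrt (real n))" using n by simp
    then show ?thesis using n by (simp add: power2_eq_square field_simps)
  qed
  have "(\<integral>\<^sup>+x. ennreal (norm_n n x * gauss n x) \<partial>lborel_n n)
      \<le> (\<integral>\<^sup>+x. ennreal (sqrt (real n) / 2) * ennreal (gauss n x) +
          ennreal (1 / (2 * sqrt (real n))) * ennreal ((norm_n n x)\<^sup>2 * gauss n x) \<partial>lborel_n n)"
  proof (intro nn_integral_mono)
    fix x
    have "norm_n n x * gauss n x \<le> (sqrt (real n) / 2 + 1 / (2 * sqrt (real n)) * (norm_n n x)\<^sup>2) * gauss n x"
      by (intro mult_right_mono amgm) simp
    then show "ennreal (norm_n n x * gauss n x) \<le> ennreal (sqrt (real n) / 2) * ennreal (gauss n x) +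
          ennreal (1 / (2 * sqrt (real n))) * ennreal ((norm_n n x)\<^sup>2 * gauss n x)"
      by (simp add: ennreal_leI algebra_simps flip: ennreal_mult ennreal_plus)
  qed
  also have "\<dots> = ennreal (sqrt (real n) / 2) + ennreal (1 / (2 * sqrt (real n))) * of_nat n"
    by (simp add: nn_integral_add nn_integral_cmult nn_integral_gauss nn_integral_gauss_sq)
  also have "\<dots> = ennreal (sqrt (real n) / 2 + 1 / (2 * sqrt (real n)) * real n)"
    by (simp add: ennreal_of_nat_eq_real_of_nat flip: ennreal_mult ennreal_plus)
  also have "sqrt (real n) / 2 + 1 / (2 * sqrt (real n)) * real n = sqrt (real n)"
    using n by (simp add: field_simps)
  finally show ?thesis .
qed

section \<open>The invariant measure on the sphere and the Gaussian average of a norm\<close>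

lemma unit_sphereD: "\<xi> \<in> unit_sphere n \<Longrightarrow> \<xi> \<in> Rn n" "\<xi> \<in> unit_sphere n \<Longrightarrow> norm_n n \<xi> = 1"
  by (auto simp: unit_sphere_def)

lemma unit_sphere_borel [measurable]: "unit_sphere n \<in> sets borel"
proof -
  have "unit_sphere n = Rn n \<inter> {x. norm_n n x = 1}" by (auto simp: unit_sphere_def)
  also have "\<dots> \<in> sets borel" by measurable
  finally show ?thesis .
qed

lemma lipschitz_continuous_on_Rn:
  assumes lip: "\<And>x y. x \<in> Rn n \<Longrightarrow> y \<in> Rn n \<Longrightarrow> F x \<le> F y + b * norm_n n (x - y)"
  shows "continuous_on (Rn n) F"
  unfolding continuous_on_def
proof
  fix x assume x: "x \<in> Rn n"
  have "continuous_on UNIV (\<lambda>y. b * norm_n n (y - x))"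
    by (intro continuous_intros) (simp, intro continuous_intros)
  then have "((\<lambda>y. b * norm_n n (y - x)) \<longlongrightarrow> b * norm_n n (x - x)) (at x within Rn n)"
    unfolding continuous_on_def by (meson UNIV_I subset_UNIV tendsto_within_subset)
  then have lim: "((\<lambda>y. b * norm_n n (y - x)) \<longlongrightarrow> 0) (at x within Rn n)"
    by (simp add: norm_n_zero)
  have "\<bar>F y - F x\<bar> \<le> b * norm_n n (y - x)" if "y \<in> Rn n" for y
    using lip[OF that x] lip[OF x that] norm_n_diff_commute[where x = x and y = y and n = n]
    by (simp add: abs_le_iff)
  then have "eventually (\<lambda>y. norm (F y - F x) \<le> b * norm_n n (y - x)) (at x within Rn n)"
    by (simp add: eventually_at_filter)
  then have "((\<lambda>y. F y - F x) \<longlongrightarrow> 0) (at x within Rn n)"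
    by (rule Lim_null_comparison) (rule lim)
  then show "(F \<longlongrightarrow> F x) (at x within Rn n)"
    by (rule LIM_zero_cancel)
qed

lemma lipschitz_borel_Rn:
  assumes lip: "\<And>x y. x \<in> Rn n \<Longrightarrow> y \<in> Rn n \<Longrightarrow> F x \<le> F y + b * norm_n n (x - y)"
  shows "(\<lambda>x. indicator (Rn n) x * F x :: real) \<in> borel_measurable borel"
proof -
  have "(\<lambda>x. indicator (Rn n) x *\<^sub>R F x) \<in> borel_measurable borel"
    by (intro borel_measurable_continuous_on_indicator lipschitz_continuous_on_Rn[where b = b] lip) auto
  then show ?thesis by simp
qed

lemma reflect_swap:
  assumes "\<xi> \<in> unit_sphere n" "\<eta> \<in> unit_sphere n" "\<xi> \<noteq> \<eta>"
  shows "reflect n (\<xi> - \<eta>) \<xi> = \<eta>"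
proof -
  have 1: "inner_n n \<xi> \<xi> = 1" "inner_n n \<eta> \<eta> = 1"
    using assms by (auto simp: unit_sphere_def norm_n_sq[symmetric])
  have "\<xi> - \<eta> \<in> Rn n" "\<xi> - \<eta> \<noteq> 0" using assms unit_sphereD(1) Rn_closed(3) by auto
  then have "0 < inner_n n (\<xi> - \<eta>) (\<xi> - \<eta>)" by (rule inner_v_pos)
  then have coeff: "2 * inner_n n \<xi> (\<xi> - \<eta>) / inner_n n (\<xi> - \<eta>) (\<xi> - \<eta>) = 1"
    by (simp add: inner_n_simps 1 inner_n_commute[of n \<eta> \<xi>])
  show ?thesis
    unfolding reflect_def coeff by (simp add: fun_eq_iff)
qed

lemma reflect_orthogonal:
  assumes v: "v \<in> Rn n" "v \<noteq> 0"
  defines "A \<equiv> \<lambda>i j. (if i = j then 1 else 0) - 2 * v i * v j / inner_n n v v"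
  shows "orthogonal_n n A"
    and "x \<in> Rn n \<Longrightarrow> apply_n n A x = reflect n v x"
proof -
  define c where "c = 2 / inner_n n v v"
  have c: "c * (\<Sum>k<n. v k * v k) = 2"
    using inner_v_pos[OF v] by (simp add: c_def inner_n_def)
  have A: "A i j = (if i = j then 1 else 0) - c * v i * v j" for i j
    by (simp add: A_def c_def)
  show "orthogonal_n n A"
    unfolding orthogonal_n_def
  proof (intro allI impI)
    fix i j assume ij: "i < n" "j < n"
    have "A k i * A k j = (if k = i then (if k = j then 1 else 0) else 0) - (if k = i then c * v i * v j else 0)
        - (if k = j then c * v i * v j else 0) + c * v i * v j * (c * (v k * v k))" for k
      by (auto simp: A algebra_simps)
    then have "(\<Sum>k<n. A k i * A k j) = (\<Sum>k<n. if k = i then (if k = j then 1 else 0) else 0) -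
        (\<Sum>k<n. if k = i then c * v i * v j else 0) - (\<Sum>k<n. if k = j then c * v i * v j else 0) +
        c * v i * v j * (c * (\<Sum>k<n. v k * v k))"
      by (simp add: sum.distrib sum_subtractf sum_distrib_left)
    also have "\<dots> = (if i = j then 1 else 0)"
      unfolding c using ij by simp
    finally show "(\<Sum>k<n. A k i * A k j) = (if i = j then 1 else 0)" .
  qed
  show "apply_n n A x = reflect n v x" if "x \<in> Rn n"
  proof
    fix i
    show "apply_n n A x i = reflect n v x i"
    proof (cases "i < n")
      case True
      have "A i j * x j = (if i = j then x j else 0) - c * v i * (x j * v j)" for j
        by (auto simp: A algebra_simps)
      then have "(\<Sum>j<n. A i j * x j) = x i - c * v i * inner_n n x v"
        using True by (simp add: sum_subtractf sum_distrib_left inner_n_def)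
      then show ?thesis
        using True by (simp add: apply_n_def reflect_def c_def)
    next
      case False
      then show ?thesis using that v by (simp add: apply_n_def reflect_def Rn_iff)
    qed
  qed
qed

context
  fixes n :: nat and \<sigma> :: "(nat \<Rightarrow> real) measure"
  assumes n: "1 \<le> n" and \<sigma>: "rotation_invariant_prob n \<sigma>"
begin

lemma sets_sphere: "sets \<sigma> = sets (restrict_space borel (unit_sphere n))"
  using \<sigma> by (simp add: rotation_invariant_prob_def)

lemma measurable_sphere: "f \<in> measurable borel M \<Longrightarrow> f \<in> measurable \<sigma> M"
  using measurable_restrict_space1[of f borel M "unit_sphere n"]
  unfolding measurable_cong_sets[OF sets_sphere refl] .

lemma space_sphere: "space \<sigma> = unit_sphere n"
  using \<sigma> by (simp add: rotation_invariant_prob_def)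

lemma prob_space_sphere: "prob_space \<sigma>"
  using \<sigma> unfolding rotation_invariant_prob_def by (intro prob_spaceI) blast

text \<open>The invariant measure lives on the trace \<open>\<sigma>\<close>-algebra of the sphere. Extended to all Borel sets
  of the ambient space it can be paired with \<open>lborel_n\<close> and integrated against Borel functions.\<close>

definition sphere_ext :: "(nat \<Rightarrow> real) measure"
  where "sphere_ext = distr \<sigma> borel (\<lambda>x. x)"

lemma sets_sphere_ext [simp, measurable_cong]: "sets sphere_ext = sets borel"
  by (simp add: sphere_ext_def)

lemma prob_space_sphere_ext: "prob_space sphere_ext"
  unfolding sphere_ext_def by (intro prob_space.prob_space_distr prob_space_sphere measurable_sphere) simp

lemma nn_integral_sphere_ext:
  "f \<in> borel_measurable borel \<Longrightarrow> (\<integral>\<^sup>+\<xi>. f \<xi> \<partial>sphere_ext) = (\<integral>\<^sup>+\<xi>. f \<xi> \<partial>\<sigma>)"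
  unfolding sphere_ext_def by (subst nn_integral_distr) (auto intro: measurable_sphere)

lemma AE_sphere_ext: "AE \<xi> in sphere_ext. \<xi> \<in> unit_sphere n"
  unfolding sphere_ext_def
  by (subst AE_distr_iff) (auto simp: space_sphere intro: measurable_sphere)

lemma nn_integral_sphere_reflect:
  assumes v: "v \<in> Rn n" "v \<noteq> 0" and f: "f \<in> borel_measurable borel"
  shows "(\<integral>\<^sup>+\<xi>. f (reflect n v \<xi>) \<partial>sphere_ext) = (\<integral>\<^sup>+\<xi>. f \<xi> \<partial>sphere_ext)"
proof -
  obtain A where A: "orthogonal_n n A" "\<And>x. x \<in> Rn n \<Longrightarrow> apply_n n A x = reflect n v x"
    using reflect_orthogonal[OF v] by blast
  have R: "reflect n v \<in> measurable \<sigma> \<sigma>"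
  proof -
    have "reflect n v \<in> measurable \<sigma> (restrict_space borel (unit_sphere n))"
      by (intro measurable_restrict_space2 measurable_sphere reflect_measurable[OF v])
         (auto simp: space_sphere unit_sphere_def reflect_Rn[OF v] norm_reflect[OF v])
    then show ?thesis
      unfolding measurable_cong_sets[OF refl sets_sphere] .
  qed
  have "\<sigma> = distr \<sigma> \<sigma> (apply_n n A)"
    using \<sigma> A(1) by (simp add: rotation_invariant_prob_def)
  also have "\<dots> = distr \<sigma> \<sigma> (reflect n v)"
    by (intro distr_cong) (auto simp: space_sphere unit_sphere_def A(2))
  finally have inv: "distr \<sigma> \<sigma> (reflect n v) = \<sigma>" ..
  have "(\<integral>\<^sup>+\<xi>. f \<xi> \<partial>\<sigma>) = (\<integral>\<^sup>+\<xi>. f \<xi> \<partial>distr \<sigma> \<sigma> (reflect n v))"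
    by (simp add: inv)
  also have "\<dots> = (\<integral>\<^sup>+\<xi>. f (reflect n v \<xi>) \<partial>\<sigma>)"
    by (subst nn_integral_distr[OF R]) (auto intro: measurable_sphere f)
  finally show ?thesis
    using f measurable_compose[OF reflect_measurable[OF v] f] by (simp add: nn_integral_sphere_ext)
qed

text \<open>Whether the direction of \<open>x\<close> is within distance \<open>e\<close> of \<open>\<xi>\<close>, written without division by \<open>\<bar>x\<bar>\<close>:
  a cap of the sphere as a function of \<open>\<xi>\<close>, a cone as a function of \<open>x\<close>.\<close>

definition in_cone :: "real \<Rightarrow> (nat \<Rightarrow> real) \<Rightarrow> (nat \<Rightarrow> real) \<Rightarrow> ennreal"
  where "in_cone e x \<xi> = (if norm_n n (x - scale (norm_n n x) \<xi>) < e * norm_n n x then 1 else 0)"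

lemma in_cone_measurable [measurable (raw)]:
  assumes [measurable]: "f \<in> borel_measurable M" "g \<in> borel_measurable M"
  shows "(\<lambda>z. in_cone e (f z) (g z)) \<in> borel_measurable M"
  unfolding in_cone_def by measurable

lemma in_cone_reflect:
  assumes v: "v \<in> Rn n" "v \<noteq> 0"
  shows "in_cone e (reflect n v x) (reflect n v \<xi>) = in_cone e x \<xi>"
  by (simp only: in_cone_def norm_reflect[OF v] reflect_scale[OF v, symmetric] reflect_diff[OF v, symmetric])

lemma in_cone_scale:
  assumes "0 < r"
  shows "in_cone e (scale r x) \<xi> = in_cone e x \<xi>"
proof -
  have eq: "scale r x - scale (norm_n n (scale r x)) \<xi> = scale r (x - scale (norm_n n x) \<xi>)"
    using assms by (simp add: norm_n_scale fun_eq_iff algebra_simps)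
  show ?thesis
    unfolding in_cone_def eq unfolding norm_n_scale
    using assms by (simp add: mult.left_commute[of e] fun_diff_def)
qed

text \<open>Reflections carry any cap to any other, so all caps have the same measure. It is positive since
  countably many caps cover the sphere.\<close>

lemma cap_measure_const:
  assumes e: "0 < e"
  obtains c where "0 < c" "c < top"
    "\<And>x. x \<in> Rn n \<Longrightarrow> x \<noteq> 0 \<Longrightarrow> (\<integral>\<^sup>+\<xi>. in_cone e x \<xi> \<partial>sphere_ext) = c"
proof -
  interpret N: prob_space sphere_ext by (rule prob_space_sphere_ext)
  define c where "c x = (\<integral>\<^sup>+\<xi>. in_cone e x \<xi> \<partial>sphere_ext)" for x
  define p :: "nat \<Rightarrow> real" where "p = (\<lambda>i. if i = 0 then 1 else 0)"
  have p: "p \<in> unit_sphere n"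
    using n by (auto simp: unit_sphere_def Rn_iff p_def L2_set_def if_distrib[of "\<lambda>x. x\<^sup>2"] cong: if_cong)
  have const1: "c \<xi> = c \<eta>" if "\<xi> \<in> unit_sphere n" "\<eta> \<in> unit_sphere n" for \<xi> \<eta>
  proof (cases "\<xi> = \<eta>")
    case False
    let ?v = "\<xi> - \<eta>"
    have v: "?v \<in> Rn n" "?v \<noteq> 0" using False that unit_sphereD(1) Rn_closed(3) by auto
    have "c \<xi> = (\<integral>\<^sup>+\<zeta>. in_cone e (reflect n ?v \<xi>) (reflect n ?v \<zeta>) \<partial>sphere_ext)"
      by (simp add: c_def in_cone_reflect[OF v])
    also have "\<dots> = (\<integral>\<^sup>+\<zeta>. in_cone e (reflect n ?v \<xi>) \<zeta> \<partial>sphere_ext)"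
      by (intro nn_integral_sphere_reflect v) measurable
    finally show ?thesis
      by (simp add: reflect_swap[OF that False] c_def)
  qed simp
  have const: "c x = c p" if x: "x \<in> Rn n" "x \<noteq> 0" for x
  proof -
    have "c x = c (scale (1 / norm_n n x) x)"
      using norm_n_pos[OF x] by (simp only: c_def in_cone_scale zero_less_divide_1_iff)
    also have "\<dots> = c p" by (intro const1 unit_sphere_normalize x p)
    finally show ?thesis .
  qed
  have "c p \<le> (\<integral>\<^sup>+\<xi>. 1 \<partial>sphere_ext)"
    unfolding c_def by (intro nn_integral_mono) (simp add: in_cone_def)
  then have fin: "c p < top" by (auto simp: N.emeasure_space_1 le_less_trans)
  have pos: "0 < c p"
  proof (rule ccontr)
    assume "\<not> 0 < c p"
    then have 0: "c \<eta> = 0" if "\<eta> \<in> unit_sphere n" for \<eta>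
      using const1[OF that p] by simp
    define U where "U \<eta> = {\<xi>. norm_n n (\<eta> - \<xi>) < e}" for \<eta>
    have U_open: "open (U \<eta>)" for \<eta>
      unfolding U_def by (intro open_Collect_less continuous_intros) (simp, intro continuous_intros)
    have null: "U \<eta> \<in> null_sets sphere_ext" if "\<eta> \<in> unit_sphere n" for \<eta>
    proof -
      have "c \<eta> = (\<integral>\<^sup>+\<xi>. indicator (U \<eta>) \<xi> \<partial>sphere_ext)"
        unfolding c_def using unit_sphereD(2)[OF that]
        by (intro nn_integral_cong) (simp add: in_cone_def U_def indicator_def)
      then show ?thesis using 0[OF that] U_open by (intro null_setsI) simp_all
    qed
    obtain \<U> where \<U>: "\<U> \<subseteq> U ` unit_sphere n" "countable \<U>" "\<Union>\<U> = \<Union>(U ` unit_sphere n)"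
      using Lindelof[of "U ` unit_sphere n"] U_open by blast
    have "(\<Union>V\<in>\<U>. V) \<in> null_sets sphere_ext"
      using \<U>(1) by (intro null_sets_UN' \<U>(2)) (auto intro: null)
    then have "emeasure sphere_ext (\<Union>\<U>) = 0" by auto
    have cover: "unit_sphere n \<subseteq> \<Union>\<U>"
      unfolding \<U>(3) using e by (auto simp: U_def norm_n_zero)
    have "emeasure sphere_ext (unit_sphere n) \<le> emeasure sphere_ext (\<Union>\<U>)"
    proof (rule emeasure_mono[OF cover])
      have "open (\<Union>\<U>)" using \<U>(1) by (intro open_Union) (auto intro: U_open)
      then show "\<Union>\<U> \<in> sets sphere_ext" by simp
    qed
    then have "emeasure sphere_ext (unit_sphere n) = 0"
      by (simp add: \<open>emeasure sphere_ext (\<Union>\<U>) = 0\<close>)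
    moreover have "emeasure sphere_ext (unit_sphere n) = 1"
      using AE_sphere_ext by (intro N.emeasure_eq_1_AE) auto
    ultimately show False by simp
  qed
  show ?thesis
    using that[of "c p"] pos fin const unfolding c_def by blast
qed

lemma cone_gauss_const:
  assumes "\<xi> \<in> unit_sphere n" "\<eta> \<in> unit_sphere n"
  shows "(\<integral>\<^sup>+x. ennreal (norm_n n x * gauss n x) * in_cone e x \<xi> \<partial>lborel_n n) =
    (\<integral>\<^sup>+x. ennreal (norm_n n x * gauss n x) * in_cone e x \<eta> \<partial>lborel_n n)"
proof (cases "\<xi> = \<eta>")
  case False
  let ?v = "\<xi> - \<eta>"
  have v: "?v \<in> Rn n" "?v \<noteq> 0" using False assms unit_sphereD(1) Rn_closed(3) by auto
  have "(\<integral>\<^sup>+x. ennreal (norm_n n x * gauss n x) * in_cone e x \<xi> \<partial>lborel_n n) =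
      (\<integral>\<^sup>+x. ennreal (norm_n n (reflect n ?v x) * gauss n (reflect n ?v x)) *
        in_cone e (reflect n ?v x) (reflect n ?v \<xi>) \<partial>lborel_n n)"
    by (simp only: in_cone_reflect[OF v] norm_reflect[OF v] gauss_eq)
  also have "\<dots> = (\<integral>\<^sup>+x. ennreal (norm_n n x * gauss n x) * in_cone e x (reflect n ?v \<xi>) \<partial>lborel_n n)"
    by (intro nn_integral_lborel_n_reflect[OF v]) measurable
  finally show ?thesis by (simp add: reflect_swap[OF assms False])
qed simp

text \<open>Integrate \<open>F x\<close> over the pairs \<open>(x, \<xi>)\<close> whose directions differ by less than \<open>e\<close>, where \<open>F x \<le> \<bar>x\<bar> (F \<xi> + b e)\<close>. The
  spherical measure of the caps and the Gaussian weight of the cones do not depend on their axes, so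
  Fubini turns this into \<open>\<integral> F d\<gamma> \<le> (\<integral> F d\<sigma> + b e) \<integral> \<bar>x\<bar> d\<gamma>\<close>; then \<open>e\<close> tends to \<open>0\<close>.\<close>

lemma gauss_average_le:
  fixes F :: "(nat \<Rightarrow> real) \<Rightarrow> real"
  assumes nonneg: "\<And>x. x \<in> Rn n \<Longrightarrow> 0 \<le> F x"
    and hom: "\<And>x r. x \<in> Rn n \<Longrightarrow> 0 \<le> r \<Longrightarrow> F (scale r x) = r * F x"
    and lip: "\<And>x y. x \<in> Rn n \<Longrightarrow> y \<in> Rn n \<Longrightarrow> F x \<le> F y + b * norm_n n (x - y)"
    and b: "0 \<le> b"
  shows "(\<integral>\<^sup>+x. ennreal (F x * gauss n x) \<partial>lborel_n n) \<le> ennreal (sqrt (real n) * (LINT \<xi>|\<sigma>. F \<xi>))"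
proof -
  interpret \<sigma>: prob_space \<sigma> by (rule prob_space_sphere)
  interpret N: prob_space sphere_ext by (rule prob_space_sphere_ext)
  interpret NP: pair_sigma_finite "lborel_n n" sphere_ext ..
  define G where "G x = indicator (Rn n) x * F x" for x
  have [measurable]: "G \<in> borel_measurable borel"
    unfolding G_def[abs_def] by (intro lipschitz_borel_Rn[where b = b] lip)
  have G0: "0 \<le> G x" for x by (cases "x \<in> Rn n") (simp_all add: G_def nonneg)
  have GF: "G x = F x" if "x \<in> Rn n" for x using that by (simp add: G_def)
  have F0: "F 0 = 0" using Rn_closed(1)[of n] hom[of 0 0] by (simp add: zero_fun_def)
  define M where "M = (LINT \<xi>|\<sigma>. F \<xi>)"
  have GM: "(LINT \<xi>|\<sigma>. G \<xi>) = M"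
    unfolding M_def by (intro Bochner_Integration.integral_cong) (auto simp: space_sphere GF unit_sphereD)
  have "integrable \<sigma> G"
  proof (rule \<sigma>.integrable_const_bound[where B = b])
    have "G \<xi> \<le> b" if "\<xi> \<in> unit_sphere n" for \<xi>
      using lip[of \<xi> 0] unit_sphereD[OF that] by (simp add: GF F0 Rn_closed)
    then show "AE \<xi> in \<sigma>. norm (G \<xi>) \<le> b" by (intro AE_I2) (auto simp: space_sphere G0)
  qed (intro measurable_sphere, measurable)
  then have M: "(\<integral>\<^sup>+\<xi>. ennreal (G \<xi>) \<partial>sphere_ext) = ennreal M"
    by (subst nn_integral_sphere_ext) (auto simp: nn_integral_eq_integral G0 GM)
  have M0: "0 \<le> M" unfolding GM[symmetric] by (simp add: G0)
  define I where "I = (\<integral>\<^sup>+x. ennreal (G x * gauss n x) \<partial>lborel_n n)"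
  have eps: "I \<le> ennreal (sqrt (real n) * (M + b * e))" if e: "0 < e" for e
  proof -
    obtain c where c: "0 < c" "c < top"
      "\<And>x. x \<in> Rn n \<Longrightarrow> x \<noteq> 0 \<Longrightarrow> (\<integral>\<^sup>+\<xi>. in_cone e x \<xi> \<partial>sphere_ext) = c"
      using cap_measure_const[OF e] by metis
    have cap: "(\<integral>\<^sup>+\<xi>. ennreal (H x) * in_cone e x \<xi> \<partial>sphere_ext) = c * ennreal (H x)"
      if "x \<in> Rn n" "H 0 = 0" for x and H :: "(nat \<Rightarrow> real) \<Rightarrow> real"
      using that c(3)[of x] by (cases "x = 0") (auto simp: nn_integral_cmult mult.commute)
    define D where "D \<xi> = (\<integral>\<^sup>+x. ennreal (norm_n n x * gauss n x) * in_cone e x \<xi> \<partial>lborel_n n)" for \<xi>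
    have [measurable]: "D \<in> borel_measurable borel"
    proof -
      have "D \<in> borel_measurable sphere_ext" unfolding D_def by measurable
      then show ?thesis unfolding measurable_cong_sets[OF sets_sphere_ext refl] .
    qed
    obtain \<eta> where \<eta>: "\<eta> \<in> unit_sphere n"
      using space_sphere \<sigma>.not_empty by auto
    have D: "D \<xi> = D \<eta>" if "\<xi> \<in> unit_sphere n" for \<xi>
      unfolding D_def by (rule cone_gauss_const[OF that \<eta>])
    have "D \<eta> = (\<integral>\<^sup>+\<xi>. D \<eta> \<partial>sphere_ext)" by (simp add: N.emeasure_space_1)
    also have "\<dots> = (\<integral>\<^sup>+\<xi>. D \<xi> \<partial>sphere_ext)"
    proof (intro nn_integral_cong_AE)
      show "AE \<xi> in sphere_ext. D \<eta> = D \<xi>"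
        using AE_sphere_ext by eventually_elim (simp add: D)
    qed
    also have "\<dots> = (\<integral>\<^sup>+x. \<integral>\<^sup>+\<xi>. ennreal (norm_n n x * gauss n x) * in_cone e x \<xi> \<partial>sphere_ext \<partial>lborel_n n)"
      unfolding D_def by (intro NP.Fubini') (unfold split_beta', measurable)
    also have "\<dots> = (\<integral>\<^sup>+x. c * ennreal (norm_n n x * gauss n x) \<partial>lborel_n n)"
    proof (intro nn_integral_cong_AE)
      show "AE x in lborel_n n. (\<integral>\<^sup>+\<xi>. ennreal (norm_n n x * gauss n x) * in_cone e x \<xi> \<partial>sphere_ext) =
          c * ennreal (norm_n n x * gauss n x)"
        using AE_lborel_n by eventually_elim (rule cap[of _ "\<lambda>x. norm_n n x * gauss n x"], simp_all add: norm_n_zero)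
    qed
    also have "\<dots> = c * (\<integral>\<^sup>+x. ennreal (norm_n n x * gauss n x) \<partial>lborel_n n)"
      by (intro nn_integral_cmult) measurable
    also have "\<dots> \<le> c * ennreal (sqrt (real n))"
      by (intro mult_left_mono nn_integral_gauss_norm n) auto
    finally have D_le: "D \<eta> \<le> c * ennreal (sqrt (real n))" .
    have "c * I = (\<integral>\<^sup>+x. c * ennreal (G x * gauss n x) \<partial>lborel_n n)"
      unfolding I_def by (intro nn_integral_cmult[symmetric]) measurable
    also have "\<dots> = (\<integral>\<^sup>+x. \<integral>\<^sup>+\<xi>. ennreal (G x * gauss n x) * in_cone e x \<xi> \<partial>sphere_ext \<partial>lborel_n n)"
    proof (intro nn_integral_cong_AE)
      show "AE x in lborel_n n. c * ennreal (G x * gauss n x) =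
          (\<integral>\<^sup>+\<xi>. ennreal (G x * gauss n x) * in_cone e x \<xi> \<partial>sphere_ext)"
        using AE_lborel_n
        by eventually_elim (rule cap[of _ "\<lambda>x. G x * gauss n x", symmetric], simp_all add: G_def F0)
    qed
    also have "\<dots> \<le> (\<integral>\<^sup>+x. \<integral>\<^sup>+\<xi>. ennreal (G \<xi> + b * e) *
        (ennreal (norm_n n x * gauss n x) * in_cone e x \<xi>) \<partial>sphere_ext \<partial>lborel_n n)"
    proof (intro nn_integral_mono_AE)
      have ptw: "ennreal (G x * gauss n x) * in_cone e x \<xi>
          \<le> ennreal (G \<xi> + b * e) * (ennreal (norm_n n x * gauss n x) * in_cone e x \<xi>)"
        if x: "x \<in> Rn n" and \<xi>: "\<xi> \<in> unit_sphere n" for x \<xi>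
      proof (cases "norm_n n (x - scale (norm_n n x) \<xi>) < e * norm_n n x")
        case True
        have \<xi>': "\<xi> \<in> Rn n" "scale (norm_n n x) \<xi> \<in> Rn n"
          using unit_sphereD(1)[OF \<xi>] Rn_closed(5) by auto
        have "G x \<le> norm_n n x * G \<xi> + b * norm_n n (x - scale (norm_n n x) \<xi>)"
          using lip[OF x \<xi>'(2)] hom[OF \<xi>'(1), of "norm_n n x"] by (simp add: GF x \<xi>')
        also have "\<dots> \<le> norm_n n x * G \<xi> + b * (e * norm_n n x)"
          using True b by (intro add_left_mono mult_left_mono) auto
        finally have "G x * gauss n x \<le> (norm_n n x * G \<xi> + b * (e * norm_n n x)) * gauss n x"
          by (intro mult_right_mono) auto
        then have "ennreal (G x * gauss n x) \<le> ennreal ((G \<xi> + b * e) * (norm_n n x * gauss n x))"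
          by (intro ennreal_leI) (simp add: algebra_simps)
        then show ?thesis
          using True e b by (simp add: in_cone_def G0 ennreal_mult)
      qed (simp add: in_cone_def)
      show "AE x in lborel_n n. (\<integral>\<^sup>+\<xi>. ennreal (G x * gauss n x) * in_cone e x \<xi> \<partial>sphere_ext)
          \<le> (\<integral>\<^sup>+\<xi>. ennreal (G \<xi> + b * e) * (ennreal (norm_n n x * gauss n x) * in_cone e x \<xi>) \<partial>sphere_ext)"
        using AE_lborel_n
      proof eventually_elim
        case (elim x)
        have "AE \<xi> in sphere_ext. ennreal (G x * gauss n x) * in_cone e x \<xi>
            \<le> ennreal (G \<xi> + b * e) * (ennreal (norm_n n x * gauss n x) * in_cone e x \<xi>)"
          using AE_sphere_ext by eventually_elim (rule ptw[OF elim])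
        then show ?case by (rule nn_integral_mono_AE)
      qed
    qed
    also have "\<dots> = (\<integral>\<^sup>+\<xi>. \<integral>\<^sup>+x. ennreal (G \<xi> + b * e) *
        (ennreal (norm_n n x * gauss n x) * in_cone e x \<xi>) \<partial>lborel_n n \<partial>sphere_ext)"
      by (intro NP.Fubini'[symmetric]) (unfold split_beta', measurable)
    also have "\<dots> = (\<integral>\<^sup>+\<xi>. ennreal (G \<xi> + b * e) * D \<xi> \<partial>sphere_ext)"
      unfolding D_def by (intro nn_integral_cong nn_integral_cmult) measurable
    also have "\<dots> = (\<integral>\<^sup>+\<xi>. (ennreal (G \<xi>) + ennreal (b * e)) * D \<eta> \<partial>sphere_ext)"
    proof (intro nn_integral_cong_AE)
      show "AE \<xi> in sphere_ext. ennreal (G \<xi> + b * e) * D \<xi> = (ennreal (G \<xi>) + ennreal (b * e)) * D \<eta>"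
        using AE_sphere_ext by eventually_elim (use b e in \<open>simp add: D G0\<close>)
    qed
    also have "\<dots> = (ennreal M + ennreal (b * e)) * D \<eta>"
      by (subst nn_integral_multc) (auto simp: nn_integral_add M N.emeasure_space_1)
    also have "\<dots> \<le> (ennreal M + ennreal (b * e)) * (c * ennreal (sqrt (real n)))"
      by (intro mult_left_mono D_le) auto
    also have "\<dots> = c * ennreal (sqrt (real n) * (M + b * e))"
      using M0 b e by (simp add: ennreal_mult ennreal_plus ac_simps)
    finally show ?thesis
      using c(1,2) by (simp add: ennreal_mult_le_mult_iff)
  qed
  have "I \<le> ennreal (sqrt (real n) * M)"
  proof (rule ennreal_le_epsilon)
    fix d :: real assume d: "0 < d"
    define e where "e = d / (sqrt (real n) * (b + 1))"
    have n0: "0 < sqrt (real n)" using n by simp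
    have e: "0 < e" using d b n0 by (simp add: e_def)
    have "sqrt (real n) * (M + b * e) \<le> sqrt (real n) * (M + (b + 1) * e)"
      using e n0 by (intro mult_left_mono add_left_mono mult_right_mono) auto
    also have "\<dots> = sqrt (real n) * M + (b + 1) * e * sqrt (real n)"
      by (simp add: algebra_simps)
    also have "(b + 1) * e * sqrt (real n) = d"
      using n0 b by (simp add: e_def)
    finally have "ennreal (sqrt (real n) * (M + b * e)) \<le> ennreal (sqrt (real n) * M) + ennreal d"
      using M0 d by (simp add: ennreal_leI flip: ennreal_plus)
    then show "I \<le> ennreal (sqrt (real n) * M) + ennreal d"
      using eps[OF e] by (rule order_trans[rotated])
  qed
  moreover have "(\<integral>\<^sup>+x. ennreal (F x * gauss n x) \<partial>lborel_n n) = I"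
    unfolding I_def using AE_lborel_n
    by (intro nn_integral_cong_AE, eventually_elim) (simp add: GF)
  ultimately show ?thesis by (simp add: M_def)
qed

end

section \<open>Norms and polar bodies\<close>

definition polar_n :: "nat \<Rightarrow> (nat \<Rightarrow> real) set \<Rightarrow> (nat \<Rightarrow> real) set"
  where "polar_n n K = {\<theta> \<in> Rn n. \<forall>y\<in>K. inner_n n y \<theta> \<le> 1}"

lemma polar_n_Rn: "\<theta> \<in> polar_n n K \<Longrightarrow> \<theta> \<in> Rn n"
  by (simp add: polar_n_def)

lemma polar_n_zero: "0 \<in> polar_n n K"
  by (simp add: polar_n_def Rn_closed inner_n_simps)

lemma interior_contains_ball:
  assumes "convex_body n K"
  obtains p d where "p \<in> Rn n" "0 < d" "\<And>x. x \<in> Rn n \<Longrightarrow> norm_n n (x - p) < d \<Longrightarrow> x \<in> K"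
proof -
  obtain p U where pU: "openin (Euclidean_space n) U" "p \<in> U" "U \<subseteq> K"
    using assms by (auto simp: convex_body_def interior_of_def)
  then obtain T where T: "openin (powertop_real UNIV) T" "U = T \<inter> Rn n"
    by (auto simp: Euclidean_space_def openin_subtopology)
  have p: "p \<in> T" "p \<in> Rn n" using pU T by auto
  obtain X where X: "p \<in> Pi\<^sub>E UNIV X" "\<And>i. open (X i)" "Pi\<^sub>E UNIV X \<subseteq> T"
    using product_topology_open_contains_basis[OF T(1) p(1)] by auto
  have "\<exists>d>0. \<forall>y. \<bar>y - p i\<bar> < d \<longrightarrow> y \<in> X i" for i
    using X(1) X(2)[of i] by (auto simp: open_dist dist_real_def PiE_iff)
  then obtain d where d: "\<And>i. 0 < d i" "\<And>i y. \<bar>y - p i\<bar> < d i \<Longrightarrow> y \<in> X i"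
    by metis
  define r where "r = Min (insert 1 (d ` {..<n}))"
  have r: "0 < r" "\<And>i. i < n \<Longrightarrow> r \<le> d i" using d(1) by (auto simp: r_def)
  have "x \<in> K" if x: "x \<in> Rn n" "norm_n n (x - p) < r" for x
  proof -
    have "x i \<in> X i" for i
    proof (cases "i < n")
      case True
      then have "\<bar>x i - p i\<bar> < d i"
        using abs_coord_le_norm_n[OF True, of "x - p"] x(2) r(2)[OF True] by simp
      then show ?thesis by (rule d(2))
    next
      case False
      then have "x i = p i" using x p by (simp add: Rn_iff)
      then show ?thesis using d by simp
    qed
    then have "x \<in> T" using X(3) by auto
    then show ?thesis using T pU x by auto
  qed
  then show ?thesis using that[OF p(2) r(1)] by blast
qed

context
  fixes n :: nat and K :: "(nat \<Rightarrow> real) set"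
  assumes K: "convex_body n K" and sym: "centrally_symmetric K"
begin

lemma uminus_mem: "x \<in> K \<Longrightarrow> - x \<in> K"
  using sym by (auto simp: centrally_symmetric_def fun_Compl_def)

lemma inner_radius:
  obtains r where "0 < r" "\<And>x. x \<in> Rn n \<Longrightarrow> norm_n n x \<le> r \<Longrightarrow> x \<in> K"
proof -
  obtain p d where p: "p \<in> Rn n" "0 < d" "\<And>x. x \<in> Rn n \<Longrightarrow> norm_n n (x - p) < d \<Longrightarrow> x \<in> K"
    using interior_contains_ball[OF K] by metis
  have "x \<in> K" if x: "x \<in> Rn n" "norm_n n x \<le> d / 4" for x
  proof -
    have "p + scale 2 x \<in> K"
      using x p(2) by (intro p(3) Rn_closed p(1)) (auto simp: norm_n_scale)
    moreover have "- p \<in> K"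
      using p by (intro uminus_mem p(3)) (auto simp: norm_n_zero)
    ultimately show ?thesis
      using convex_body_convex[OF K, of "p + scale 2 x" "- p" "1 / 2" "1 / 2"]
      by (simp add: add_divide_distrib)
  qed
  then show ?thesis using that[of "d / 4"] p(2) by auto
qed

lemma zero_mem: "0 \<in> K"
  using inner_radius by (metis Rn_closed(1) norm_n_zero less_imp_le)

lemma scale_mem:
  assumes "x \<in> K" "0 \<le> r" "r \<le> 1"
  shows "scale r x \<in> K"
  using convex_body_convex[OF K assms(1) zero_mem, of r "1 - r"] assms by simp

lemma gauge_norm_alt: "gauge_norm K x = Inf {r. 0 < r \<and> scale (1 / r) x \<in> K}"
proof -
  have "x \<in> (\<lambda>y i. r * y i) ` K \<longleftrightarrow> scale (1 / r) x \<in> K" if "0 < r" for r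
  proof
    assume "scale (1 / r) x \<in> K"
    then show "x \<in> (\<lambda>y i. r * y i) ` K" using that by (intro image_eqI[of _ _ "scale (1 / r) x"]) auto
  qed (use that in auto)
  then have "{r. 0 < r \<and> x \<in> (\<lambda>y i. r * y i) ` K} = {r. 0 < r \<and> scale (1 / r) x \<in> K}"
    by blast
  then show ?thesis by (simp add: gauge_norm_def)
qed

lemma gauge_set_bdd: "bdd_below {r. 0 < r \<and> scale (1 / r) x \<in> K}"
  by (intro bdd_belowI[of _ 0]) auto

lemma gauge_set_nonempty:
  assumes "x \<in> Rn n"
  shows "{r. 0 < r \<and> scale (1 / r) x \<in> K} \<noteq> {}"
proof -
  obtain \<rho> where \<rho>: "0 < \<rho>" "\<And>x. x \<in> Rn n \<Longrightarrow> norm_n n x \<le> \<rho> \<Longrightarrow> x \<in> K"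
    using inner_radius by metis
  define r where "r = norm_n n x / \<rho> + 1"
  have r: "0 < r" using \<rho> by (auto simp: r_def intro: add_nonneg_pos)
  have "norm_n n x \<le> \<rho> * r" using \<rho> by (simp add: r_def algebra_simps)
  then have "scale (1 / r) x \<in> K"
    using r by (intro \<rho>(2) Rn_closed assms) (simp add: norm_n_scale[where r = "1 / r", simplified] pos_divide_le_eq)
  with r show ?thesis by auto
qed

lemma gauge_le: "0 < r \<Longrightarrow> scale (1 / r) x \<in> K \<Longrightarrow> gauge_norm K x \<le> r"
  unfolding gauge_norm_alt by (intro cInf_lower gauge_set_bdd) auto

lemma gauge_lessD:
  assumes "x \<in> Rn n" "gauge_norm K x < r"
  shows "scale (1 / r) x \<in> K" "0 < r"
proof -
  obtain q where q: "0 < q" "scale (1 / q) x \<in> K" "q < r"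
    using cInf_lessD[OF gauge_set_nonempty[OF assms(1)]] assms(2) by (auto simp: gauge_norm_alt)
  then show "0 < r" by simp
  have "scale (q / r) (scale (1 / q) x) \<in> K" using q scale_mem[OF q(2), of "q / r"] by simp
  then show "scale (1 / r) x \<in> K" using q by simp
qed

lemma gauge_nonneg: "x \<in> Rn n \<Longrightarrow> 0 \<le> gauge_norm K x"
  unfolding gauge_norm_alt by (intro cInf_greatest gauge_set_nonempty) auto

lemma gauge_zero: "gauge_norm K 0 = 0"
proof -
  have "gauge_norm K 0 \<le> e" if "0 < e" for e
    using that zero_mem by (intro gauge_le) (auto simp: zero_fun_def)
  then have "gauge_norm K 0 \<le> 0" by (rule dense_ge)
  then show ?thesis using gauge_nonneg[OF Rn_closed(1)] by simp
qed

lemma gauge_scale_le: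
  assumes x: "x \<in> Rn n" and r: "0 < r"
  shows "gauge_norm K (scale r x) \<le> r * gauge_norm K x"
proof -
  have "gauge_norm K (scale r x) / r \<le> gauge_norm K x"
  proof (rule dense_ge)
    fix q assume q: "gauge_norm K x < q"
    have "gauge_norm K (scale r x) \<le> r * q"
      using gauge_lessD[OF x q] r by (intro gauge_le) auto
    then show "gauge_norm K (scale r x) / r \<le> q" using r by (simp add: divide_le_eq mult.commute)
  qed
  then show ?thesis using r by (simp add: divide_le_eq mult.commute)
qed

lemma gauge_scale:
  assumes x: "x \<in> Rn n" and r: "0 \<le> r"
  shows "gauge_norm K (scale r x) = r * gauge_norm K x"
proof (cases "r = 0")
  case True
  then show ?thesis using gauge_zero by (simp add: zero_fun_def)
next
  case False
  with r have r: "0 < r" by simp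
  have "gauge_norm K (scale (1 / r) (scale r x)) \<le> 1 / r * gauge_norm K (scale r x)"
    using r by (intro gauge_scale_le Rn_closed x) simp
  then have "r * gauge_norm K x \<le> gauge_norm K (scale r x)"
    using r by (simp add: field_simps)
  with gauge_scale_le[OF x r] show ?thesis by simp
qed

lemma gauge_uminus: "gauge_norm K (- x) = gauge_norm K x"
proof -
  have "scale (1 / r) (- x) \<in> K \<longleftrightarrow> scale (1 / r) x \<in> K" for r
    using uminus_mem[of "scale (1 / r) x"] uminus_mem[of "scale (1 / r) (- x)"]
    by (auto simp: fun_Compl_def)
  then show ?thesis by (simp only: gauge_norm_alt)
qed

lemma gauge_triangle:
  assumes x: "x \<in> Rn n" and y: "y \<in> Rn n"
  shows "gauge_norm K (x + y) \<le> gauge_norm K x + gauge_norm K y"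
proof -
  have ab: "gauge_norm K (x + y) \<le> a + b" if "gauge_norm K x < a" "gauge_norm K y < b" for a b
  proof -
    note a = gauge_lessD[OF x that(1)] and b = gauge_lessD[OF y that(2)]
    have "(\<lambda>i. a / (a + b) * scale (1 / a) x i + b / (a + b) * scale (1 / b) y i) \<in> K"
      using a b by (intro convex_body_convex[OF K]) (auto simp flip: add_divide_distrib)
    also have "(\<lambda>i. a / (a + b) * scale (1 / a) x i + b / (a + b) * scale (1 / b) y i) =
        scale (1 / (a + b)) (x + y)"
      using a(2) b(2) by (simp add: fun_eq_iff add_divide_distrib)
    finally show ?thesis using a(2) b(2) by (intro gauge_le) auto
  qed
  have "gauge_norm K (x + y) - b \<le> gauge_norm K x" if b: "gauge_norm K y < b" for b
  proof (rule dense_ge)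
    fix a assume "gauge_norm K x < a"
    then show "gauge_norm K (x + y) - b \<le> a" using ab[OF _ b] by (simp add: diff_le_eq)
  qed
  then have "gauge_norm K (x + y) - gauge_norm K x \<le> b" if "gauge_norm K y < b" for b
    using that by (simp add: diff_le_eq add.commute)
  then have "gauge_norm K (x + y) - gauge_norm K x \<le> gauge_norm K y"
    by (rule dense_ge)
  then show ?thesis by simp
qed

lemma gauge_lipschitz:
  obtains b where "0 \<le> b"
    "\<And>x y. x \<in> Rn n \<Longrightarrow> y \<in> Rn n \<Longrightarrow> gauge_norm K x \<le> gauge_norm K y + b * norm_n n (x - y)"
proof -
  obtain \<rho> where \<rho>: "0 < \<rho>" "\<And>x. x \<in> Rn n \<Longrightarrow> norm_n n x \<le> \<rho> \<Longrightarrow> x \<in> K"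
    using inner_radius by metis
  have le: "gauge_norm K x \<le> 1 / \<rho> * norm_n n x" if x: "x \<in> Rn n" for x
  proof (rule dense_ge)
    fix r assume r: "1 / \<rho> * norm_n n x < r"
    have "0 \<le> 1 / \<rho> * norm_n n x" using \<rho> by simp
    with r have r0: "0 < r" by linarith
    have "norm_n n x \<le> \<rho> * r" using r \<rho> by (simp add: divide_less_eq mult.commute)
    then have "scale (1 / r) x \<in> K"
      using r0 by (intro \<rho>(2) Rn_closed x) (simp add: norm_n_scale[where r = "1 / r", simplified] pos_divide_le_eq)
    then show "gauge_norm K x \<le> r" by (rule gauge_le[OF r0])
  qed
  have "gauge_norm K x \<le> gauge_norm K y + 1 / \<rho> * norm_n n (x - y)"
    if "x \<in> Rn n" "y \<in> Rn n" for x y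
    using gauge_triangle[OF that(2) Rn_closed(3)[OF that]] le[OF Rn_closed(3)[OF that]] by simp
  then show ?thesis using that[of "1 / \<rho>"] \<rho>(1) by simp
qed

lemma gauge_borel [measurable]: "(\<lambda>x. indicator (Rn n) x * gauge_norm K x) \<in> borel_measurable borel"
  using gauge_lipschitz lipschitz_borel_Rn by metis

lemma inner_le_gauge:
  assumes \<theta>: "\<theta> \<in> polar_n n K" and x: "x \<in> Rn n"
  shows "inner_n n x \<theta> \<le> gauge_norm K x"
proof (rule dense_ge)
  fix r assume r: "gauge_norm K x < r"
  have "inner_n n (scale (1 / r) x) \<theta> \<le> 1"
    using \<theta> gauge_lessD(1)[OF x r] by (simp add: polar_n_def)
  then have "1 / r * inner_n n x \<theta> \<le> 1"
    by (simp only: inner_n_simps)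
  then show "inner_n n x \<theta> \<le> r"
    using gauge_lessD(2)[OF x r] by (simp add: field_simps)
qed

text \<open>The nearest point \<open>p\<close> of \<open>K\<close> to a point \<open>x\<close> outside \<open>K\<close> gives the separating functional
  \<open>x - p\<close>.\<close>

lemma separation:
  assumes x: "x \<in> Rn n" "x \<notin> K"
  obtains \<theta> where "\<theta> \<in> polar_n n K" "1 < inner_n n x \<theta>"
proof -
  have "continuous_on K (\<lambda>y. norm_n n (y - x))"
    by (intro continuous_intros) (simp, intro continuous_intros)
  then obtain p where p: "p \<in> K" "\<And>y. y \<in> K \<Longrightarrow> norm_n n (p - x) \<le> norm_n n (y - x)"
    using continuous_attains_inf[OF convex_body_compact[OF K]] zero_mem by blast
  have pR: "p \<in> Rn n" using p(1) convex_body_subset[OF K] by blast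
  define \<phi> where "\<phi> = x - p"
  have \<phi>: "\<phi> \<in> Rn n" "\<phi> \<noteq> 0" using x p(1) pR by (auto simp: \<phi>_def intro: Rn_closed)
  have \<phi>\<phi>: "0 < inner_n n \<phi> \<phi>" using norm_n_pos[OF \<phi>] by (simp add: norm_n_sq[symmetric])
  have obtuse: "inner_n n (y - p) \<phi> \<le> 0" if y: "y \<in> K" for y
  proof (rule ccontr)
    assume "\<not> ?thesis"
    then have a: "0 < inner_n n (y - p) \<phi>" by simp
    define u where "u = y - p"
    define a where "a = inner_n n u \<phi>"
    define q where "q = inner_n n u u"
    have a0: "0 < a" using a by (simp add: a_def u_def)
    have q0: "0 \<le> q" by (simp add: q_def norm_n_sq[symmetric])
    define t where "t = min 1 (a / (q + 1))"
    have t: "0 < t" "t \<le> 1" using a0 q0 by (auto simp: t_def)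
    have tq: "t * q < 2 * a"
    proof -
      have "t * (q + 1) \<le> a / (q + 1) * (q + 1)"
        using q0 by (intro mult_right_mono) (auto simp: t_def)
      also have "\<dots> = a" using q0 by simp
      finally have "t * q + t \<le> a" by (simp add: algebra_simps)
      with a0 t(1) show ?thesis by linarith
    qed
    have "p + scale t u \<in> K"
      using convex_body_convex[OF K p(1) y, of "1 - t" t] t
      by (simp add: u_def fun_eq_iff plus_fun_def algebra_simps)
    then have "norm_n n (p - x) \<le> norm_n n (p + scale t u - x)" by (rule p(2))
    then have "norm_n n \<phi> \<le> norm_n n (\<phi> - scale t u)"
      using norm_n_diff_commute[where x = x and y = p and n = n]
        norm_n_diff_commute[where x = "p + scale t u" and y = x and n = n]
      by (simp add: \<phi>_def diff_diff_eq)
    then have "(norm_n n \<phi>)\<^sup>2 \<le> (norm_n n (\<phi> - scale t u))\<^sup>2"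
      by (intro power_mono) auto
    then have "inner_n n \<phi> \<phi> \<le> inner_n n (\<phi> - scale t u) (\<phi> - scale t u)"
      by (simp only: norm_n_sq)
    then have "t * (2 * a) \<le> t * (t * q)"
      unfolding inner_n_simps by (simp add: a_def q_def inner_n_commute[of n \<phi> u] algebra_simps)
    with t tq show False by simp
  qed
  define m where "m = inner_n n p \<phi>"
  have m: "0 < m"
  proof -
    obtain \<rho> where \<rho>: "0 < \<rho>" "\<And>x. x \<in> Rn n \<Longrightarrow> norm_n n x \<le> \<rho> \<Longrightarrow> x \<in> K"
      using inner_radius by metis
    have N: "0 < norm_n n \<phi>" by (rule norm_n_pos[OF \<phi>])
    define c where "c = \<rho> / norm_n n \<phi>"
    have c: "0 < c" using \<rho> N by (simp add: c_def)
    have "scale c \<phi> \<in> K"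
      using N \<rho>(1) c by (intro \<rho>(2) Rn_closed \<phi>) (simp add: norm_n_scale, simp add: c_def)
    then have "inner_n n (scale c \<phi> - p) \<phi> \<le> 0" by (rule obtuse)
    then have "c * inner_n n \<phi> \<phi> \<le> m" by (simp only: inner_n_simps m_def)
    moreover have "0 < c * inner_n n \<phi> \<phi>" using c \<phi>\<phi> by simp
    ultimately show ?thesis by linarith
  qed
  define k where "k = 1 / m"
  have k: "0 < k" "k * m = 1" using m by (auto simp: k_def)
  have "scale k \<phi> \<in> polar_n n K"
    unfolding polar_n_def
  proof (intro CollectI conjI ballI Rn_closed \<phi>)
    fix y assume "y \<in> K"
    then have "inner_n n y \<phi> \<le> m" using obtuse[of y] by (simp add: inner_n_simps m_def)
    then have "k * inner_n n y \<phi> \<le> k * m" using k by (intro mult_left_mono) auto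
    then show "inner_n n y (scale k \<phi>) \<le> 1" by (simp only: inner_n_simps k)
  qed
  moreover have "1 < inner_n n x (scale k \<phi>)"
  proof -
    have "m < inner_n n x \<phi>" using \<phi>\<phi> by (simp add: \<phi>_def inner_n_simps m_def)
    then have "k * m < k * inner_n n x \<phi>" using k(1) by (rule mult_strict_left_mono)
    then show ?thesis by (simp only: inner_n_simps k)
  qed
  ultimately show ?thesis by (rule that)
qed

text \<open>The bipolar theorem: the norm is the support function of the polar body.\<close>

lemma gauge_le_polar:
  assumes x: "x \<in> Rn n" and B: "0 \<le> B"
    and le: "\<And>\<theta>. \<theta> \<in> polar_n n K \<Longrightarrow> inner_n n x \<theta> \<le> B"
  shows "gauge_norm K x \<le> B"
proof (rule dense_ge)
  fix r assume r: "B < r"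
  with B have r0: "0 < r" by simp
  have "scale (1 / r) x \<in> K"
  proof (rule ccontr)
    assume "scale (1 / r) x \<notin> K"
    then obtain \<theta> where \<theta>: "\<theta> \<in> polar_n n K" "1 < inner_n n (scale (1 / r) x) \<theta>"
      using separation Rn_closed(5)[OF x] by metis
    then have "1 < 1 / r * inner_n n x \<theta>" by (simp only: inner_n_simps)
    then have "r < inner_n n x \<theta>" using r0 by (simp add: field_simps)
    with le[OF \<theta>(1)] r show False by simp
  qed
  then show "gauge_norm K x \<le> r" by (rule gauge_le[OF r0])
qed

end

section \<open>Sudakov's inequality for the polar body\<close>

text \<open>The Gaussian weight of a translate of a symmetric set: the weights of the two opposite
  translates agree, and their average is controlled by \<open>cosh \<ge> 1\<close>.\<close>

lemma gauss_translate_ge: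
  assumes [measurable]: "A \<in> sets borel" and A: "\<And>x. - x \<in> A \<longleftrightarrow> x \<in> A" and z: "z \<in> Rn n"
  shows "ennreal (exp (- (norm_n n z)\<^sup>2 / 2)) * (\<integral>\<^sup>+x. indicator A x * ennreal (gauss n x) \<partial>lborel_n n)
    \<le> (\<integral>\<^sup>+x. indicator A (x - z) * ennreal (gauss n x) \<partial>lborel_n n)"
proof -
  let ?e = "exp (- (norm_n n z)\<^sup>2 / 2)"
  define J where "J = (\<integral>\<^sup>+x. indicator A (x - z) * ennreal (gauss n x) \<partial>lborel_n n)"
  have J1: "J = (\<integral>\<^sup>+x. indicator A x * ennreal (gauss n (x + z)) \<partial>lborel_n n)"
    unfolding J_def
    using nn_integral_lborel_n_translate[of "\<lambda>x. indicator A (x - z) * ennreal (gauss n x)", OF _ z]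
    by simp
  also have "\<dots> = (\<integral>\<^sup>+x. indicator A (- x) * ennreal (gauss n (- x + z)) \<partial>lborel_n n)"
    by (rule nn_integral_lborel_n_uminus[symmetric]) measurable
  also have "\<dots> = (\<integral>\<^sup>+x. indicator A x * ennreal (gauss n (x - z)) \<partial>lborel_n n)"
  proof (intro nn_integral_cong)
    fix x
    have "norm_n n (- x + z) = norm_n n (x - z)"
      using norm_n_diff_commute[where x = z and y = x and n = n] by simp
    then show "indicator A (- x) * ennreal (gauss n (- x + z)) =
        indicator A x * ennreal (gauss n (x - z))"
      using A[of x] by (simp add: gauss_eq indicator_def)
  qed
  finally have J2: "J = (\<integral>\<^sup>+x. indicator A x * ennreal (gauss n (x - z)) \<partial>lborel_n n)" .
  have ptw: "2 * (?e * gauss n x) \<le> gauss n (x + z) + gauss n (x - z)" for x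
  proof -
    define a where "a = inner_n n x z"
    have sq: "(norm_n n (x + z))\<^sup>2 = (norm_n n x)\<^sup>2 + (norm_n n z)\<^sup>2 + 2 * a"
      "(norm_n n (x - z))\<^sup>2 = (norm_n n x)\<^sup>2 + (norm_n n z)\<^sup>2 - 2 * a"
      unfolding norm_n_sq inner_n_simps by (simp_all add: a_def inner_n_commute[of n z x])
    have "exp (- (norm_n n (x + z))\<^sup>2 / 2) = ?e * exp (- (norm_n n x)\<^sup>2 / 2) * exp (- a)"
      "exp (- (norm_n n (x - z))\<^sup>2 / 2) = ?e * exp (- (norm_n n x)\<^sup>2 / 2) * exp a"
      unfolding sq by (simp_all add: field_simps flip: exp_add)
    moreover have "2 \<le> exp (- a) + exp a"
      using exp_ge_add_one_self[of a] exp_ge_add_one_self[of "- a"] by linarith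
    then have "?e * exp (- (norm_n n x)\<^sup>2 / 2) * 2
        \<le> ?e * exp (- (norm_n n x)\<^sup>2 / 2) * (exp (- a) + exp a)"
      by (intro mult_left_mono) auto
    ultimately have "2 * (?e * exp (- (norm_n n x)\<^sup>2 / 2))
        \<le> exp (- (norm_n n (x + z))\<^sup>2 / 2) + exp (- (norm_n n (x - z))\<^sup>2 / 2)"
      by (simp add: algebra_simps)
    then have "(1 / sqrt (2 * pi)) ^ n * (2 * (?e * exp (- (norm_n n x)\<^sup>2 / 2)))
        \<le> (1 / sqrt (2 * pi)) ^ n *
          (exp (- (norm_n n (x + z))\<^sup>2 / 2) + exp (- (norm_n n (x - z))\<^sup>2 / 2))"
      by (intro mult_left_mono) auto
    then show ?thesis unfolding gauss_eq by (simp only: distrib_left ac_simps)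
  qed
  have "2 * (ennreal ?e * (\<integral>\<^sup>+x. indicator A x * ennreal (gauss n x) \<partial>lborel_n n)) =
      (\<integral>\<^sup>+x. 2 * (ennreal ?e * (indicator A x * ennreal (gauss n x))) \<partial>lborel_n n)"
    by (simp add: nn_integral_cmult)
  also have "\<dots> \<le> (\<integral>\<^sup>+x. indicator A x * ennreal (gauss n (x + z)) +
      indicator A x * ennreal (gauss n (x - z)) \<partial>lborel_n n)"
  proof (intro nn_integral_mono)
    fix x
    have "ennreal (2 * (?e * gauss n x)) \<le> ennreal (gauss n (x + z) + gauss n (x - z))"
      by (intro ennreal_leI ptw)
    then have "2 * (ennreal ?e * ennreal (gauss n x)) \<le> ennreal (gauss n (x + z)) + ennreal (gauss n (x - z))"
      by (simp add: ennreal_mult)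
    then show "2 * (ennreal ?e * (indicator A x * ennreal (gauss n x)))
        \<le> indicator A x * ennreal (gauss n (x + z)) + indicator A x * ennreal (gauss n (x - z))"
      by (cases "x \<in> A") auto
  qed
  also have "\<dots> = J + J"
    by (subst nn_integral_add) (auto simp: J1[symmetric] J2[symmetric])
  finally have "2 * (ennreal ?e * (\<integral>\<^sup>+x. indicator A x * ennreal (gauss n x) \<partial>lborel_n n)) \<le> 2 * J"
    by (simp add: mult_2)
  then show ?thesis
    unfolding J_def by (simp add: ennreal_mult_le_mult_iff)
qed

lemma maximal_separated_subset:
  fixes A :: "'a set" and N :: real
  assumes bound: "\<And>F. finite F \<Longrightarrow> F \<subseteq> A \<Longrightarrow> (\<And>x y. x \<in> F \<Longrightarrow> y \<in> F \<Longrightarrow> x \<noteq> y \<Longrightarrow> far x y) \<Longrightarrow>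
      real (card F) \<le> N"
    and sym: "\<And>x y. far x y \<Longrightarrow> far y x"
  obtains F where "finite F" "F \<subseteq> A" "real (card F) \<le> N"
    "\<And>a. a \<in> A \<Longrightarrow> \<exists>f\<in>F. f = a \<or> \<not> far a f"
proof -
  define P where "P F \<longleftrightarrow> finite F \<and> F \<subseteq> A \<and> (\<forall>x\<in>F. \<forall>y\<in>F. x \<noteq> y \<longrightarrow> far x y)" for F
  have P: "P F \<Longrightarrow> real (card F) \<le> N" for F
    using bound[of F] by (auto simp: P_def)
  have "P F \<Longrightarrow> card F < Suc (nat \<lfloor>N\<rfloor>)" for F
    using P[of F] by linarith
  moreover have "P {}" by (simp add: P_def)
  ultimately obtain F where F: "P F" "\<And>G. P G \<Longrightarrow> card G \<le> card F"
    using ex_has_greatest_nat[of P "{}" card "Suc (nat \<lfloor>N\<rfloor>)"] by blast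
  have "\<exists>f\<in>F. f = a \<or> \<not> far a f" if a: "a \<in> A" for a
  proof (rule ccontr)
    assume "\<not> ?thesis"
    then have "a \<notin> F" "P (insert a F)"
      using F(1) a sym by (auto simp: P_def)
    then show False using F(2)[of "insert a F"] F(1) by (simp add: P_def)
  qed
  then show ?thesis using that[of F] F(1) P[OF F(1)] by (simp add: P_def)
qed

context
  fixes n :: nat and K :: "(nat \<Rightarrow> real) set" and W :: real
  assumes K: "convex_body n K" and sym: "centrally_symmetric K" and W: "0 < W"
    and mean: "(\<integral>\<^sup>+x. ennreal (gauge_norm K x * gauss n x) \<partial>lborel_n n) \<le> ennreal W"
begin

text \<open>Translates of \<open>{x. \<parallel>x\<parallel> \<le> 2W}\<close>, a set carrying at least half of the Gaussian mass, by points at mutual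
  distance above \<open>4W\<close> are disjoint.\<close>

lemma gauss_packing:
  assumes F: "finite F" "F \<subseteq> Rn n"
    and sep: "\<And>x y. x \<in> F \<Longrightarrow> y \<in> F \<Longrightarrow> x \<noteq> y \<Longrightarrow> 4 * W < gauge_norm K (x - y)"
  shows "(\<Sum>z\<in>F. exp (- (norm_n n z)\<^sup>2 / 2)) \<le> 2"
proof -
  define G where "G x = indicator (Rn n) x * gauge_norm K x" for x
  have [measurable]: "G \<in> borel_measurable borel"
    unfolding G_def[abs_def] by (rule gauge_borel[OF K sym])
  have G0: "0 \<le> G x" for x
    by (cases "x \<in> Rn n") (auto simp: G_def gauge_nonneg[OF K sym])
  define A where "A = {x \<in> Rn n. G x \<le> 2 * W}"
  have A_eq: "A = Rn n \<inter> {x. G x \<le> 2 * W}" by (auto simp: A_def)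
  have [measurable]: "A \<in> sets borel" unfolding A_eq by measurable
  define \<gamma> where "\<gamma> B = (\<integral>\<^sup>+x. indicator B x * ennreal (gauss n x) \<partial>lborel_n n)" for B
  have "ennreal (2 * W) * \<gamma> (- A) = (\<integral>\<^sup>+x. ennreal (2 * W) * (indicator (- A) x * ennreal (gauss n x)) \<partial>lborel_n n)"
    unfolding \<gamma>_def by (intro nn_integral_cmult[symmetric]) measurable
  also have "\<dots> \<le> (\<integral>\<^sup>+x. ennreal (gauge_norm K x * gauss n x) \<partial>lborel_n n)"
  proof (intro nn_integral_mono_AE)
    show "AE x in lborel_n n. ennreal (2 * W) * (indicator (- A) x * ennreal (gauss n x))
        \<le> ennreal (gauge_norm K x * gauss n x)"
      using AE_lborel_n
    proof eventually_elim
      case (elim x)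
      then show ?case
        using W by (cases "x \<in> A")
          (auto simp: A_def G_def ennreal_mult[symmetric] intro!: ennreal_leI mult_right_mono)
    qed
  qed
  also note mean
  also have "ennreal W = ennreal (2 * W) * ennreal (1 / 2)"
    using W by (subst ennreal_mult[symmetric]) auto
  finally have "ennreal (2 * W) * \<gamma> (- A) \<le> ennreal (2 * W) * ennreal (1 / 2)" .
  then have compl: "\<gamma> (- A) \<le> ennreal (1 / 2)"
    using W by (subst (asm) ennreal_mult_le_mult_iff) auto
  have "1 = \<gamma> A + \<gamma> (- A)"
  proof -
    have "\<gamma> A + \<gamma> (- A) = (\<integral>\<^sup>+x. indicator A x * ennreal (gauss n x) + indicator (- A) x * ennreal (gauss n x) \<partial>lborel_n n)"
      unfolding \<gamma>_def by (intro nn_integral_add[symmetric]) measurable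
    also have "\<dots> = (\<integral>\<^sup>+x. ennreal (gauss n x) \<partial>lborel_n n)"
      by (intro nn_integral_cong) (auto simp: indicator_def)
    finally show ?thesis by (simp add: nn_integral_gauss)
  qed
  also have "\<dots> \<le> \<gamma> A + ennreal (1 / 2)" by (intro add_left_mono compl)
  finally have le: "1 \<le> \<gamma> A + ennreal (1 / 2)" .
  have half: "ennreal (1 / 2) \<le> \<gamma> A"
  proof (cases "\<gamma> A")
    case (real g)
    have "\<gamma> A + ennreal (1 / 2) = ennreal (g + 1 / 2)"
      unfolding real(2) using real(1) by (subst ennreal_plus) auto
    then have "ennreal 1 \<le> ennreal (g + 1 / 2)" using le by (simp only: ennreal_1)
    then have "1 \<le> g + 1 / 2" using real(1) by (subst (asm) ennreal_le_iff) auto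
    then show ?thesis unfolding real(2) by (intro ennreal_leI) simp
  qed simp
  have symA: "- x \<in> A \<longleftrightarrow> x \<in> A" for x
    using Rn_closed(4)[of x n] Rn_closed(4)[of "- x" n]
    by (auto simp: A_def G_def gauge_uminus[OF K sym] indicator_def)
  have disj: "(\<Sum>z\<in>F. indicator A (x - z)) \<le> (1 :: ennreal)" for x
  proof (cases "\<exists>z\<in>F. x - z \<in> A")
    case True
    then obtain z where z: "z \<in> F" "x - z \<in> A" by blast
    have "indicator A (x - y) = (0 :: ennreal)" if y: "y \<in> F - {z}" for y
    proof -
      have "x - y \<notin> A"
      proof
        assume yA: "x - y \<in> A"
        have R: "x - z \<in> Rn n" "- (x - y) \<in> Rn n"
          using z yA Rn_closed(4)[of "x - y" n] by (simp_all add: A_def)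
        have "gauge_norm K (y - z) = gauge_norm K ((x - z) + - (x - y))" by simp
        also have "\<dots> \<le> gauge_norm K (x - z) + gauge_norm K (- (x - y))"
          by (intro gauge_triangle[OF K sym] R)
        also have "\<dots> \<le> 2 * W + 2 * W"
          unfolding gauge_uminus[OF K sym] using z yA by (intro add_mono) (auto simp: A_def G_def)
        finally show False using sep[of y z] y z by auto
      qed
      then show ?thesis by simp
    qed
    then have "(\<Sum>y\<in>F. indicator A (x - y)) = (indicator A (x - z) :: ennreal)"
      using F z by (subst sum.remove[of F z]) (auto intro!: sum.neutral)
    then show ?thesis by (simp add: indicator_def)
  qed simp
  have "(\<Sum>z\<in>F. ennreal (exp (- (norm_n n z)\<^sup>2 / 2)) * ennreal (1 / 2))
      \<le> (\<Sum>z\<in>F. \<integral>\<^sup>+x. indicator A (x - z) * ennreal (gauss n x) \<partial>lborel_n n)"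
  proof (intro sum_mono)
    fix z assume "z \<in> F"
    then have "z \<in> Rn n" using F by auto
    then show "ennreal (exp (- (norm_n n z)\<^sup>2 / 2)) * ennreal (1 / 2)
        \<le> (\<integral>\<^sup>+x. indicator A (x - z) * ennreal (gauss n x) \<partial>lborel_n n)"
      using half symA
      by (intro order_trans[OF _ gauss_translate_ge[of A z n]]) (auto simp: \<gamma>_def intro!: mult_left_mono)
  qed
  also have "\<dots> = (\<integral>\<^sup>+x. (\<Sum>z\<in>F. indicator A (x - z) * ennreal (gauss n x)) \<partial>lborel_n n)"
    by (intro nn_integral_sum[symmetric]) measurable
  also have "\<dots> \<le> (\<integral>\<^sup>+x. 1 * ennreal (gauss n x) \<partial>lborel_n n)"
    unfolding sum_distrib_right[symmetric] by (intro nn_integral_mono mult_right_mono disj) auto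
  also have "\<dots> = 1" by (simp add: nn_integral_gauss)
  also have "(\<Sum>z\<in>F. ennreal (exp (- (norm_n n z)\<^sup>2 / 2)) * ennreal (1 / 2)) =
      (\<Sum>z\<in>F. ennreal (exp (- (norm_n n z)\<^sup>2 / 2) * (1 / 2)))"
    by (intro sum.cong refl ennreal_mult[symmetric]) auto
  also have "\<dots> = ennreal ((\<Sum>z\<in>F. exp (- (norm_n n z)\<^sup>2 / 2)) * (1 / 2))"
    unfolding sum_distrib_right by (intro sum_ennreal) auto
  finally have "(\<Sum>z\<in>F. exp (- (norm_n n z)\<^sup>2 / 2)) * (1 / 2) \<le> 1"
    by (simp only: ennreal_le_1)
  then show ?thesis by simp
qed

text \<open>Otherwise, for a unit vector \<open>u\<close>, the three points \<open>0\<close>, \<open>u\<close>, \<open>- u\<close> would violate the packing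
  bound, because \<open>1 + 2 exp (- 1 / 2) > 2\<close>.\<close>

lemma gauge_le_norm:
  assumes x: "x \<in> Rn n"
  shows "gauge_norm K x \<le> 4 * W * norm_n n x"
proof (cases "x = 0")
  case True
  then show ?thesis by (simp add: gauge_zero[OF K sym] norm_n_zero)
next
  case False
  define r where "r = norm_n n x"
  have r: "0 < r" unfolding r_def by (rule norm_n_pos[OF x False])
  define u where "u = scale (1 / r) x"
  have uR: "u \<in> Rn n" unfolding u_def by (intro Rn_closed x)
  have x_eq: "x = scale r u" using r by (simp add: u_def)
  have nu: "norm_n n u = 1"
    using unit_sphereD(2)[OF unit_sphere_normalize[OF x False]] by (simp only: u_def r_def)
  then have u0: "u \<noteq> 0" using norm_n_zero[of n] by auto
  have "gauge_norm K u \<le> 4 * W"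
  proof (rule ccontr)
    assume "\<not> ?thesis"
    then have big: "4 * W < gauge_norm K u" by simp
    have "2 * u = scale 2 u" by (simp add: fun_eq_iff)
    then have g2: "gauge_norm K (2 * u) = 2 * gauge_norm K u"
      using gauge_scale[OF K sym uR, of 2] by simp
    have "u \<noteq> - u" "u + u \<noteq> 0"
      using u0 by (auto simp: fun_eq_iff)
    then have card: "u \<noteq> - u" "u \<noteq> 0" "- u \<noteq> 0" using u0 by auto
    have "(\<Sum>z\<in>{0, u, - u}. exp (- (norm_n n z)\<^sup>2 / 2)) \<le> 2"
    proof (rule gauss_packing)
      show "{0, u, - u} \<subseteq> Rn n" using uR Rn_closed by auto
      fix y z assume "y \<in> {0, u, - u}" "z \<in> {0, u, - u}" "y \<noteq> z"
      then show "4 * W < gauge_norm K (y - z)"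
        using big W by (auto simp: gauge_uminus[OF K sym] g2)
    qed simp
    then have "2 * exp (- (1 / 2)) \<le> (1 :: real)"
      using card by (simp add: nu norm_n_zero norm_n_minus)
    then have "2 \<le> exp (1 / 2 :: real)"
      by (simp add: exp_minus field_simps)
    then have "2 * 2 \<le> exp (1 / 2) * exp (1 / 2 :: real)" by (intro mult_mono) auto
    then show False using exp_le by (simp flip: exp_add)
  qed
  then have "r * gauge_norm K u \<le> r * (4 * W)" using r by (intro mult_left_mono) auto
  moreover have "gauge_norm K x = r * gauge_norm K u"
    using gauge_scale[OF K sym uR, of r] r x_eq by simp
  ultimately show ?thesis by (simp add: r_def mult.commute)
qed

lemma polar_norm_le:
  assumes "\<theta> \<in> polar_n n K"
  shows "norm_n n \<theta> \<le> 4 * W"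
proof -
  have R: "\<theta> \<in> Rn n" by (rule polar_n_Rn[OF assms])
  have "norm_n n \<theta> * norm_n n \<theta> = inner_n n \<theta> \<theta>" by (simp add: norm_n_sq[symmetric] power2_eq_square)
  also have "\<dots> \<le> 4 * W * norm_n n \<theta>"
    using inner_le_gauge[OF K sym assms R] gauge_le_norm[OF R] by simp
  finally have "norm_n n \<theta> * norm_n n \<theta> \<le> 4 * W * norm_n n \<theta>" .
  then show ?thesis
    using W L2_set_nonneg[of \<theta> "{..<n}"] by (cases "norm_n n \<theta> = 0") (auto dest: mult_right_le_imp_le)
qed

text \<open>A maximal \<open>d\<close>-separated subset of the unit ball is a \<open>d\<close>-net. Scaled by \<open>4W / d\<close> it becomes
  \<open>4W\<close>-separated, and the packing bound limits its size.\<close>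

lemma ball_net:
  assumes d: "0 < d"
  shows "\<exists>Y. finite Y \<and> Y \<subseteq> Rn n \<and> real (card Y) \<le> 2 * exp (8 * W\<^sup>2 / d\<^sup>2) \<and>
    (\<forall>x\<in>Rn n. norm_n n x \<le> 1 \<longrightarrow> (\<exists>y\<in>Y. gauge_norm K (x - y) \<le> d))"
proof -
  let ?B = "{x \<in> Rn n. norm_n n x \<le> 1}"
  let ?far = "\<lambda>x y. d < gauge_norm K (x - y)"
  define r where "r = 4 * W / d"
  have r: "0 < r" "r * d = 4 * W" using W d by (auto simp: r_def)
  have bound: "real (card F) \<le> 2 * exp (8 * W\<^sup>2 / d\<^sup>2)"
    if F: "finite F" "F \<subseteq> ?B" and far: "\<And>x y. x \<in> F \<Longrightarrow> y \<in> F \<Longrightarrow> x \<noteq> y \<Longrightarrow> ?far x y" for F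
  proof -
    have inj: "inj_on (scale r) F"
      using r by (auto simp: inj_on_def fun_eq_iff)
    have "(\<Sum>z\<in>scale r ` F. exp (- (norm_n n z)\<^sup>2 / 2)) \<le> 2"
    proof (rule gauss_packing)
      show "scale r ` F \<subseteq> Rn n" using F Rn_closed(5) by auto
      fix x' y' assume "x' \<in> scale r ` F" "y' \<in> scale r ` F" "x' \<noteq> y'"
      then obtain x y where xy: "x \<in> F" "y \<in> F" "x \<noteq> y" "x' = scale r x" "y' = scale r y" by auto
      have "x \<in> Rn n" "y \<in> Rn n" using xy F(2) by auto
      then have "x - y \<in> Rn n" by (rule Rn_closed(3))
      then have "gauge_norm K (scale r (x - y)) = r * gauge_norm K (x - y)"
        using r gauge_scale[OF K sym \<open>x - y \<in> Rn n\<close>, of r] by simp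
      moreover have "scale r (x - y) = x' - y'"
        using xy by (simp add: fun_eq_iff algebra_simps)
      ultimately have "gauge_norm K (x' - y') = r * gauge_norm K (x - y)" by simp
      moreover have "r * d < r * gauge_norm K (x - y)"
        using far[OF xy(1-3)] r(1) by simp
      ultimately show "4 * W < gauge_norm K (x' - y')" using r(2) by simp
    qed (use F in simp)
    also have "(\<Sum>z\<in>scale r ` F. exp (- (norm_n n z)\<^sup>2 / 2)) = (\<Sum>z\<in>F. exp (- (norm_n n (scale r z))\<^sup>2 / 2))"
      by (subst sum.reindex[OF inj]) simp
    finally have le2: "(\<Sum>z\<in>F. exp (- (norm_n n (scale r z))\<^sup>2 / 2)) \<le> 2" .
    have "real (card F) * exp (- (r\<^sup>2 / 2)) = (\<Sum>z\<in>F. exp (- (r\<^sup>2 / 2)))" by simp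
    also have "\<dots> \<le> (\<Sum>z\<in>F. exp (- (norm_n n (scale r z))\<^sup>2 / 2))"
    proof (intro sum_mono)
      fix z assume "z \<in> F"
      then have "norm_n n z \<le> 1" using F by auto
      then have "r * norm_n n z \<le> r * 1" using r by (intro mult_left_mono) auto
      then have "(norm_n n (scale r z))\<^sup>2 \<le> r\<^sup>2"
        using r by (intro power_mono) (auto simp: norm_n_scale)
      then show "exp (- (r\<^sup>2 / 2)) \<le> exp (- (norm_n n (scale r z))\<^sup>2 / 2)" by simp
    qed
    also note le2
    finally have "real (card F) * exp (- (r\<^sup>2 / 2)) * exp (r\<^sup>2 / 2) \<le> 2 * exp (r\<^sup>2 / 2)"
      by (intro mult_right_mono) auto
    moreover have "r\<^sup>2 / 2 = 8 * W\<^sup>2 / d\<^sup>2" by (simp add: r_def power_divide power_mult_distrib)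
    ultimately show ?thesis by (simp add: mult.assoc flip: exp_add)
  qed
  obtain Y where Y: "finite Y" "Y \<subseteq> ?B" "real (card Y) \<le> 2 * exp (8 * W\<^sup>2 / d\<^sup>2)"
    "\<And>x. x \<in> ?B \<Longrightarrow> \<exists>y\<in>Y. y = x \<or> \<not> ?far x y"
  proof (rule maximal_separated_subset[of ?B ?far "2 * exp (8 * W\<^sup>2 / d\<^sup>2)"])
    fix F :: "(nat \<Rightarrow> real) set"
    assume "finite F" "F \<subseteq> ?B" "\<And>x y. x \<in> F \<Longrightarrow> y \<in> F \<Longrightarrow> x \<noteq> y \<Longrightarrow> ?far x y"
    then show "real (card F) \<le> 2 * exp (8 * W\<^sup>2 / d\<^sup>2)" by (rule bound)
  next
    fix x y assume "?far x y"
    then show "?far y x" using gauge_uminus[OF K sym, of "x - y"] by simp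
  next
    fix F assume F: "finite F" "F \<subseteq> ?B" "real (card F) \<le> 2 * exp (8 * W\<^sup>2 / d\<^sup>2)"
      "\<And>x. x \<in> ?B \<Longrightarrow> \<exists>y\<in>F. y = x \<or> \<not> ?far x y"
    show thesis by (rule that[OF F])
  qed
  show ?thesis
  proof (intro exI[of _ Y] conjI ballI impI Y(1,3))
    show "Y \<subseteq> Rn n" using Y(2) by auto
    fix x assume x: "x \<in> Rn n" "norm_n n x \<le> 1"
    then obtain y where y: "y \<in> Y" "y = x \<or> \<not> ?far x y" using Y(4)[of x] by auto
    then have "gauge_norm K (x - y) \<le> d" using d by (auto simp: gauge_zero[OF K sym])
    then show "\<exists>y\<in>Y. gauge_norm K (x - y) \<le> d" using y(1) by blast
  qed
qed

text \<open>Duality of the covering numbers: two points of the polar body whose difference \<open>u\<close> has a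
  small norm satisfy \<open>\<bar>u\<bar>\<^sup>2 \<le> 2 \<parallel>u\<parallel>\<close>. Hence a covering of the polar body by balls of radius \<open>2\<epsilon>\<close>,
  refined by coverings of these balls in the norm, becomes a covering with radius \<open>\<epsilon>\<close>.\<close>

lemma polar_net_refine:
  assumes T: "finite T" "T \<subseteq> polar_n n K"
    and cover: "\<And>\<theta>. \<theta> \<in> polar_n n K \<Longrightarrow> \<exists>\<tau>\<in>T. norm_n n (\<theta> - \<tau>) \<le> 2 * e"
    and e: "0 < e"
  shows "\<exists>T'. finite T' \<and> T' \<subseteq> polar_n n K \<and>
    real (card T') \<le> real (card T) * (2 * exp (512 * W\<^sup>2 / e\<^sup>2)) \<and>
    (\<forall>\<theta>\<in>polar_n n K. \<exists>\<tau>\<in>T'. norm_n n (\<theta> - \<tau>) \<le> e)"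
proof -
  have e8: "0 < e / 8" using e by simp
  obtain Y where Y: "finite Y" "Y \<subseteq> Rn n" "real (card Y) \<le> 2 * exp (8 * W\<^sup>2 / (e / 8)\<^sup>2)"
    "\<forall>x\<in>Rn n. norm_n n x \<le> 1 \<longrightarrow> (\<exists>y\<in>Y. gauge_norm K (x - y) \<le> e / 8)"
    using ball_net[OF e8] by blast
  define cell where "cell p = {\<theta> \<in> polar_n n K. gauge_norm K (\<theta> - (fst p + scale (2 * e) (snd p))) \<le> e\<^sup>2 / 4}"
    for p :: "(nat \<Rightarrow> real) \<times> (nat \<Rightarrow> real)"
  define T' where "T' = (\<lambda>p. SOME \<theta>. \<theta> \<in> cell p) ` {p \<in> T \<times> Y. cell p \<noteq> {}}"
  have some: "(SOME \<theta>. \<theta> \<in> cell p) \<in> cell p" if "cell p \<noteq> {}" for p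
    using that by (auto simp: some_in_eq)
  have fin: "finite (T \<times> Y)" using T Y by auto
  have "card T' \<le> card {p \<in> T \<times> Y. cell p \<noteq> {}}"
    unfolding T'_def using fin by (intro card_image_le) auto
  also have "\<dots> \<le> card (T \<times> Y)" by (intro card_mono fin) auto
  also have "\<dots> = card T * card Y" by (rule card_cartesian_product)
  finally have "real (card T') \<le> real (card T) * real (card Y)"
    by (metis of_nat_le_iff of_nat_mult)
  also have "\<dots> \<le> real (card T) * (2 * exp (512 * W\<^sup>2 / e\<^sup>2))"
    using Y(3) by (intro mult_left_mono) (simp_all add: power_divide)
  finally have card: "real (card T') \<le> real (card T) * (2 * exp (512 * W\<^sup>2 / e\<^sup>2))" .
  have close: "norm_n n (\<theta> - \<theta>') \<le> e" if p: "p \<in> T \<times> Y" "\<theta> \<in> cell p" "\<theta>' \<in> cell p" for p \<theta> \<theta>'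
  proof -
    let ?m = "fst p + scale (2 * e) (snd p)"
    have P: "\<theta> \<in> polar_n n K" "\<theta>' \<in> polar_n n K" using p by (auto simp: cell_def)
    have mR: "?m \<in> Rn n"
      using p T(2) Y(2) polar_n_Rn by (intro Rn_closed) auto
    have R: "\<theta> \<in> Rn n" "\<theta>' \<in> Rn n" using P polar_n_Rn by auto
    have R': "\<theta> - ?m \<in> Rn n" "- (\<theta>' - ?m) \<in> Rn n" "\<theta> - \<theta>' \<in> Rn n"
      using Rn_closed(3)[OF R(1) mR] Rn_closed(4)[OF Rn_closed(3)[OF R(2) mR]] Rn_closed(3)[OF R] by auto
    have "gauge_norm K (\<theta> - \<theta>') = gauge_norm K ((\<theta> - ?m) + - (\<theta>' - ?m))" by simp
    also have "\<dots> \<le> gauge_norm K (\<theta> - ?m) + gauge_norm K (- (\<theta>' - ?m))"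
      by (intro gauge_triangle[OF K sym] R')
    also have "\<dots> \<le> e\<^sup>2 / 4 + e\<^sup>2 / 4"
      unfolding gauge_uminus[OF K sym] using p by (intro add_mono) (auto simp: cell_def)
    finally have g: "gauge_norm K (\<theta> - \<theta>') \<le> e\<^sup>2 / 2" by simp
    have "inner_n n (\<theta> - \<theta>') \<theta> \<le> e\<^sup>2 / 2"
      using inner_le_gauge[OF K sym P(1) R'(3)] g by simp
    moreover have "inner_n n (- (\<theta> - \<theta>')) \<theta>' \<le> e\<^sup>2 / 2"
      using inner_le_gauge[OF K sym P(2) Rn_closed(4)[OF R'(3)]] g
      unfolding gauge_uminus[OF K sym] by simp
    moreover have "(norm_n n (\<theta> - \<theta>'))\<^sup>2 = inner_n n (\<theta> - \<theta>') \<theta> + inner_n n (- (\<theta> - \<theta>')) \<theta>'"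
      unfolding norm_n_sq inner_n_simps by simp
    ultimately have "(norm_n n (\<theta> - \<theta>'))\<^sup>2 \<le> e\<^sup>2" by simp
    then show ?thesis by (rule power2_le_imp_le) (use e in simp)
  qed
  show ?thesis
  proof (intro exI[of _ T'] conjI ballI card)
    show "finite T'" unfolding T'_def using fin by auto
    show "T' \<subseteq> polar_n n K" unfolding T'_def using some by (auto simp: cell_def)
    fix \<theta> assume \<theta>: "\<theta> \<in> polar_n n K"
    obtain \<tau> where \<tau>: "\<tau> \<in> T" "norm_n n (\<theta> - \<tau>) \<le> 2 * e" using cover[OF \<theta>] by blast
    define u where "u = scale (1 / (2 * e)) (\<theta> - \<tau>)"
    have uR: "u \<in> Rn n"
      unfolding u_def using T(2) \<tau>(1) by (intro Rn_closed polar_n_Rn[where K = K] \<theta>) auto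
    have u_eq: "scale (2 * e) u = \<theta> - \<tau>" using e by (simp add: u_def fun_eq_iff)
    have "2 * e * norm_n n u \<le> 2 * e * 1"
      using \<tau>(2) e norm_n_scale[where n = n and r = "2 * e" and x = u] unfolding u_eq by simp
    then have "norm_n n u \<le> 1" using e by simp
    then obtain y where y: "y \<in> Y" "gauge_norm K (u - y) \<le> e / 8" using Y(4) uR by blast
    have "\<theta> - (\<tau> + scale (2 * e) y) = scale (2 * e) (u - y)"
      using u_eq by (simp add: fun_eq_iff algebra_simps)
    then have "gauge_norm K (\<theta> - (\<tau> + scale (2 * e) y)) = 2 * e * gauge_norm K (u - y)"
      using gauge_scale[OF K sym, of "u - y" "2 * e"] Rn_closed(3)[OF uR, of y] y(1) Y(2) e by auto
    also have "\<dots> \<le> 2 * e * (e / 8)" using y e by (intro mult_left_mono) auto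
    finally have "\<theta> \<in> cell (\<tau>, y)"
      using \<theta> by (simp add: cell_def power2_eq_square)
    moreover from this have "(SOME \<theta>. \<theta> \<in> cell (\<tau>, y)) \<in> T'" "(SOME \<theta>. \<theta> \<in> cell (\<tau>, y)) \<in> cell (\<tau>, y)"
      using \<tau>(1) y(1) some[of "(\<tau>, y)"] by (auto simp: T'_def)
    ultimately show "\<exists>\<tau>\<in>T'. norm_n n (\<theta> - \<tau>) \<le> e"
      using close[of "(\<tau>, y)"] \<tau>(1) y(1) by blast
  qed
qed

text \<open>Sudakov's inequality: the logarithm of the covering number at radius \<open>4W / 2 ^ k\<close> is of order
  \<open>4 ^ k\<close>. Each refinement adds \<open>ln 2 + 32 * 4 ^ Suc k\<close>, and the sum of these terms is dominated by the
  last one. The net at level \<open>0\<close> is a single point, from which all chains start.\<close>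

lemma polar_nets:
  obtains T where "T 0 = {0}"
    "\<And>k. finite (T k)" "\<And>k. T k \<subseteq> polar_n n K" "\<And>k. real (card (T k)) \<le> exp (50 * 4 ^ k)"
    "\<And>k \<theta>. \<theta> \<in> polar_n n K \<Longrightarrow> \<exists>\<tau>\<in>T k. norm_n n (\<theta> - \<tau>) \<le> 4 * W / 2 ^ k"
proof -
  define P where "P k T \<longleftrightarrow> finite T \<and> T \<subseteq> polar_n n K \<and> real (card T) \<le> exp (50 * 4 ^ k) \<and>
    (\<forall>\<theta>\<in>polar_n n K. \<exists>\<tau>\<in>T. norm_n n (\<theta> - \<tau>) \<le> 4 * W / 2 ^ k)" for k :: nat and T
  have P0: "P 0 {0}" unfolding P_def using polar_norm_le polar_n_zero by simp
  have "\<exists>T. P k T" for k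
  proof (induction k)
    case (Suc k)
    then obtain T where T: "P k T" by blast
    define e where "e = 4 * W / 2 ^ Suc k"
    have e: "0 < e" "2 * e = 4 * W / 2 ^ k" using W by (auto simp: e_def)
    have "((2::real) ^ Suc k)\<^sup>2 = 4 ^ Suc k"
      by (simp add: power2_eq_square flip: power_mult_distrib)
    then have "e\<^sup>2 = 16 * W\<^sup>2 / 4 ^ Suc k"
      by (simp only: e_def power_divide power_mult_distrib) simp
    then have "512 * W\<^sup>2 / e\<^sup>2 = 32 * 4 ^ Suc k"
      using W by simp
    moreover have "\<exists>T'. finite T' \<and> T' \<subseteq> polar_n n K \<and>
        real (card T') \<le> real (card T) * (2 * exp (512 * W\<^sup>2 / e\<^sup>2)) \<and>
        (\<forall>\<theta>\<in>polar_n n K. \<exists>\<tau>\<in>T'. norm_n n (\<theta> - \<tau>) \<le> e)"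
    proof (rule polar_net_refine)
      show "finite T" "T \<subseteq> polar_n n K" using T by (simp_all add: P_def)
      show "\<exists>\<tau>\<in>T. norm_n n (\<theta> - \<tau>) \<le> 2 * e" if "\<theta> \<in> polar_n n K" for \<theta>
        using T that unfolding P_def e(2) by blast
    qed (rule e(1))
    then obtain T' where "finite T'" "T' \<subseteq> polar_n n K"
      "real (card T') \<le> real (card T) * (2 * exp (512 * W\<^sup>2 / e\<^sup>2))"
      "\<forall>\<theta>\<in>polar_n n K. \<exists>\<tau>\<in>T'. norm_n n (\<theta> - \<tau>) \<le> e"
      by blast
    moreover have "real (card T) * (2 * exp (32 * 4 ^ Suc k)) \<le> exp (50 * 4 ^ Suc k)"
    proof -
      have "(2 :: real) \<le> exp 1" using exp_ge_add_one_self[of 1] by simp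
      then have "real (card T) * (2 * exp (32 * 4 ^ Suc k)) \<le> exp (50 * 4 ^ k) * (exp 1 * exp (32 * 4 ^ Suc k))"
        using T by (intro mult_mono) (auto simp: P_def)
      also have "\<dots> = exp (50 * 4 ^ k + (1 + 32 * 4 ^ Suc k))" by (simp only: exp_add)
      also have "\<dots> \<le> exp (50 * 4 ^ Suc k)"
        using one_le_power[of "4::real" k] unfolding exp_le_cancel_iff power_Suc by linarith
      finally show ?thesis .
    qed
    ultimately have "P (Suc k) T'" unfolding P_def e_def by auto
    then show ?case by blast
  qed (use P0 in blast)
  then obtain T where T: "\<And>k. P k (T k)" by metis
  show ?thesis
    by (rule that[of "\<lambda>k. if k = 0 then {0} else T k"]) (use T P0 in \<open>auto simp: P_def\<close>)
qed

end

section \<open>Chaining\<close>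

lemma exp_sum_ge_square: "u\<^sup>2 \<le> 2 * (exp u + exp (- u))" for u :: real
proof -
  have "1 + \<bar>u\<bar> + \<bar>u\<bar>\<^sup>2 / 2 \<le> exp \<bar>u\<bar>"
    by (rule exp_lower_Taylor_quadratic) simp
  moreover have "exp \<bar>u\<bar> \<le> exp u + exp (- u)" by (cases "0 \<le> u") auto
  ultimately show ?thesis by simp
qed

context
  fixes n :: nat and K :: "(nat \<Rightarrow> real) set" and W :: real
  assumes n: "1 \<le> n" and K: "convex_body n K" and sym: "centrally_symmetric K" and W: "0 < W"
    and mean: "(\<integral>\<^sup>+x. ennreal (gauge_norm K x * gauss n x) \<partial>lborel_n n) \<le> ennreal W"
begin

text \<open>Every functional of the polar body is reached from \<open>0\<close> by links between successive nets, up to a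
  remainder of length \<open>4W / 2 ^ m\<close>. The maximum of a finite family of variables with bounded
  exponential moment is at most the logarithm of their number, up to a constant, since
  \<open>u \<le> E + exp (- E) exp u\<close>. The remainder is controlled by the Euclidean norm alone.\<close>

lemma chaining:
  fixes P :: "'a measure" and S :: "'a \<Rightarrow> nat \<Rightarrow> real"
  assumes P: "prob_space P" and S [measurable]: "S \<in> borel_measurable P"
    and l: "0 < l" and Q: "0 \<le> Q"
    and mgf: "\<And>\<theta>. \<theta> \<in> Rn n \<Longrightarrow> norm_n n \<theta> \<le> 1 \<Longrightarrow>
      (\<integral>\<^sup>+x. ennreal (exp (l * inner_n n (S x) \<theta>)) \<partial>P) \<le> ennreal Q"
  shows "(\<integral>\<^sup>+x. ennreal (indicator (Rn n) (S x) * gauge_norm K (S x)) \<partial>P)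
    \<le> ennreal ((\<Sum>k<m. 12 * W / 2 ^ Suc k / l * (100 * 4 ^ Suc k + Q)) +
        4 * W / 2 ^ m * (1 / (2 * l) * (sqrt (real n) + 4 * sqrt (real n) * Q)))"
proof -
  interpret P: prob_space P by (rule P)
  obtain T where T0: "T 0 = {0}"
    and T: "\<And>k. finite (T k)" "\<And>k. T k \<subseteq> polar_n n K" "\<And>k. real (card (T k)) \<le> exp (50 * 4 ^ k)"
    "\<And>k \<theta>. \<theta> \<in> polar_n n K \<Longrightarrow> \<exists>\<tau>\<in>T k. norm_n n (\<theta> - \<tau>) \<le> 4 * W / 2 ^ k"
    using polar_nets[OF K sym W mean] by blast
  \<comment> \<open>\<open>d k\<close> bounds the length of the links from level \<open>k\<close> to level \<open>Suc k\<close>, and \<open>E k\<close> the logarithm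
    of their number.\<close>
  define d where "d k = 12 * W / 2 ^ Suc k" for k :: nat
  define E :: "nat \<Rightarrow> real" where "E k = 100 * 4 ^ Suc k" for k
  have d0: "0 < d k" for k using W by (simp add: d_def)
  define L where "L k = {p \<in> T (Suc k) \<times> T k. norm_n n (fst p - snd p) \<le> d k}" for k
  define link where "link k p = scale (1 / d k) (fst p - snd p)" for k and p :: "(nat \<Rightarrow> real) \<times> (nat \<Rightarrow> real)"
  have finL: "finite (L k)" for k unfolding L_def using T(1) by auto
  have linkR: "link k p \<in> Rn n" "norm_n n (link k p) \<le> 1" if "p \<in> L k" for k p
  proof -
    have "fst p \<in> Rn n" "snd p \<in> Rn n"
      using that T(2) polar_n_Rn by (fastforce simp: L_def)+
    then show "link k p \<in> Rn n" unfolding link_def by (intro Rn_closed)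
    show "norm_n n (link k p) \<le> 1"
      using that d0[of k] unfolding link_def norm_n_scale by (simp add: L_def fun_diff_def)
  qed
  have cardL: "real (card (L k)) \<le> exp (E k)" for k
  proof -
    have "card (L k) \<le> card (T (Suc k) \<times> T k)"
      unfolding L_def using T(1) by (intro card_mono) auto
    then have "real (card (L k)) \<le> real (card (T (Suc k))) * real (card (T k))"
      by (metis card_cartesian_product of_nat_le_iff of_nat_mult)
    also have "\<dots> \<le> exp (50 * 4 ^ Suc k) * exp (50 * 4 ^ k)"
      by (intro mult_mono T(3)) auto
    also have "\<dots> \<le> exp (E k)"
      by (simp add: E_def flip: exp_add)
    finally show ?thesis .
  qed
  define \<Phi> where "\<Phi> \<theta> y = exp (l * inner_n n y \<theta>)" for \<theta> y
  define e :: "nat \<Rightarrow> nat \<Rightarrow> real" where "e i = (\<lambda>j. if j = i then 1 else 0)" for i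
  have eR: "e i \<in> Rn n" "norm_n n (e i) \<le> 1" "- e i \<in> Rn n" "norm_n n (- e i) \<le> 1" if "i < n" for i
    using that by (auto simp: e_def Rn_iff L2_set_def if_distrib[of "\<lambda>x. x\<^sup>2"] cong: if_cong)
  define Bd where "Bd \<psi> = (\<Sum>k<m. d k / l * (E k + exp (- E k) * (\<Sum>p\<in>L k. \<psi> (link k p)))) +
      4 * W / 2 ^ m * (1 / (2 * l) * (sqrt (real n) + 2 / sqrt (real n) * (\<Sum>i<n. \<psi> (e i) + \<psi> (- e i))))"
    for \<psi> :: "(nat \<Rightarrow> real) \<Rightarrow> real"
  have Bd0: "0 \<le> Bd (\<lambda>\<theta>. \<Phi> \<theta> y)" for y
    unfolding Bd_def \<Phi>_def E_def using W l d0 n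
    by (intro add_nonneg_nonneg sum_nonneg mult_nonneg_nonneg divide_nonneg_pos) (auto intro: less_imp_le)
  have ptw: "gauge_norm K y \<le> Bd (\<lambda>\<theta>. \<Phi> \<theta> y)" if y: "y \<in> Rn n" for y
  proof (rule gauge_le_polar[OF K sym y Bd0])
    fix \<theta> assume \<theta>: "\<theta> \<in> polar_n n K"
    obtain \<pi> where \<pi>: "\<And>k. \<pi> k \<in> T k" "\<And>k. norm_n n (\<theta> - \<pi> k) \<le> 4 * W / 2 ^ k"
      using T(4)[OF \<theta>] by metis
    have \<pi>0: "\<pi> 0 = 0" using \<pi>(1)[of 0] T0 by simp
    have step: "inner_n n y (\<pi> (Suc k)) - inner_n n y (\<pi> k)
        \<le> d k / l * (E k + exp (- E k) * (\<Sum>p\<in>L k. \<Phi> (link k p) y))" for k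
    proof -
      define p where "p = (\<pi> (Suc k), \<pi> k)"
      have "norm_n n (\<pi> (Suc k) - \<pi> k) \<le> norm_n n (\<theta> - \<pi> (Suc k)) + norm_n n (\<theta> - \<pi> k)"
        using norm_n_triangle_diff[where x = "\<pi> (Suc k)" and y = \<theta> and z = "\<pi> k" and n = n]
          norm_n_diff_commute[where x = "\<pi> (Suc k)" and y = \<theta> and n = n] by simp
      also have "\<dots> \<le> 4 * W / 2 ^ Suc k + 4 * W / 2 ^ k" by (intro add_mono \<pi>(2))
      also have "\<dots> = d k" by (simp add: d_def)
      finally have p: "p \<in> L k" using \<pi>(1) by (simp add: L_def p_def)
      let ?x = "l * inner_n n y (link k p)"
      have "inner_n n y (link k p) = 1 / d k * (inner_n n y (\<pi> (Suc k)) - inner_n n y (\<pi> k))"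
        unfolding link_def inner_n_simps by (simp add: p_def)
      then have eq: "inner_n n y (\<pi> (Suc k)) - inner_n n y (\<pi> k) = d k / l * ?x"
        using d0[of k] l by simp
      have "?x - E k \<le> exp (?x - E k)"
        using exp_ge_add_one_self[of "?x - E k"] by linarith
      also have "\<dots> = exp (- E k) * \<Phi> (link k p) y"
        by (simp add: \<Phi>_def flip: exp_add)
      also have "\<dots> \<le> exp (- E k) * (\<Sum>p\<in>L k. \<Phi> (link k p) y)"
        using p by (intro mult_left_mono member_le_sum finL) (auto simp: \<Phi>_def)
      finally have "?x \<le> E k + exp (- E k) * (\<Sum>p\<in>L k. \<Phi> (link k p) y)" by simp
      then show ?thesis
        unfolding eq using d0[of k] l by (intro mult_left_mono) auto
    qed
    have "inner_n n y (\<pi> m) = (\<Sum>k<m. inner_n n y (\<pi> (Suc k)) - inner_n n y (\<pi> k))"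
      using sum_lessThan_telescope[of "\<lambda>k. inner_n n y (\<pi> k)" m] by (simp add: \<pi>0 inner_n_simps)
    also have "\<dots> \<le> (\<Sum>k<m. d k / l * (E k + exp (- E k) * (\<Sum>p\<in>L k. \<Phi> (link k p) y)))"
      by (intro sum_mono step)
    finally have net: "inner_n n y (\<pi> m) \<le> \<dots>" .
    have ynorm: "norm_n n y \<le> 1 / (2 * l) * (sqrt (real n) + 2 / sqrt (real n) * (\<Sum>i<n. \<Phi> (e i) y + \<Phi> (- e i) y))"
    proof -
      have inner_e: "inner_n n y (e i) = y i" "inner_n n y (- e i) = - y i" if "i < n" for i
        using that by (simp_all only: inner_n_simps) (simp_all add: inner_n_def e_def if_distrib cong: if_cong)
      have "(l * norm_n n y)\<^sup>2 = (\<Sum>i<n. (l * y i)\<^sup>2)"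
        by (simp add: power_mult_distrib norm_n_sq_sum sum_distrib_left)
      also have "\<dots> \<le> (\<Sum>i<n. 2 * (\<Phi> (e i) y + \<Phi> (- e i) y))"
      proof (intro sum_mono)
        fix i assume "i \<in> {..<n}"
        then show "(l * y i)\<^sup>2 \<le> 2 * (\<Phi> (e i) y + \<Phi> (- e i) y)"
          using exp_sum_ge_square[of "l * y i"] by (simp add: \<Phi>_def inner_e)
      qed
      finally have sq: "(l * norm_n n y)\<^sup>2 \<le> 2 * (\<Sum>i<n. \<Phi> (e i) y + \<Phi> (- e i) y)"
        by (simp add: sum_distrib_left)
      have sn: "0 < sqrt (real n)" using n by simp
      have "0 \<le> (l * norm_n n y - sqrt (real n))\<^sup>2 / sqrt (real n)" using sn by simp
      then have "2 * (l * norm_n n y) \<le> sqrt (real n) + (l * norm_n n y)\<^sup>2 / sqrt (real n)"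
        using sn by (simp add: power2_eq_square field_simps)
      also have "(l * norm_n n y)\<^sup>2 / sqrt (real n)
          \<le> 2 * (\<Sum>i<n. \<Phi> (e i) y + \<Phi> (- e i) y) / sqrt (real n)"
        using sq by (intro divide_right_mono) auto
      finally have "norm_n n y * (2 * l) \<le> sqrt (real n) + 2 / sqrt (real n) * (\<Sum>i<n. \<Phi> (e i) y + \<Phi> (- e i) y)"
        by (simp add: ac_simps)
      then have "norm_n n y \<le> (sqrt (real n) + 2 / sqrt (real n) * (\<Sum>i<n. \<Phi> (e i) y + \<Phi> (- e i) y)) / (2 * l)"
        using l by (subst pos_le_divide_eq) auto
      then show ?thesis by simp
    qed
    have "inner_n n y (\<theta> - \<pi> m) \<le> norm_n n (\<theta> - \<pi> m) * norm_n n y"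
      using inner_n_le[of n y "\<theta> - \<pi> m"] by (simp add: mult.commute)
    also have "\<dots> \<le> 4 * W / 2 ^ m * (1 / (2 * l) *
        (sqrt (real n) + 2 / sqrt (real n) * (\<Sum>i<n. \<Phi> (e i) y + \<Phi> (- e i) y)))"
      using W by (intro mult_mono \<pi>(2) ynorm) auto
    finally show "inner_n n y \<theta> \<le> Bd (\<lambda>\<theta>. \<Phi> \<theta> y)"
      using net unfolding Bd_def by (simp add: inner_n_simps)
  qed
  have int: "integrable P (\<lambda>x. \<Phi> \<theta> (S x))" and int_le: "(LINT x|P. \<Phi> \<theta> (S x)) \<le> Q"
    if "\<theta> \<in> Rn n" "norm_n n \<theta> \<le> 1" for \<theta>
  proof -
    show i: "integrable P (\<lambda>x. \<Phi> \<theta> (S x))"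
      unfolding \<Phi>_def using mgf[OF that]
      by (intro integrableI_nonneg) (auto simp: le_less_trans[OF _ ennreal_less_top])
    have "ennreal (LINT x|P. \<Phi> \<theta> (S x)) \<le> ennreal Q"
      using mgf[OF that] i by (subst nn_integral_eq_integral[symmetric]) (auto simp: \<Phi>_def)
    then show "(LINT x|P. \<Phi> \<theta> (S x)) \<le> Q"
      using Q by (subst (asm) ennreal_le_iff) auto
  qed
  define J where "J \<theta> = (LINT x|P. \<Phi> \<theta> (S x))" for \<theta>
  have hb: "has_bochner_integral P (\<lambda>x. \<Phi> \<theta> (S x)) (J \<theta>)" if "\<theta> \<in> Rn n" "norm_n n \<theta> \<le> 1" for \<theta>
    using int[OF that] by (simp add: has_bochner_integral_iff J_def)
  have hc: "has_bochner_integral P (\<lambda>x. c) c" for c :: real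
    by (simp add: has_bochner_integral_iff P.prob_space)
  have hbBd: "has_bochner_integral P (\<lambda>x. Bd (\<lambda>\<theta>. \<Phi> \<theta> (S x))) (Bd J)"
    unfolding Bd_def
    by (intro has_bochner_integral_add has_bochner_integral_sum has_bochner_integral_mult_right
        hb hc linkR eR) auto
  have "(\<integral>\<^sup>+x. ennreal (indicator (Rn n) (S x) * gauge_norm K (S x)) \<partial>P)
      \<le> (\<integral>\<^sup>+x. ennreal (Bd (\<lambda>\<theta>. \<Phi> \<theta> (S x))) \<partial>P)"
    using ptw Bd0 by (intro nn_integral_mono ennreal_leI) (auto simp: indicator_def)
  also have "\<dots> = ennreal (Bd J)"
    using hbBd Bd0 by (subst nn_integral_eq_integral) (auto simp: has_bochner_integral_iff)
  also have "Bd J \<le> (\<Sum>k<m. d k / l * (E k + Q)) +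
      4 * W / 2 ^ m * (1 / (2 * l) * (sqrt (real n) + 4 * sqrt (real n) * Q))"
    unfolding Bd_def
  proof (intro add_mono sum_mono mult_left_mono)
    fix k
    have "(\<Sum>p\<in>L k. J (link k p)) \<le> (\<Sum>p\<in>L k. Q)"
      unfolding J_def by (intro sum_mono int_le linkR)
    also have "\<dots> = real (card (L k)) * Q" by simp
    also have "\<dots> \<le> exp (E k) * Q" by (intro mult_right_mono cardL Q)
    finally have "exp (- E k) * (\<Sum>p\<in>L k. J (link k p)) \<le> exp (- E k) * (exp (E k) * Q)"
      by (intro mult_left_mono) auto
    also have "\<dots> = Q" by (simp add: exp_minus)
    finally show "exp (- E k) * (\<Sum>p\<in>L k. J (link k p)) \<le> Q" .
  next
    have "(\<Sum>i<n. J (e i) + J (- e i)) \<le> (\<Sum>i<n. Q + Q)"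
      unfolding J_def by (intro sum_mono add_mono int_le eR) auto
    then have "2 / sqrt (real n) * (\<Sum>i<n. J (e i) + J (- e i)) \<le> 2 / sqrt (real n) * (real n * (2 * Q))"
      by (intro mult_left_mono) auto
    also have "\<dots> = 4 * (real n / sqrt (real n)) * Q" by simp
    also have "\<dots> = 4 * sqrt (real n) * Q" by (simp only: real_div_sqrt of_nat_0_le_iff)
    finally show "2 / sqrt (real n) * (\<Sum>i<n. J (e i) + J (- e i)) \<le> 4 * sqrt (real n) * Q" .
  qed (use W l d0 in \<open>auto intro: less_imp_le\<close>)
  finally show ?thesis
    unfolding d_def E_def by (simp add: ennreal_leI)
qed

text \<open>The links up to level \<open>m\<close> cost \<open>\<Sum> 2 ^ k W / l\<close>, of order \<open>2 ^ m W / l\<close>, and the remainder costs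
  \<open>sqrt n / 2 ^ m * W / l\<close>. Both are of order \<open>root 4 n * W / l\<close> for \<open>2 ^ m\<close> close to \<open>root 4 n\<close>.\<close>

lemma gauge_mean_le:
  fixes P :: "'a measure" and S :: "'a \<Rightarrow> nat \<Rightarrow> real"
  assumes P: "prob_space P" and S [measurable]: "S \<in> borel_measurable P"
    and l: "0 < l" and Q: "0 \<le> Q"
    and mgf: "\<And>\<theta>. \<theta> \<in> Rn n \<Longrightarrow> norm_n n \<theta> \<le> 1 \<Longrightarrow>
      (\<integral>\<^sup>+x. ennreal (exp (l * inner_n n (S x) \<theta>)) \<partial>P) \<le> ennreal Q"
  shows "(\<integral>\<^sup>+x. ennreal (indicator (Rn n) (S x) * gauge_norm K (S x)) \<partial>P)
    \<le> ennreal ((2404 + 40 * Q) * (root 4 (real n) * W / l))"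
proof -
  define r where "r = root 4 (real n)"
  have r1: "1 \<le> r" using n by (simp add: r_def)
  have rr: "r * r = sqrt (real n)"
  proof -
    have "(r * r)\<^sup>2 = r ^ 4" by (simp add: power2_eq_square power4_eq_xxxx mult.assoc)
    also have "\<dots> = real n" by (simp add: r_def)
    finally show ?thesis using r1 by (intro real_sqrt_unique[symmetric]) auto
  qed
  have "1 \<le> nat \<lfloor>r\<rfloor>" using r1 by linarith
  then obtain m where "2 ^ m \<le> nat \<lfloor>r\<rfloor>" "nat \<lfloor>r\<rfloor> < 2 ^ (m + 1)"
    using ex_power_ivl1[of 2 "nat \<lfloor>r\<rfloor>"] by auto
  then have "real (2 ^ m) \<le> real (nat \<lfloor>r\<rfloor>)" "real (nat \<lfloor>r\<rfloor>) + 1 \<le> real (2 ^ (m + 1))"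
    by linarith+
  moreover have "real (nat \<lfloor>r\<rfloor>) \<le> r" "r \<le> real (nat \<lfloor>r\<rfloor>) + 1"
    using r1 by linarith+
  ultimately have "real (2 ^ m) \<le> r" "r \<le> real (2 ^ (m + 1))" by linarith+
  then have m: "2 ^ m \<le> r" "r \<le> 2 * 2 ^ m" by simp_all
  have "(\<Sum>k<m. 12 * W / 2 ^ Suc k / l * (100 * 4 ^ Suc k + Q)) \<le> (\<Sum>k<m. 12 * W / l * (100 + Q) * 2 ^ Suc k)"
  proof (intro sum_mono)
    fix k
    have "(4::real) ^ Suc k = 2 ^ Suc k * 2 ^ Suc k"
      by (simp flip: power_mult_distrib)
    then have "1 / 2 ^ Suc k * (100 * 4 ^ Suc k + Q) = 100 * 2 ^ Suc k + Q / 2 ^ Suc k"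
      by (simp add: field_simps)
    also have "Q / 2 ^ Suc k \<le> Q * 2 ^ Suc k"
    proof -
      have "Q / 2 ^ Suc k \<le> Q / 1" using Q by (intro divide_left_mono one_le_power) auto
      also have "\<dots> \<le> Q * 2 ^ Suc k" using mult_left_mono[OF one_le_power[of "2::real" "Suc k"] Q] by simp
      finally show ?thesis .
    qed
    finally have "1 / 2 ^ Suc k * (100 * 4 ^ Suc k + Q) \<le> (100 + Q) * 2 ^ Suc k"
      by (simp only: distrib_right)
    then have "12 * W / l * (1 / 2 ^ Suc k * (100 * 4 ^ Suc k + Q)) \<le> 12 * W / l * ((100 + Q) * 2 ^ Suc k)"
      using W l by (intro mult_left_mono) auto
    moreover have "12 * W / p / l * z = 12 * W / l * (1 / p * z)" for p z by simp
    ultimately show "12 * W / 2 ^ Suc k / l * (100 * 4 ^ Suc k + Q) \<le> 12 * W / l * (100 + Q) * 2 ^ Suc k"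
      by (simp only: mult.assoc)
  qed
  also have "\<dots> = 12 * W / l * (100 + Q) * (\<Sum>k<m. 2 ^ Suc k)"
    by (simp only: sum_distrib_left)
  also have "\<dots> \<le> 12 * W / l * (100 + Q) * (2 * r)"
  proof (intro mult_left_mono)
    have "(\<Sum>k<m. (2::real) ^ Suc k) = 2 * (\<Sum>k<m. 2 ^ k)" by (simp add: sum_distrib_left)
    also have "\<dots> = 2 * (2 ^ m - 1)" by (simp add: sum_power2 geometric_sum)
    also have "\<dots> \<le> 2 * r" using m by simp
    finally show "(\<Sum>k<m. (2::real) ^ Suc k) \<le> 2 * r" .
  qed (use W l Q in auto)
  finally have A: "(\<Sum>k<m. 12 * W / 2 ^ Suc k / l * (100 * 4 ^ Suc k + Q)) \<le> 12 * W / l * (100 + Q) * (2 * r)" .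
  have "1 / 2 ^ m \<le> 2 / r" using m r1 by (simp add: field_simps)
  then have "4 * W * (1 / (2 * l) * (sqrt (real n) + 4 * sqrt (real n) * Q)) * (1 / 2 ^ m)
      \<le> 4 * W * (1 / (2 * l) * (sqrt (real n) + 4 * sqrt (real n) * Q)) * (2 / r)"
    using W l Q by (intro mult_left_mono) auto
  also have "\<dots> = 4 * W / l * (1 + 4 * Q) * r"
    using r1 l unfolding rr[symmetric] by (simp add: field_simps)
  finally have B: "4 * W / 2 ^ m * (1 / (2 * l) * (sqrt (real n) + 4 * sqrt (real n) * Q))
      \<le> 4 * W / l * (1 + 4 * Q) * r"
    by (simp add: ac_simps)
  have "12 * W / l * (100 + Q) * (2 * r) + 4 * W / l * (1 + 4 * Q) * r = (2404 + 40 * Q) * (r * W / l)"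
    using l by (simp add: field_simps)
  then have "(\<Sum>k<m. 12 * W / 2 ^ Suc k / l * (100 * 4 ^ Suc k + Q)) +
      4 * W / 2 ^ m * (1 / (2 * l) * (sqrt (real n) + 4 * sqrt (real n) * Q)) \<le> (2404 + 40 * Q) * (r * W / l)"
    using A B by linarith
  then show ?thesis
    using chaining[OF P S l Q mgf, where m = m] unfolding r_def
    by (meson ennreal_leI order_trans)
qed

end

section \<open>Weighted sums of isotropic vectors\<close>

lemma isotropic_constant_unique:
  assumes n: "1 \<le> n" and L: "0 < L"
    "\<And>\<xi>. \<xi> \<in> unit_sphere n \<Longrightarrow> (LINT x:C|lborel_n n. (inner_n n x \<xi>)\<^sup>2) = L\<^sup>2"
  shows "isotropic_constant n C = L"
  unfolding isotropic_constant_def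
proof (rule the_equality)
  show "L > 0 \<and> (\<forall>\<xi>\<in>unit_sphere n. (LINT x:C|lborel_n n. (inner_n n x \<xi>)\<^sup>2) = L\<^sup>2)"
    using L by blast
next
  fix L' assume L': "L' > 0 \<and> (\<forall>\<xi>\<in>unit_sphere n. (LINT x:C|lborel_n n. (inner_n n x \<xi>)\<^sup>2) = L'\<^sup>2)"
  have "(\<lambda>i. if i = 0 then 1 else 0) \<in> unit_sphere n"
    using n by (auto simp: unit_sphere_def Rn_iff L2_set_def if_distrib[of "\<lambda>x. x\<^sup>2"] cong: if_cong)
  then have "L'\<^sup>2 = L\<^sup>2" using L' L(2) by metis
  then show "L' = L" using L(1) L' by (simp add: power2_eq_iff_nonneg)
qed

lemma multi_norm_le:
  assumes n: "1 \<le> n"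
    and C: "convex_body n C" "emeasure (lborel_n n) C = 1" and L: "0 < L"
    and bary: "\<And>i. i < n \<Longrightarrow> (LINT x:C|lborel_n n. x i) = 0"
    and var: "\<And>\<xi>. \<xi> \<in> unit_sphere n \<Longrightarrow> (LINT x:C|lborel_n n. (inner_n n x \<xi>)\<^sup>2) = L\<^sup>2"
    and K: "convex_body n K" "centrally_symmetric K" and W: "0 < W"
    and mean: "(\<integral>\<^sup>+x. ennreal (gauge_norm K x * gauss n x) \<partial>lborel_n n) \<le> ennreal W"
    and \<tau>: "L2_set t {..<s} \<le> \<tau>" "0 < \<tau>"
  shows "multi_norm n s C K t \<le> (2404 + 40 * exp 8) * 12 * L * root 4 (real n) * W * \<tau>"
proof -
  have Cm [measurable]: "C \<in> sets borel" by (rule convex_body_borel[OF C(1)])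
  let ?M = "Pi\<^sub>M {..<s} (\<lambda>_. lborel_n n)"
  let ?Cs = "{..<s} \<rightarrow>\<^sub>E C"
  let ?S = "\<lambda>x i. \<Sum>j<s. t j * x j i"
  have Cs [measurable]: "?Cs \<in> sets ?M" by (intro sets_PiM_I_finite) auto
  have S [measurable]: "?S \<in> borel_measurable ?M"
  proof (rule measurable_coordI, intro borel_measurable_sum borel_measurable_times)
    fix i j assume "j \<in> {..<s}"
    then have "(\<lambda>x. x j) \<in> borel_measurable ?M"
      using measurable_component_singleton[of j "{..<s}" "\<lambda>_. lborel_n n"]
      by (simp cong: measurable_cong_sets)
    then show "(\<lambda>x. x j i) \<in> borel_measurable ?M" by (rule measurable_coord')
  qed simp
  define G where "G y = indicator (Rn n) y * gauge_norm K y" for y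
  have [measurable]: "G \<in> borel_measurable borel"
    unfolding G_def[abs_def] by (rule gauge_borel[OF K])
  have G0: "0 \<le> G y" for y by (cases "y \<in> Rn n") (auto simp: G_def gauge_nonneg[OF K])
  define P where "P = density ?M (\<lambda>x. indicator ?Cs x :: ennreal)"
  have int_P: "(\<integral>\<^sup>+x. f x \<partial>P) = (\<integral>\<^sup>+x. indicator ?Cs x * f x \<partial>?M)"
    if "f \<in> borel_measurable ?M" for f
    unfolding P_def using that by (intro nn_integral_density) auto
  have "emeasure ?M ?Cs = (\<Prod>j<s. emeasure (lborel_n n) C)"
    by (intro lborel_n_prod.emeasure_PiM) auto
  then have "prob_space P"
    using C(2) by (intro prob_spaceI) (simp add: P_def emeasure_density)
  have "(\<integral>\<^sup>+x. ennreal (G (?S x)) \<partial>P)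
      \<le> ennreal ((2404 + 40 * exp 8) * (root 4 (real n) * W / (1 / (12 * L * \<tau>))))"
    unfolding G_def
  proof (rule gauge_mean_le[OF n K W mean \<open>prob_space P\<close>])
    show "?S \<in> borel_measurable P" using S by (simp add: P_def)
    fix \<theta> assume \<theta>: "\<theta> \<in> Rn n" "norm_n n \<theta> \<le> 1"
    show "(\<integral>\<^sup>+x. ennreal (exp (1 / (12 * L * \<tau>) * inner_n n (?S x) \<theta>)) \<partial>P) \<le> ennreal (exp 8)"
      using exp_moment_weighted_sum[OF C L bary var \<theta> \<tau>]
      by (subst int_P) (auto simp: mult.commute)
  qed (use L \<tau> in auto)
  also have "(\<integral>\<^sup>+x. ennreal (G (?S x)) \<partial>P) = (\<integral>\<^sup>+x. ennreal (indicator ?Cs x *\<^sub>R G (?S x)) \<partial>?M)"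
    by (subst int_P) (auto simp: indicator_def intro!: nn_integral_cong)
  finally have nn: "(\<integral>\<^sup>+x. ennreal (indicator ?Cs x *\<^sub>R G (?S x)) \<partial>?M)
      \<le> ennreal ((2404 + 40 * exp 8) * (root 4 (real n) * W / (1 / (12 * L * \<tau>))))" .
  have GS: "G (?S x) = gauge_norm K (?S x)" if "x \<in> ?Cs" for x
  proof -
    have "x j i = 0" if "j < s" "n \<le> i" for i j
      using \<open>x \<in> ?Cs\<close> that convex_body_subset[OF C(1)] by (auto simp: PiE_iff Rn_iff)
    then have "?S x \<in> Rn n" by (simp add: Rn_iff)
    then show ?thesis by (simp add: G_def)
  qed
  have "multi_norm n s C K t = (LINT x|?M. indicator ?Cs x *\<^sub>R G (?S x))"
    unfolding multi_norm_def set_lebesgue_integral_def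
    by (intro Bochner_Integration.integral_cong refl) (simp add: indicator_def GS)
  also have "\<dots> = enn2real (\<integral>\<^sup>+x. ennreal (indicator ?Cs x *\<^sub>R G (?S x)) \<partial>?M)"
    using G0 by (intro integral_eq_nn_integral) auto
  also have "\<dots> \<le> (2404 + 40 * exp 8) * (root 4 (real n) * W / (1 / (12 * L * \<tau>)))"
    using W L \<tau> by (intro enn2real_leI nn) auto
  also have "\<dots> = (2404 + 40 * exp 8) * 12 * L * root 4 (real n) * W * \<tau>"
    by simp
  finally show ?thesis .
qed

theorem theorem1p4:
  shows "\<exists>c::real. c > 0 \<and>
    (\<forall>(n::nat) (s::nat) (C :: (nat \<Rightarrow> real) set) (K :: (nat \<Rightarrow> real) set)
       (t :: nat \<Rightarrow> real) (\<sigma> :: (nat \<Rightarrow> real) measure).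
      n \<ge> 1 \<longrightarrow> s \<ge> 1 \<longrightarrow>
      convex_body n C \<longrightarrow> isotropic n C \<longrightarrow>
      convex_body n K \<longrightarrow> centrally_symmetric K \<longrightarrow>
      rotation_invariant_prob n \<sigma> \<longrightarrow>
      multi_norm n s C K t
        \<le> c * (isotropic_constant n C * max (root 4 (real n)) (sqrt (ln (1 + real s))))
            * sqrt (real n) * mean_norm \<sigma> K * L2_set t {..<s})"
proof (intro exI conjI allI impI)
  show "0 < (2404 + 40 * exp 8) * (12 :: real)" by (simp add: add_pos_pos)
  fix n s :: nat and C K t \<sigma>
  assume n: "1 \<le> n" and C: "convex_body n C" and iso: "isotropic n C"
    and K: "convex_body n K" "centrally_symmetric K" and \<sigma>: "rotation_invariant_prob n \<sigma>"
  let ?c = "(2404 + 40 * exp 8) * (12 :: real)"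
  obtain L where L: "0 < L" "\<And>\<xi>. \<xi> \<in> unit_sphere n \<Longrightarrow> (LINT x:C|lborel_n n. (inner_n n x \<xi>)\<^sup>2) = L\<^sup>2"
    using iso by (auto simp: isotropic_def)
  have vol: "emeasure (lborel_n n) C = 1" and bary: "\<And>i. i < n \<Longrightarrow> (LINT x:C|lborel_n n. x i) = 0"
    using iso by (auto simp: isotropic_def)
  have LC: "isotropic_constant n C = L" by (rule isotropic_constant_unique[OF n L])
  define M where "M = mean_norm \<sigma> K"
  define T where "T = L2_set t {..<s}"
  obtain b where b: "0 \<le> b"
    "\<And>x y. x \<in> Rn n \<Longrightarrow> y \<in> Rn n \<Longrightarrow> gauge_norm K x \<le> gauge_norm K y + b * norm_n n (x - y)"
    using gauge_lipschitz[OF K] by blast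
  have avg: "(\<integral>\<^sup>+x. ennreal (gauge_norm K x * gauss n x) \<partial>lborel_n n) \<le> ennreal (sqrt (real n) * M)"
    unfolding M_def mean_norm_def
    by (rule gauss_average_le[OF n \<sigma> gauge_nonneg[OF K] gauge_scale[OF K] b(2,1)])
  have M0: "0 \<le> M"
    unfolding M_def mean_norm_def
    by (intro integral_nonneg_AE AE_I2) (auto simp: space_sphere[OF n \<sigma>] unit_sphereD gauge_nonneg[OF K])
  have T0: "0 \<le> T" by (simp add: T_def)
  \<comment> \<open>The bounds \<open>W\<close> and \<open>\<tau>\<close> have to be positive; approximation from above covers \<open>t = 0\<close>.\<close>
  have bound: "multi_norm n s C K t \<le> ?c * L * root 4 (real n) * (sqrt (real n) * M + e) * (T + e)"
    if e: "0 < e" for e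
  proof (rule multi_norm_le[OF n C vol L(1) bary L(2) K])
    show "0 < sqrt (real n) * M + e" using M0 e by (intro add_nonneg_pos) auto
    show "(\<integral>\<^sup>+x. ennreal (gauge_norm K x * gauss n x) \<partial>lborel_n n) \<le> ennreal (sqrt (real n) * M + e)"
      using e by (intro order_trans[OF avg] ennreal_leI) auto
    show "L2_set t {..<s} \<le> T + e" "0 < T + e"
      using e T0 by (simp_all add: T_def add_nonneg_pos)
  qed
  have "((\<lambda>e. ?c * L * root 4 (real n) * (sqrt (real n) * M + e) * (T + e)) \<longlongrightarrow>
      ?c * L * root 4 (real n) * (sqrt (real n) * M + 0) * (T + 0)) (at_right 0)"
    by (intro tendsto_intros)
  moreover have "\<forall>\<^sub>F e in at_right 0. multi_norm n s C K t
      \<le> ?c * L * root 4 (real n) * (sqrt (real n) * M + e) * (T + e)"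
    using eventually_at_right_less[of "0::real"] by eventually_elim (rule bound)
  ultimately have "multi_norm n s C K t \<le> ?c * L * root 4 (real n) * (sqrt (real n) * M + 0) * (T + 0)"
    by (rule tendsto_lowerbound) simp
  also have "\<dots> = ?c * (L * root 4 (real n)) * sqrt (real n) * M * T" by simp
  also have "\<dots> \<le> ?c * (L * max (root 4 (real n)) (sqrt (ln (1 + real s)))) * sqrt (real n) * M * T"
    using L(1) M0 T0 by (intro mult_right_mono mult_left_mono) auto
  finally show "multi_norm n s C K t
      \<le> ?c * (isotropic_constant n C * max (root 4 (real n)) (sqrt (ln (1 + real s))))
        * sqrt (real n) * mean_norm \<sigma> K * L2_set t {..<s}"
    by (simp only: LC M_def T_def)
qed

end
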